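(* Let $q$ be a prime power and let $F/\mathbf{F}_q$ be an algebraic function field of one variable with genus $g(F)$. Let $P_1,\ldots,P_n,Q_1,\ldots,Q_L$ be pairwise distinct $\mathbf{F}_q$-rational places of $F/\mathbf{F}_q$, and let $G$ be a divisor of $F/\mathbf{F}_q$ whose support contains none of $P_1,\ldots,P_n,Q_1,\ldots,Q_L$. Assume \[ L = \dim \mathcal{L}(G) - \dim \mathcal{L}(G-Q_1-\cdots-Q_L), \qquad 0=\dim\mathcal{L}(G-P_1-\cdots-P_n). \] Consider the quantum ramp secret sharing scheme with secret space $\bigotimes_{i=1}^L\mathcal{G}_i$ and share space $\bigotimes_{j=1}^n\mathcal{H}_j$ (all $\mathcal{G}_i,\mathcal{H}_j$ being $q$-dimensional with orthonormal basis $\{|a\rangle : a\in\mathbf{F}_q\}$), defined as the complex linear isometric embedding that maps each basis state $|\vec{s}\rangle$, $\vec{s}\in\mathbf{F}_q^L$, to \[ \frac{1}{\sqrt{q^{\dim\mathcal{L}(G-Q_1-\cdots-Q_L)}}}\sum_{\substack{h\in\mathcal{L}(G)\\ (h(Q_1),\ldots,h(Q_L))=\vec{s}}} |h(P_1)\rangle\otimes|h(P_2)\rangle\otimes\cdots\otimes|h(P_n)\rangle , \] where $\mathcal{H}_j$ is the $j$-th share. Then for $I\subset\{1,\ldots,L\}$ and $J\subset\{1,\ldots,n\}$, the scheme is strongly secure with respect to $I$ and $J$ whenever \[ |J| \le |\overline{I}| + \min\{\deg G - L - 2g(F)+1,\; n-1-\deg G\}, \] where $\overline{I}=\{1,\ldots,L\}\setminus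 I$.
   Context: $\mathcal{L}(G)$ denotes the Riemann–Roch space of the divisor $G$ (a finite-dimensional $\mathbf{F}_q$-vector space), and $h(P)$ is the evaluation of $h$ at a rational place $P$. For $I\subseteq\{1,\ldots,L\}$ let $\mathcal{G}_I=\bigotimes_{i\in I}\mathcal{G}_i$ and $\mathcal{G}_{\overline{I}}=\bigotimes_{i\in\overline{I}}\mathcal{G}_i$. Definition (strong security): a quantum ramp secret sharing scheme (an isometric encoding of the secret space into the share space) is strongly secure with respect to $I$ and $J$ if the quantum state $\sigma_J$ of the shares in $\bigotimes_{j\in J}\mathcal{H}_j$ (the reduced state of the encoded secret) is always the same state regardless of the quantum state $\rho_I$, when the whole quantum secret is in the state $\rho_I\otimes\rho_{\overline{I},\mathrm{mix}}$, where $\rho_I$ is an arbitrary state on $\mathcal{G}_I$ and $\rho_{\overline{I},\mathrm{mix}}$ is the fully mixed state on $\mathcal{G}_{\overline{I}}$. *)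

theory Defs
  imports "HOL-Computational_Algebra.Polynomial" "HOL-Library.FuncSet"
begin

section \<open>Algebraic function fields F/K (Stichtenoth), F = UNIV of type 'f, K the constant field\<close>

definition subfield :: "'f::field set \<Rightarrow> bool" where
  "subfield K \<longleftrightarrow> 0 \<in> K \<and> 1 \<in> K \<and>
     (\<forall>a\<in>K. \<forall>b\<in>K. a + b \<in> K \<and> a * b \<in> K \<and> - a \<in> K) \<and> (\<forall>a\<in>K. inverse a \<in> K)"

definition transcendental_over :: "'f::field set \<Rightarrow> 'f \<Rightarrow> bool" where
  "transcendental_over K x \<longleftrightarrow>
     (\<forall>p. set (coeffs p) \<subseteq> K \<longrightarrow> p \<noteq> 0 \<longrightarrow> poly p x \<noteq> 0)"

definition rat_fun_field :: "'f::field set \<Rightarrow> 'f \<Rightarrow> 'f set" where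
  "rat_fun_field K x = {poly a x / poly b x | a b.
      set (coeffs a) \<subseteq> K \<and> set (coeffs b) \<subseteq> K \<and> poly b x \<noteq> 0}"

definition function_field :: "'f::field set \<Rightarrow> bool" where
  "function_field K \<longleftrightarrow> subfield K \<and>
     (\<exists>x. transcendental_over K x \<and>
        (\<exists>B. finite B \<and> (\<forall>z. \<exists>c. (\<forall>b\<in>B. c b \<in> rat_fun_field K x) \<and> z = (\<Sum>b\<in>B. c b * b))))"

text \<open>Valuation rings of F/K; a place P is represented by its valuation ring R_P
  (P itself is max_ideal R_P; this correspondence is bijective).\<close>
definition valuation_ring :: "'f::field set \<Rightarrow> 'f set \<Rightarrow> bool" where
  "valuation_ring K R \<longleftrightarrow> K \<subset> R \<and> R \<noteq> UNIV \<and>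
     (\<forall>a\<in>R. \<forall>b\<in>R. a + b \<in> R \<and> a * b \<in> R \<and> - a \<in> R) \<and>
     (\<forall>z. z \<in> R \<or> inverse z \<in> R)"

definition places :: "'f::field set \<Rightarrow> 'f set set" where
  "places K = {R. valuation_ring K R}"

definition max_ideal :: "'f::field set \<Rightarrow> 'f set" where
  "max_ideal R = {z \<in> R. z = 0 \<or> inverse z \<notin> R}"

definition uniformizer :: "'f::field set \<Rightarrow> 'f \<Rightarrow> bool" where
  "uniformizer R t \<longleftrightarrow> t \<in> R \<and> max_ideal R = {t * a | a. a \<in> R}"

text \<open>Normalized discrete valuation v_P(z), z nonzero.\<close>
definition ord :: "'f::field set \<Rightarrow> 'f \<Rightarrow> int" where
  "ord R z = (THE n::int. \<exists>u. u \<in> R \<and> u \<noteq> 0 \<and> inverse u \<in> R \<and>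
                 z = (SOME t. uniformizer R t) powi n * u)"

definition kdim :: "'f::field set \<Rightarrow> 'f set \<Rightarrow> nat" where
  "kdim K V = (THE d. \<exists>b. (\<forall>i<d. b i \<in> V) \<and>
      (\<forall>c. (\<forall>i<d. c i \<in> K) \<longrightarrow> (\<Sum>i<d. c i * b i) = 0 \<longrightarrow> (\<forall>i<d. c i = 0)) \<and>
      V = {\<Sum>i<d. c i * b i | c. \<forall>i<d. c i \<in> K})"

definition place_degree :: "'f::field set \<Rightarrow> 'f set \<Rightarrow> nat" where
  "place_degree K R = (THE d. \<exists>b. (\<forall>i<d. b i \<in> R) \<and>
      (\<forall>c. (\<forall>i<d. c i \<in> K) \<longrightarrow> (\<Sum>i<d. c i * b i) \<in> max_ideal R \<longrightarrow> (\<forall>i<d. c i = 0)) \<and>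
      (\<forall>z\<in>R. \<exists>c. (\<forall>i<d. c i \<in> K) \<and> z - (\<Sum>i<d. c i * b i) \<in> max_ideal R))"

definition rational_place :: "'f::field set \<Rightarrow> 'f set \<Rightarrow> bool" where
  "rational_place K R \<longleftrightarrow> R \<in> places K \<and> place_degree K R = 1"

definition divisor :: "'f::field set \<Rightarrow> ('f set \<Rightarrow> int) \<Rightarrow> bool" where
  "divisor K D \<longleftrightarrow> finite {R. D R \<noteq> 0} \<and> (\<forall>R. D R \<noteq> 0 \<longrightarrow> R \<in> places K)"

definition div_deg :: "'f::field set \<Rightarrow> ('f set \<Rightarrow> int) \<Rightarrow> int" where
  "div_deg K D = (\<Sum>R\<in>{R. D R \<noteq> 0}. D R * int (place_degree K R))"

definition place_div :: "'f set \<Rightarrow> ('f set \<Rightarrow> int)" where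
  "place_div R = (\<lambda>X. if X = R then 1 else 0)"

definition places_sum :: "(nat \<Rightarrow> 'f set) \<Rightarrow> nat set \<Rightarrow> ('f set \<Rightarrow> int)" where
  "places_sum P S = (\<lambda>X. \<Sum>i\<in>S. place_div (P i) X)"

definition RR_space :: "'f::field set \<Rightarrow> ('f set \<Rightarrow> int) \<Rightarrow> 'f set" where
  "RR_space K A = {z. z = 0 \<or> (\<forall>R\<in>places K. ord R z \<ge> - A R)}"

definition ell :: "'f::field set \<Rightarrow> ('f set \<Rightarrow> int) \<Rightarrow> nat" where
  "ell K A = kdim K (RR_space K A)"

definition genus :: "'f::field set \<Rightarrow> int" where
  "genus K = (GREATEST m. \<exists>A. divisor K A \<and> m = div_deg K A - int (ell K A) + 1)"

text \<open>Evaluation h(P) at a rational place (h in R_P).\<close>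
definition eval_at :: "'f::field set \<Rightarrow> 'f set \<Rightarrow> 'f \<Rightarrow> 'f" where
  "eval_at K R h = (THE a. a \<in> K \<and> h - a \<in> max_ideal R)"

text \<open>An operator on the tensor product of copies of C^K indexed by a set X of positions
  is a matrix indexed by basis vectors, i.e. elements of PiE X (\<lambda>_. K).\<close>
definition density_op :: "'b set \<Rightarrow> ('b \<Rightarrow> 'b \<Rightarrow> complex) \<Rightarrow> bool" where
  "density_op B \<rho> \<longleftrightarrow>
     (\<forall>a\<in>B. \<forall>b\<in>B. \<rho> b a = cnj (\<rho> a b)) \<and>
     (\<forall>v. Im (\<Sum>a\<in>B. \<Sum>b\<in>B. cnj (v a) * \<rho> a b * v b) = 0 \<and>
          Re (\<Sum>a\<in>B. \<Sum>b\<in>B. cnj (v a) * \<rho> a b * v b) \<ge> 0) \<and>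
     (\<Sum>a\<in>B. \<rho> a a) = 1"

definition tensor_mixed ::
  "'f set \<Rightarrow> nat \<Rightarrow> nat set \<Rightarrow> ((nat \<Rightarrow> 'f) \<Rightarrow> (nat \<Rightarrow> 'f) \<Rightarrow> complex) \<Rightarrow>
   (nat \<Rightarrow> 'f) \<Rightarrow> (nat \<Rightarrow> 'f) \<Rightarrow> complex" where
  "tensor_mixed K L I \<rho>I s s' =
     \<rho>I (restrict s I) (restrict s' I) *
     (if (\<forall>i\<in>{1..L} - I. s i = s' i)
      then 1 / of_nat (card K ^ card ({1..L} - I)) else 0)"

definition reduced_state ::
  "'f set \<Rightarrow> nat \<Rightarrow> nat set \<Rightarrow> ((nat \<Rightarrow> 'f) \<Rightarrow> (nat \<Rightarrow> 'f) \<Rightarrow> complex) \<Rightarrow>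
   (nat \<Rightarrow> 'f) \<Rightarrow> (nat \<Rightarrow> 'f) \<Rightarrow> complex" where
  "reduced_state K n J \<sigma> a b =
     (\<Sum>z\<in>PiE ({1..n} - J) (\<lambda>_. K).
        \<sigma> (\<lambda>j. if j \<in> J then a j else z j) (\<lambda>j. if j \<in> J then b j else z j))"

definition strongly_secure ::
  "'f set \<Rightarrow> nat \<Rightarrow> nat \<Rightarrow>
   (((nat \<Rightarrow> 'f) \<Rightarrow> (nat \<Rightarrow> 'f) \<Rightarrow> complex) \<Rightarrow> ((nat \<Rightarrow> 'f) \<Rightarrow> (nat \<Rightarrow> 'f) \<Rightarrow> complex)) \<Rightarrow>
   nat set \<Rightarrow> nat set \<Rightarrow> bool" where
  "strongly_secure K L n enc I J \<longleftrightarrow>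
     (\<forall>\<rho>1 \<rho>2. density_op (PiE I (\<lambda>_. K)) \<rho>1 \<longrightarrow> density_op (PiE I (\<lambda>_. K)) \<rho>2 \<longrightarrow>
        (\<forall>a\<in>PiE J (\<lambda>_. K). \<forall>b\<in>PiE J (\<lambda>_. K).
           reduced_state K n J (enc (tensor_mixed K L I \<rho>1)) a b =
           reduced_state K n J (enc (tensor_mixed K L I \<rho>2)) a b))"

text \<open>Amplitude <y| V |s> of the isometric encoding V.\<close>
definition qrss_amp ::
  "'f::field set \<Rightarrow> ('f set \<Rightarrow> int) \<Rightarrow> (nat \<Rightarrow> 'f set) \<Rightarrow> (nat \<Rightarrow> 'f set) \<Rightarrow> nat \<Rightarrow> nat \<Rightarrow>
   (nat \<Rightarrow> 'f) \<Rightarrow> (nat \<Rightarrow> 'f) \<Rightarrow> complex" where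
  "qrss_amp K G P Q n L s y =
     complex_of_real (1 / sqrt (real (card K ^ ell K (G - places_sum Q {1..L})))) *
     of_nat (card {h \<in> RR_space K G. (\<forall>i\<in>{1..L}. eval_at K (Q i) h = s i) \<and>
                                     (\<forall>j\<in>{1..n}. eval_at K (P j) h = y j)})"

definition qrss_encode ::
  "'f::field set \<Rightarrow> ('f set \<Rightarrow> int) \<Rightarrow> (nat \<Rightarrow> 'f set) \<Rightarrow> (nat \<Rightarrow> 'f set) \<Rightarrow> nat \<Rightarrow> nat \<Rightarrow>
   ((nat \<Rightarrow> 'f) \<Rightarrow> (nat \<Rightarrow> 'f) \<Rightarrow> complex) \<Rightarrow> (nat \<Rightarrow> 'f) \<Rightarrow> (nat \<Rightarrow> 'f) \<Rightarrow> complex" where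
  "qrss_encode K G P Q n L \<rho> y y' =
     (\<Sum>s\<in>PiE {1..L} (\<lambda>_. K). \<Sum>s'\<in>PiE {1..L} (\<lambda>_. K).
        qrss_amp K G P Q n L s y * \<rho> s s' * cnj (qrss_amp K G P Q n L s' y'))"

end

theory Submission
  imports Defs
begin

text \<open>
  If two functions of \<open>L(G)\<close> agree at the \<open>Q\<^sub>i\<close> with \<open>i \<notin> I\<close> and at the \<open>P\<^sub>j\<close> with
  \<open>j \<notin> J\<close>, their difference lies in a Riemann--Roch space of negative degree, hence they are equal;
  so tracing out the shares outside \<open>J\<close> leaves only the diagonal of \<open>\<rho>\<^sub>I\<close>.  The weight of a
  diagonal entry is a count of functions with prescribed values, and it is the same for all entries because
  \<open>L(G)\<close> contains functions that vanish at the \<open>P\<^sub>j\<close>, \<open>j \<in> J\<close>, and take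
  arbitrary values at the \<open>Q\<^sub>i\<close>, \<open>i \<in> I\<close>.  Since the trace is 1, \<open>\<rho>\<^sub>I\<close> drops out.

  Such functions exist as soon as \<open>L(A) \<noteq> L(A + R)\<close> for rational \<open>R\<close> and
  \<open>deg A \<ge> 2g - 1\<close>.  Only this consequence of the Riemann--Roch theorem is needed, and it can be had without
  adeles: the rational place \<open>R\<close> makes the first cohomology of \<open>A\<close> the quotient of \<open>F\<close> by the
  sum of the functions bounded by \<open>A\<close> away from \<open>R\<close> and those bounded by \<open>A\<close> at \<open>R\<close>.
\<close>

section \<open>Linear algebra over a subfield\<close>

text \<open>The two terms of the minimum in the bound on |J| are two degree conditions: n - 1 - deg
  G makes the degree negative in the uniqueness argument, and deg G - L - 2g + 1 brings the degree
  up to 2g - 1 in the existence argument. The definitions do not provide that places are discrete,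
  that their degrees are finite, or that the maximum in \<open>genus\<close> is attained. All of
  this is derived from \<open>function_field\<close>, mainly through one principle: elements that
  are independent over \<open>K\<close> modulo \<open>y\<close> at the zeros of \<open>y\<close> are
  independent over K[y], and the size of such a family is bounded by the degree of F over K(y).
  Since K[y] is not a field, relations are kept free of denominators and the elimination of unknowns
  is done over subrings. That L(0) is no larger than \<open>K\<close> is proved with a rational
  place. Some \<open>Q i\<close> with \<open>i\<close> in \<open>I\<close> serves, so the case of
  empty \<open>I\<close> is separate.\<close>

definition closed_ring :: "'f::field set \<Rightarrow> bool" where
  "closed_ring S \<longleftrightarrow> 0 \<in> S \<and> 1 \<in> S \<and> (\<forall>a\<in>S. \<forall>b\<in>S. a + b \<in> S \<and> a * b \<in> S) \<and> (\<forall>a\<in>S. - a \<in> S)"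

lemma closed_ringD:
  assumes "closed_ring S"
  shows "0 \<in> S" "1 \<in> S" "a \<in> S \<Longrightarrow> b \<in> S \<Longrightarrow> a + b \<in> S"
    "a \<in> S \<Longrightarrow> b \<in> S \<Longrightarrow> a * b \<in> S" "a \<in> S \<Longrightarrow> - a \<in> S"
    "a \<in> S \<Longrightarrow> b \<in> S \<Longrightarrow> a - b \<in> S"
  using assms unfolding closed_ring_def by (blast, blast, blast, blast, blast, metis diff_conv_add_uminus)

lemma closed_ring_sum:
  assumes "closed_ring S" "\<And>i. i \<in> A \<Longrightarrow> f i \<in> S"
  shows "sum f A \<in> S"
  using assms(2) by (induction A rule: infinite_finite_induct) (auto intro: closed_ringD[OF assms(1)])

lemma closed_ring_prod:
  assumes "closed_ring S" "\<And>i. i \<in> A \<Longrightarrow> f i \<in> S"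
  shows "prod f A \<in> S"
  using assms(2) by (induction A rule: infinite_finite_induct) (auto intro: closed_ringD[OF assms(1)])

lemma closed_ring_power: "closed_ring S \<Longrightarrow> a \<in> S \<Longrightarrow> a ^ n \<in> S"
  by (induction n) (auto intro: closed_ringD)

text \<open>Gaussian elimination without fractions: the pivot unknown is eliminated by
  cross-multiplication, so the solution stays in the subring \<open>S\<close>. It serves for
  \<open>K\<close>, for K[y] and for K(x) alike.\<close>

lemma underdetermined_system:
  fixes a :: "'i \<Rightarrow> 'k \<Rightarrow> 'f::field"
  assumes S: "closed_ring S" and "finite B" "finite A" "card B < card A"
    and "\<And>i k. i \<in> A \<Longrightarrow> k \<in> B \<Longrightarrow> a i k \<in> S"
  shows "\<exists>c. (\<forall>i\<in>A. c i \<in> S) \<and> (\<exists>i\<in>A. c i \<noteq> 0) \<and> (\<forall>k\<in>B. (\<Sum>i\<in>A. c i * a i k) = 0)"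
  using assms(2-)
proof (induction B arbitrary: A a rule: finite_induct)
  case empty
  then show ?case using closed_ringD(2)[OF S] by (intro exI[of _ "\<lambda>_. 1"]) (auto simp: card_gt_0_iff)
next
  case (insert k B)
  show ?case
  proof (cases "\<forall>i\<in>A. a i k = 0")
    case True
    have "\<exists>c. (\<forall>i\<in>A. c i \<in> S) \<and> (\<exists>i\<in>A. c i \<noteq> 0) \<and> (\<forall>k\<in>B. (\<Sum>i\<in>A. c i * a i k) = 0)"
      using insert.prems insert.hyps by (intro insert.IH) auto
    then obtain c where c: "\<forall>i\<in>A. c i \<in> S" "\<exists>i\<in>A. c i \<noteq> 0" "\<forall>k\<in>B. (\<Sum>i\<in>A. c i * a i k) = 0"
      by blast
    show ?thesis by (rule exI[of _ c]) (use c True in auto)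
  next
    case False
    then obtain p where p: "p \<in> A" "a p k \<noteq> 0" by blast
    define A' where "A' = A - {p}"
    define a' where "a' = (\<lambda>i j. a p k * a i j - a i k * a p j)"
    have fA': "finite A'" and pA': "p \<notin> A'" and AA: "A = insert p A'"
      using p insert.prems by (auto simp: A'_def)
    have "card B < card A'" using insert.prems insert.hyps p by (simp add: A'_def)
    moreover have "a' i j \<in> S" if "i \<in> A'" "j \<in> B" for i j
      unfolding a'_def using that insert.prems(3) p
      by (auto simp: A'_def intro!: closed_ringD[OF S])
    ultimately have "\<exists>c. (\<forall>i\<in>A'. c i \<in> S) \<and> (\<exists>i\<in>A'. c i \<noteq> 0) \<and> (\<forall>k\<in>B. (\<Sum>i\<in>A'. c i * a' i k) = 0)"
      using fA' by (intro insert.IH) auto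
    then obtain c where c: "\<forall>i\<in>A'. c i \<in> S" "\<exists>i\<in>A'. c i \<noteq> 0" "\<forall>k\<in>B. (\<Sum>i\<in>A'. c i * a' i k) = 0"
      by blast
    define s where "s = (\<Sum>i\<in>A'. c i * a i k)"
    \<comment> \<open>Back substitution: the solution of the reduced system is scaled by the pivot
      \<open>a p k\<close>, so that the entry at \<open>p\<close> can be \<open>- s\<close> without
      division.\<close>
    define c' where "c' = (\<lambda>i. if i = p then - s else c i * a p k)"
    have sS: "s \<in> S" unfolding s_def using c(1) insert.prems(3) A'_def
      by (intro closed_ring_sum[OF S] closed_ringD[OF S]) auto
    have sumc: "(\<Sum>i\<in>A. c' i * a i j) = - s * a p j + (\<Sum>i\<in>A'. c i * a p k * a i j)" for j
      unfolding AA using fA' pA' by (auto simp: c'_def intro!: sum.cong)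
    have 1: "(\<Sum>i\<in>A. c' i * a i k) = 0"
      unfolding sumc s_def by (simp add: sum_distrib_right sum_distrib_left algebra_simps)
    have 2: "(\<Sum>i\<in>A. c' i * a i j) = 0" if "j \<in> B" for j
    proof -
      have "(\<Sum>i\<in>A. c' i * a i j) = (\<Sum>i\<in>A'. c i * a' i j)"
        unfolding sumc s_def a'_def
        by (simp add: sum_distrib_right sum_distrib_left algebra_simps sum_subtractf)
      then show ?thesis using c(3) that by simp
    qed
    show ?thesis
    proof (rule exI[of _ c'], intro conjI)
      show "\<forall>i\<in>A. c' i \<in> S"
        using c(1) sS p insert.prems(3) by (auto simp: c'_def AA intro!: closed_ringD[OF S])
      show "\<exists>i\<in>A. c' i \<noteq> 0" using c(2) p(2) pA' by (auto simp: c'_def AA)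
      show "\<forall>k\<in>insert k B. (\<Sum>i\<in>A. c' i * a i k) = 0" using 1 2 by auto
    qed
  qed
qed

section \<open>Independence, spanning and dimension in quotients\<close>

definition lin_indep_mod :: "'f::field set \<Rightarrow> 'f set \<Rightarrow> 'i set \<Rightarrow> ('i \<Rightarrow> 'f) \<Rightarrow> bool" where
  "lin_indep_mod K W A b \<longleftrightarrow>
     (\<forall>c. (\<forall>i\<in>A. c i \<in> K) \<longrightarrow> (\<Sum>i\<in>A. c i * b i) \<in> W \<longrightarrow> (\<forall>i\<in>A. c i = 0))"

definition spans_mod :: "'f::field set \<Rightarrow> 'f set \<Rightarrow> 'f set \<Rightarrow> 'i set \<Rightarrow> ('i \<Rightarrow> 'f) \<Rightarrow> bool" where
  "spans_mod K V W A b \<longleftrightarrow>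
     (\<forall>z\<in>V. \<exists>c. (\<forall>i\<in>A. c i \<in> K) \<and> z - (\<Sum>i\<in>A. c i * b i) \<in> W)"

text \<open>The dimension of the image of \<open>V\<close> in F/W. \<open>W\<close> need not lie in
  \<open>V\<close>, and \<open>W = {0}\<close> gives the ordinary dimension; so \<open>ell\<close>,
  place degrees and codimensions in F are instances of one notion.\<close>

definition has_dim :: "'f::field set \<Rightarrow> 'f set \<Rightarrow> 'f set \<Rightarrow> nat \<Rightarrow> bool" where
  "has_dim K V W d \<longleftrightarrow>
     (\<exists>b. (\<forall>i<d. b i \<in> V) \<and> lin_indep_mod K W {..<d} b \<and> spans_mod K V W {..<d} b)"

definition ksubspace :: "'f::field set \<Rightarrow> 'f set \<Rightarrow> bool" where
  "ksubspace K V \<longleftrightarrow> 0 \<in> V \<and> (\<forall>a\<in>V. \<forall>b\<in>V. a + b \<in> V) \<and> (\<forall>c\<in>K. \<forall>a\<in>V. c * a \<in> V)"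

lemma ksubspaceD:
  assumes "ksubspace K V"
  shows "0 \<in> V" "a \<in> V \<Longrightarrow> b \<in> V \<Longrightarrow> a + b \<in> V" "c \<in> K \<Longrightarrow> a \<in> V \<Longrightarrow> c * a \<in> V"
  using assms unfolding ksubspace_def by blast+

lemma ksubspace_sum:
  assumes "ksubspace K V" "\<And>i. i \<in> A \<Longrightarrow> f i \<in> V"
  shows "sum f A \<in> V"
  using assms(2) by (induction A rule: infinite_finite_induct) (auto intro: ksubspaceD[OF assms(1)])

lemma ksubspace_lincomb:
  assumes "ksubspace K V" "\<And>i. i \<in> A \<Longrightarrow> b i \<in> V" "\<And>i. i \<in> A \<Longrightarrow> c i \<in> K"
  shows "(\<Sum>i\<in>A. c i * b i) \<in> V"
  by (intro ksubspace_sum[OF assms(1)] ksubspaceD(3)[OF assms(1)] assms)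

lemma ksubspace_zero: "ksubspace K {0}"
  unfolding ksubspace_def by auto

lemma lin_indep_modD:
  "lin_indep_mod K W A b \<Longrightarrow> (\<And>i. i \<in> A \<Longrightarrow> c i \<in> K) \<Longrightarrow> (\<Sum>i\<in>A. c i * b i) \<in> W \<Longrightarrow> i \<in> A \<Longrightarrow> c i = 0"
  unfolding lin_indep_mod_def by blast

locale const_field =
  fixes K :: "'f::field set"
  assumes subfield: "subfield K"
begin

lemma closed_ring_K: "closed_ring K"
  using subfield unfolding subfield_def closed_ring_def by blast

lemmas K_ring = closed_ringD[OF closed_ring_K]

lemma K_inverse: "a \<in> K \<Longrightarrow> inverse a \<in> K"
  using subfield unfolding subfield_def by blast

lemma K_divide: "a \<in> K \<Longrightarrow> b \<in> K \<Longrightarrow> a / b \<in> K"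
  by (simp add: divide_inverse K_inverse K_ring)

lemma ksubspace_uminus: "ksubspace K V \<Longrightarrow> a \<in> V \<Longrightarrow> - a \<in> V"
  using ksubspaceD(3)[of K V "-1" a] K_ring(2,5) by simp

lemma ksubspace_diff: "ksubspace K V \<Longrightarrow> a \<in> V \<Longrightarrow> b \<in> V \<Longrightarrow> a - b \<in> V"
  using ksubspace_uminus[of V b] ksubspaceD(2)[of K V a "-b"] by simp

lemma ksubspace_times: "ksubspace K V \<Longrightarrow> ksubspace K ((*) y ` V)"
  unfolding ksubspace_def
  by (auto simp: image_iff distrib_left[symmetric] mult.left_commute[of _ y])

text \<open>Modulo \<open>W\<close> each \<open>b i\<close> is a combination of the
  \<open>v j\<close>. With more rows than columns, the coefficient matrix has a nontrivial relation
  between its rows, and this would be a dependence of the \<open>b i\<close> modulo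
  \<open>W\<close>.\<close>

lemma card_indep_le_card_span:
  assumes W: "ksubspace K W" and fin: "finite A" "finite B"
    and ind: "lin_indep_mod K W A b" and V: "\<And>i. i \<in> A \<Longrightarrow> b i \<in> V"
    and sp: "spans_mod K V W B v"
  shows "card A \<le> card B"
proof (rule ccontr)
  assume "\<not> card A \<le> card B"
  have "\<forall>i\<in>A. \<exists>c. (\<forall>j\<in>B. c j \<in> K) \<and> b i - (\<Sum>j\<in>B. c j * v j) \<in> W"
    using sp V unfolding spans_mod_def by blast
  then obtain a where a: "\<And>i j. i \<in> A \<Longrightarrow> j \<in> B \<Longrightarrow> a i j \<in> K"
    "\<And>i. i \<in> A \<Longrightarrow> b i - (\<Sum>j\<in>B. a i j * v j) \<in> W" by (metis bchoice)
  obtain c where c: "\<forall>i\<in>A. c i \<in> K" "\<exists>i\<in>A. c i \<noteq> 0" "\<forall>k\<in>B. (\<Sum>i\<in>A. c i * a i k) = 0"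
    using underdetermined_system[OF closed_ring_K fin(2,1), of a] a(1) \<open>\<not> card A \<le> card B\<close> by auto
  have "(\<Sum>i\<in>A. c i * b i) = (\<Sum>i\<in>A. c i * (b i - (\<Sum>j\<in>B. a i j * v j))) + (\<Sum>i\<in>A. \<Sum>j\<in>B. c i * a i j * v j)"
    by (simp add: right_diff_distrib sum_subtractf sum_distrib_left mult.assoc)
  also have "(\<Sum>i\<in>A. \<Sum>j\<in>B. c i * a i j * v j) = (\<Sum>j\<in>B. (\<Sum>i\<in>A. c i * a i j) * v j)"
    by (subst sum.swap) (simp add: sum_distrib_right)
  also have "\<dots> = 0" using c(3) by simp
  finally have "(\<Sum>i\<in>A. c i * b i) \<in> W"
    using ksubspace_lincomb[OF W, of A "\<lambda>i. b i - (\<Sum>j\<in>B. a i j * v j)" c] a(2) c(1) by auto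
  then show False using ind c unfolding lin_indep_mod_def by blast
qed

lemma has_dimI:
  assumes "finite A" "\<And>i. i \<in> A \<Longrightarrow> b i \<in> V" "lin_indep_mod K W A b" "spans_mod K V W A b"
  shows "has_dim K V W (card A)"
proof -
  obtain g where gb: "bij_betw g A {..<card A}"
    using ex_bij_betw_finite_nat[OF assms(1)] by (auto simp: atLeast0LessThan)
  let ?A = "{..<card A}"
  define f where "f = the_inv_into A g"
  have g: "g i \<in> ?A" "f (g i) = i" if "i \<in> A" for i
    using that gb by (auto simp: bij_betw_def the_inv_into_f_f f_def)
  have f: "f i \<in> A" "g (f i) = i" if "i \<in> ?A" for i
    using that gb by (auto simp: bij_betw_def the_inv_into_into f_the_inv_into_f f_def)
  have s: "(\<Sum>i\<in>?A. c i * (b \<circ> f) i) = (\<Sum>i\<in>A. c (g i) * b i)" for c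
    by (rule sum.reindex_bij_witness[of _ g f]) (use f g in auto)
  show ?thesis
    unfolding has_dim_def
  proof (intro exI[of _ "b \<circ> f"] conjI)
    show "\<forall>i<card A. (b \<circ> f) i \<in> V" using assms(2) f by auto
    show "lin_indep_mod K W ?A (b \<circ> f)"
      unfolding lin_indep_mod_def s
    proof (intro allI impI ballI)
      fix c i assume c: "\<forall>i\<in>?A. c i \<in> K" "(\<Sum>i\<in>A. c (g i) * b i) \<in> W" "i \<in> ?A"
      then have "c (g (f i)) = 0"
        using lin_indep_modD[OF assms(3), of "c \<circ> g" "f i"] g f by auto
      then show "c i = 0" using f c(3) by simp
    qed
    show "spans_mod K V W ?A (b \<circ> f)"
      unfolding spans_mod_def s
    proof
      fix z assume "z \<in> V"
      then obtain c where c: "\<forall>i\<in>A. c i \<in> K" "z - (\<Sum>i\<in>A. c i * b i) \<in> W"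
        using assms(4) unfolding spans_mod_def by blast
      have "(\<Sum>i\<in>A. c i * b i) = (\<Sum>i\<in>A. (c \<circ> f) (g i) * b i)"
        using g by (intro sum.cong) auto
      then show "\<exists>c. (\<forall>i\<in>?A. c i \<in> K) \<and> z - (\<Sum>i\<in>A. c (g i) * b i) \<in> W"
        using c f by (intro exI[of _ "c \<circ> f"]) auto
    qed
  qed
qed

lemma has_dim_unique:
  assumes "ksubspace K W" "has_dim K V W d" "has_dim K V W e"
  shows "d = e"
proof -
  obtain b c where
    "\<forall>i<d. b i \<in> V" "lin_indep_mod K W {..<d} b" "spans_mod K V W {..<d} b"
    "\<forall>i<e. c i \<in> V" "lin_indep_mod K W {..<e} c" "spans_mod K V W {..<e} c"
    using assms unfolding has_dim_def by blast
  then have "card {..<d} \<le> card {..<e}" "card {..<e} \<le> card {..<d}"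
    using assms(1) by (intro card_indep_le_card_span[of W, where V=V]; auto)+
  then show ?thesis by simp
qed

lemma has_dim_indep_le:
  assumes "ksubspace K W" "has_dim K V W d" "finite A" "\<And>i. i \<in> A \<Longrightarrow> b i \<in> V" "lin_indep_mod K W A b"
  shows "card A \<le> d"
proof -
  obtain c where "spans_mod K V W {..<d} c"
    using assms unfolding has_dim_def by blast
  then show ?thesis using card_indep_le_card_span[OF assms(1,3) _ assms(5), of "{..<d}" V c] assms by auto
qed

text \<open>A longest independent family spans, so a bound on the length of independent families is
  all that finite dimension requires.\<close>

lemma has_dim_bounded_exists:
  assumes W: "ksubspace K W"
    and bd: "\<And>d (b :: nat \<Rightarrow> 'f). (\<And>i. i < d \<Longrightarrow> b i \<in> V) \<Longrightarrow> lin_indep_mod K W {..<d} b \<Longrightarrow> d \<le> N"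
  shows "\<exists>d\<le>N. has_dim K V W d"
proof -
  define Pr where "Pr = (\<lambda>d. \<exists>b :: nat \<Rightarrow> 'f. (\<forall>i<d. b i \<in> V) \<and> lin_indep_mod K W {..<d} b)"
  have P0: "Pr 0" unfolding Pr_def lin_indep_mod_def by auto
  have PN: "Pr d \<Longrightarrow> d \<le> N" for d unfolding Pr_def using bd by blast
  define d where "d = (GREATEST d. Pr d)"
  have Pd: "Pr d" unfolding d_def using GreatestI_nat[of Pr 0 N] P0 PN by blast
  have Pm: "Pr e \<Longrightarrow> e \<le> d" for e unfolding d_def using Greatest_le_nat[of Pr e N] PN by blast
  obtain b :: "nat \<Rightarrow> 'f" where b: "\<forall>i<d. b i \<in> V" "lin_indep_mod K W {..<d} b" using Pd unfolding Pr_def by blast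
  have "spans_mod K V W {..<d} b"
    unfolding spans_mod_def
  proof
    fix z assume z: "z \<in> V"
    have "\<not> lin_indep_mod K W {..<Suc d} (b(d := z))"
    proof
      assume *: "lin_indep_mod K W {..<Suc d} (b(d := z))"
      have "Pr (Suc d)" unfolding Pr_def
        by (intro exI[of _ "b(d := z)"] conjI *) (use b z in \<open>auto simp: less_Suc_eq\<close>)
      then show False using Pm[of "Suc d"] by simp
    qed
    then obtain c where c: "\<forall>i\<in>{..<Suc d}. c i \<in> K" "(\<Sum>i<Suc d. c i * (b(d := z)) i) \<in> W" "\<exists>i\<in>{..<Suc d}. c i \<noteq> 0"
      unfolding lin_indep_mod_def by blast
    have "(\<Sum>i<d. c i * (b(d := z)) i) = (\<Sum>i<d. c i * b i)" by (intro sum.cong) auto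
    then have c2: "(\<Sum>i<d. c i * b i) + c d * z \<in> W" using c(2) by simp
    \<comment> \<open>The old family is independent, so the dependence must involve
      \<open>z\<close>; division by its coefficient then expresses \<open>z\<close> through the
      family.\<close>
    have cd: "c d \<noteq> 0"
    proof
      assume "c d = 0"
      then have "(\<Sum>i<d. c i * b i) \<in> W" using c2 by simp
      then have "\<forall>i<d. c i = 0" using b(2) c(1) unfolding lin_indep_mod_def by auto
      then show False using c(3) \<open>c d = 0\<close> by (auto simp: less_Suc_eq)
    qed
    have "inverse (c d) * ((\<Sum>i<d. c i * b i) + c d * z) \<in> W"
      using c2 c(1) by (intro ksubspaceD(3)[OF W] K_inverse) auto
    also have "inverse (c d) * ((\<Sum>i<d. c i * b i) + c d * z) = z - (\<Sum>i<d. (- inverse (c d) * c i) * b i)"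
      using cd by (simp add: sum_negf sum_distrib_left algebra_simps)
    finally show "\<exists>c. (\<forall>i\<in>{..<d}. c i \<in> K) \<and> z - (\<Sum>i<d. c i * b i) \<in> W"
      using c(1) by (intro exI[of _ "\<lambda>i. - inverse (c d) * c i"]) (auto intro!: K_ring K_inverse)
  qed
  then show ?thesis using b PN[OF Pd] unfolding has_dim_def by blast
qed

lemma has_dim_subspace:
  assumes W: "ksubspace K W" and "has_dim K V W d" "V' \<subseteq> V"
  shows "\<exists>e\<le>d. has_dim K V' W e"
proof (rule has_dim_bounded_exists[OF W])
  fix e and b :: "nat \<Rightarrow> 'f" assume "\<And>i. i < e \<Longrightarrow> b i \<in> V'" "lin_indep_mod K W {..<e} b"
  then show "e \<le> d" using has_dim_indep_le[OF assms(1,2), of "{..<e}" b] assms(3) by auto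
qed

lemma has_dim_trans:
  assumes U: "ksubspace K U" and W: "ksubspace K W" and V: "ksubspace K V" and "U \<subseteq> W" "W \<subseteq> V"
    and "has_dim K V W d" "has_dim K W U e"
  shows "has_dim K V U (d + e)"
proof -
  obtain b where b: "\<forall>i<d. b i \<in> V" "lin_indep_mod K W {..<d} b" "spans_mod K V W {..<d} b"
    using assms unfolding has_dim_def by blast
  obtain c where c: "\<forall>i<e. c i \<in> W" "lin_indep_mod K U {..<e} c" "spans_mod K W U {..<e} c"
    using assms unfolding has_dim_def by blast
  let ?A = "{..<d} <+> {..<e}" and ?f = "case_sum b c"
  have s: "(\<Sum>i\<in>?A. k i * ?f i) = (\<Sum>i<d. k (Inl i) * b i) + (\<Sum>i<e. k (Inr i) * c i)" for k
    by (subst sum.Plus) auto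
  have "has_dim K V U (card ?A)"
  proof (rule has_dimI)
    show "finite ?A" by auto
    show "?f i \<in> V" if "i \<in> ?A" for i using that b(1) c(1) assms by auto
    show "lin_indep_mod K U ?A ?f"
      unfolding lin_indep_mod_def s
    proof (intro allI impI)
      fix k assume k: "\<forall>i\<in>?A. k i \<in> K" "(\<Sum>i<d. k (Inl i) * b i) + (\<Sum>i<e. k (Inr i) * c i) \<in> U"
      have cW: "(\<Sum>i<e. k (Inr i) * c i) \<in> W" using k c by (intro ksubspace_lincomb[OF W]) auto
      then have "(\<Sum>i<d. k (Inl i) * b i) + (\<Sum>i<e. k (Inr i) * c i) - (\<Sum>i<e. k (Inr i) * c i) \<in> W"
        using k assms by (intro ksubspace_diff[OF W]) auto
      then have 0: "\<forall>i<d. k (Inl i) = 0"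
        using lin_indep_modD[OF b(2), of "k \<circ> Inl"] k(1) by auto
      then have "(\<Sum>i<e. k (Inr i) * c i) \<in> U" using k(2) by simp
      then have "\<forall>i<e. k (Inr i) = 0"
        using lin_indep_modD[OF c(2), of "k \<circ> Inr"] k(1) by auto
      then show "\<forall>i\<in>?A. k i = 0" using 0 by auto
    qed
    show "spans_mod K V U ?A ?f"
      unfolding spans_mod_def s
    proof
      fix z assume "z \<in> V"
      then obtain k where k: "\<forall>i\<in>{..<d}. k i \<in> K" "z - (\<Sum>i<d. k i * b i) \<in> W"
        using b(3) unfolding spans_mod_def by blast
      then obtain l where l: "\<forall>i\<in>{..<e}. l i \<in> K" "z - (\<Sum>i<d. k i * b i) - (\<Sum>i<e. l i * c i) \<in> U"
        using c(3) unfolding spans_mod_def by blast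
      show "\<exists>ca. (\<forall>i\<in>?A. ca i \<in> K) \<and> z - ((\<Sum>i<d. ca (Inl i) * b i) + (\<Sum>i<e. ca (Inr i) * c i)) \<in> U"
        using k l by (intro exI[of _ "case_sum k l"]) (auto simp: algebra_simps)
    qed
  qed
  then show ?thesis by (simp add: card_Plus)
qed

text \<open>The condition on \<open>W'\<close> says that the map induced on the quotients is
  injective. With \<open>f\<close> the identity it embeds a quotient of two Riemann-Roch spaces into
  a quotient of two conditions at a single place.\<close>

lemma has_dim_linear_inj:
  assumes f: "\<And>x y. x \<in> V \<Longrightarrow> y \<in> V \<Longrightarrow> f (x + y) = f x + f y" "\<And>c x. c \<in> K \<Longrightarrow> x \<in> V \<Longrightarrow> f (c * x) = c * f x"
    and V: "ksubspace K V" and fV: "\<And>x. x \<in> V \<Longrightarrow> f x \<in> V'" "\<And>x. x \<in> V \<Longrightarrow> f x \<in> W' \<Longrightarrow> x \<in> W"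
    and W: "ksubspace K W" "ksubspace K W'" and d: "has_dim K V' W' d"
  shows "\<exists>e\<le>d. has_dim K V W e"
proof (rule has_dim_bounded_exists[OF W(1)])
  fix e and b :: "nat \<Rightarrow> 'f" assume b: "\<And>i. i < e \<Longrightarrow> b i \<in> V" "lin_indep_mod K W {..<e} b"
  have f0: "f 0 = 0" using f(2)[of 0 0] ksubspaceD(1)[OF V] K_ring(1) by simp
  have fs: "f (\<Sum>i\<in>A. c i * b i) = (\<Sum>i\<in>A. c i * f (b i)) \<and> (\<Sum>i\<in>A. c i * b i) \<in> V"
    if "A \<subseteq> {..<e}" "\<And>i. i \<in> A \<Longrightarrow> c i \<in> K" for c A
  proof -
    have "finite A" using that(1) finite_subset by blast
    then show ?thesis using that
      by (induction A) (use b f f0 V in \<open>auto intro: ksubspaceD simp: f ksubspaceD\<close>)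
  qed
  have "lin_indep_mod K W' {..<e} (f \<circ> b)"
    unfolding lin_indep_mod_def
  proof (intro allI impI)
    fix c assume c: "\<forall>i\<in>{..<e}. c i \<in> K" "(\<Sum>i<e. c i * (f \<circ> b) i) \<in> W'"
    then have "(\<Sum>i<e. c i * b i) \<in> W" using fs[of "{..<e}" c] fV(2) by auto
    then show "\<forall>i\<in>{..<e}. c i = 0" using lin_indep_modD[OF b(2), of c] c(1) by blast
  qed
  then show "e \<le> d" using has_dim_indep_le[OF W(2) d, of "{..<e}" "f \<circ> b"] fV(1) b(1) by auto
qed

lemma has_dim_scale:
  assumes "y \<noteq> 0" "has_dim K V W d"
  shows "has_dim K ((*) y ` V) ((*) y ` W) d"
proof -
  obtain b where b: "\<forall>i<d. b i \<in> V" "lin_indep_mod K W {..<d} b" "spans_mod K V W {..<d} b"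
    using assms unfolding has_dim_def by blast
  have s: "(\<Sum>i<d. c i * (y * b i)) = y * (\<Sum>i<d. c i * b i)" for c
    by (simp add: sum_distrib_left algebra_simps)
  have m: "y * a \<in> (*) y ` W \<longleftrightarrow> a \<in> W" for a using assms(1) by auto
  show ?thesis unfolding has_dim_def
  proof (intro exI[of _ "\<lambda>i. y * b i"] conjI)
    show "\<forall>i<d. y * b i \<in> (*) y ` V" using b by auto
    show "lin_indep_mod K ((*) y ` W) {..<d} (\<lambda>i. y * b i)"
      using b(2) unfolding lin_indep_mod_def s m .
    show "spans_mod K ((*) y ` V) ((*) y ` W) {..<d} (\<lambda>i. y * b i)"
      unfolding spans_mod_def s
    proof safe
      fix z assume "z \<in> V"
      then obtain c where "\<forall>i\<in>{..<d}. c i \<in> K" "z - (\<Sum>i<d. c i * b i) \<in> W"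
        using b(3) unfolding spans_mod_def by blast
      then show "\<exists>c. (\<forall>i\<in>{..<d}. c i \<in> K) \<and> y * z - y * (\<Sum>i<d. c i * b i) \<in> (*) y ` W"
        by (intro exI[of _ c]) (auto simp: right_diff_distrib[symmetric])
    qed
  qed
qed

lemma has_dim_self: "ksubspace K V \<Longrightarrow> has_dim K V V 0"
  unfolding has_dim_def lin_indep_mod_def spans_mod_def by auto

lemma has_dim_0D:
  assumes "has_dim K V W 0" shows "V \<subseteq> W"
  using assms unfolding has_dim_def spans_mod_def by auto

text \<open>The description inside \<open>kdim\<close> is \<open>has_dim K V {0}\<close> written
  out, and uniqueness of the dimension makes the \<open>THE\<close> denote.\<close>

lemma kdim_eq:
  assumes V: "ksubspace K V" and d: "has_dim K V {0} d"
  shows "kdim K V = d"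
proof -
  have *: "(\<exists>b. (\<forall>i<d. b i \<in> V) \<and>
      (\<forall>c. (\<forall>i<d. c i \<in> K) \<longrightarrow> (\<Sum>i<d. c i * b i) = 0 \<longrightarrow> (\<forall>i<d. c i = 0)) \<and>
      V = {\<Sum>i<d. c i * b i | c. \<forall>i<d. c i \<in> K}) \<longleftrightarrow> has_dim K V {0} d" for d
    unfolding has_dim_def lin_indep_mod_def spans_mod_def
  proof (intro ex_cong1 conj_cong refl)
    fix b :: "nat \<Rightarrow> 'f" assume b: "\<forall>i<d. b i \<in> V"
    have "{\<Sum>i<d. c i * b i | c. \<forall>i<d. c i \<in> K} \<subseteq> V"
      using b by (auto intro!: ksubspace_lincomb[OF V])
    then show "(V = {\<Sum>i<d. c i * b i | c. \<forall>i<d. c i \<in> K}) =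
      (\<forall>z\<in>V. \<exists>c. (\<forall>i\<in>{..<d}. c i \<in> K) \<and> z - (\<Sum>i<d. c i * b i) \<in> {0})"
      by (simp add: set_eq_iff subset_iff Ball_def) blast
  qed auto
  show ?thesis unfolding kdim_def *
    using d has_dim_unique[OF ksubspace_zero] by blast
qed

lemma place_degree_eq:
  assumes "ksubspace K (max_ideal R)" and d: "has_dim K R (max_ideal R) d"
  shows "place_degree K R = d"
proof -
  have "place_degree K R = (THE d. has_dim K R (max_ideal R) d)"
    unfolding place_degree_def has_dim_def lin_indep_mod_def spans_mod_def Ball_def lessThan_iff ..
  then show ?thesis using d has_dim_unique[OF assms(1)] by auto
qed

end

section \<open>Dependence over polynomial rings\<close>

definition polys_over :: "'f::field set \<Rightarrow> 'f \<Rightarrow> 'f set" where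
  "polys_over K y = {poly p y | p. \<forall>k. coeff p k \<in> K}"

text \<open>Says that the degree of \<open>F\<close> over \<open>K(y)\<close> is at most \<open>N\<close>, with denominators cleared.\<close>
definition dep_over :: "'f::field set \<Rightarrow> 'f \<Rightarrow> nat \<Rightarrow> bool" where
  "dep_over K y N \<longleftrightarrow> (\<forall>z::nat \<Rightarrow> 'f. \<exists>c. (\<forall>i\<le>N. c i \<in> polys_over K y) \<and> (\<exists>i\<le>N. c i \<noteq> 0) \<and> (\<Sum>i\<le>N. c i * z i) = 0)"

lemma dep_overD:
  fixes z :: "'i \<Rightarrow> 'f::field"
  assumes "dep_over K y N" "finite A" "N < card A" "0 \<in> polys_over K y"
  shows "\<exists>c. (\<forall>i\<in>A. c i \<in> polys_over K y) \<and> (\<exists>i\<in>A. c i \<noteq> 0) \<and> (\<Sum>i\<in>A. c i * z i) = 0"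
proof -
  obtain A' where A': "A' \<subseteq> A" "card A' = Suc N" using assms(3) by (metis Suc_leI obtain_subset_with_card_n)
  have finA': "finite A'" using A' assms(2) finite_subset by blast
  then obtain f where f: "bij_betw f {..N} A'"
    using A' ex_bij_betw_nat_finite[of A'] by (auto simp: atLeast0LessThan lessThan_Suc_atMost)
  define g where "g = the_inv_into {..N} f"
  have fg: "i \<le> N \<Longrightarrow> f i \<in> A'" "i \<le> N \<Longrightarrow> g (f i) = i" for i
    using f by (auto simp: bij_betw_def g_def the_inv_into_f_f)
  have gf: "i \<in> A' \<Longrightarrow> g i \<le> N" "i \<in> A' \<Longrightarrow> f (g i) = i" for i
    using f the_inv_into_into[of f "{..N}" i "{..N}"] by (auto simp: bij_betw_def g_def f_the_inv_into_f)
  obtain c where c: "\<forall>i\<le>N. c i \<in> polys_over K y" "\<exists>i\<le>N. c i \<noteq> 0" "(\<Sum>i\<le>N. c i * z (f i)) = 0"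
    using assms(1)[unfolded dep_over_def, rule_format, of "\<lambda>i. z (f i)"] by blast
  define c' where "c' = (\<lambda>i. if i \<in> A' then c (g i) else 0)"
  have "(\<Sum>i\<in>A. c' i * z i) = (\<Sum>i\<in>A'. c' i * z i)"
    by (rule sum.mono_neutral_right) (use A' assms in \<open>auto simp: c'_def\<close>)
  also have "\<dots> = (\<Sum>i\<le>N. c i * z (f i))"
    by (rule sum.reindex_bij_witness[of _ f g]) (auto simp: c'_def fg gf)
  finally have "(\<Sum>i\<in>A. c' i * z i) = 0" using c(3) by simp
  moreover have "\<exists>i\<in>A. c' i \<noteq> 0"
  proof -
    obtain i where "i \<le> N" "c i \<noteq> 0" using c by blast
    then show ?thesis using fg A' by (intro bexI[of _ "f i"]) (auto simp: c'_def)
  qed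
  ultimately show ?thesis using c(1) gf assms(4) by (intro exI[of _ c']) (auto simp: c'_def)
qed

lemma closed_ring_polys_over:
  assumes S: "closed_ring S"
  shows "closed_ring (polys_over S y)"
  unfolding closed_ring_def
proof (intro conjI ballI)
  note S_ring = closed_ringD[OF S]
  show "0 \<in> polys_over S y" unfolding polys_over_def by (auto intro!: exI[of _ 0] S_ring)
  show "1 \<in> polys_over S y" unfolding polys_over_def
    using S_ring by (auto intro!: exI[of _ "[:1:]"] simp: coeff_pCons split: nat.splits)
next
  note S_ring = closed_ringD[OF S]
  fix a b assume "a \<in> polys_over S y" "b \<in> polys_over S y"
  then obtain p q where p: "a = poly p y" "\<forall>k. coeff p k \<in> S" and q: "b = poly q y" "\<forall>k. coeff q k \<in> S"
    unfolding polys_over_def by blast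
  show "a + b \<in> polys_over S y" using p q unfolding polys_over_def
    by (auto intro!: exI[of _ "p+q"] S_ring)
  have "coeff (p * q) k \<in> S" for k
    using p q by (auto simp: coeff_mult intro!: closed_ring_sum[OF S] S_ring)
  then show "a * b \<in> polys_over S y" using p q unfolding polys_over_def
    by (auto intro!: exI[of _ "p*q"])
next
  note S_ring = closed_ringD[OF S]
  fix a assume "a \<in> polys_over S y"
  then obtain p where p: "a = poly p y" "\<forall>k. coeff p k \<in> S" unfolding polys_over_def by blast
  show "- a \<in> polys_over S y" using p unfolding polys_over_def
    by (auto intro!: exI[of _ "-p"] S_ring)
qed

text \<open>Polynomials in \<open>y\<close> with at most \<open>n\<close> terms and coefficients in
  the ideal \<open>w S\<close>. For \<open>w = 1\<close> this is the \<open>S\<close>-span of the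
  first \<open>n\<close> powers of \<open>y\<close>; for a non-unit \<open>w\<close> it is where the
  construction of valuation rings looks for expressions of 1.\<close>

definition ideal_polys :: "'f::field set \<Rightarrow> 'f \<Rightarrow> 'f \<Rightarrow> nat \<Rightarrow> 'f set" where
  "ideal_polys S w y n = {\<Sum>i<n. w * a i * y ^ i | a. \<forall>i<n. a i \<in> S}"

lemma ksubspace_ideal_polys:
  assumes S: "closed_ring S"
  shows "ksubspace S (ideal_polys S w y n)"
  unfolding ksubspace_def
proof (intro conjI ballI)
  note r = closed_ringD[OF S]
  show "0 \<in> ideal_polys S w y n" unfolding ideal_polys_def using r(1)
    by (auto intro!: exI[of _ "\<lambda>_. 0"])
next
  note r = closed_ringD[OF S]
  fix a b assume "a \<in> ideal_polys S w y n" "b \<in> ideal_polys S w y n"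
  then obtain p q where "a = (\<Sum>i<n. w * p i * y ^ i)" "b = (\<Sum>i<n. w * q i * y ^ i)"
    "\<forall>i<n. p i \<in> S" "\<forall>i<n. q i \<in> S" unfolding ideal_polys_def by blast
  then show "a + b \<in> ideal_polys S w y n" unfolding ideal_polys_def using r(3)
    by (auto intro!: exI[of _ "\<lambda>i. p i + q i"] simp: algebra_simps sum.distrib)
next
  note r = closed_ringD[OF S]
  fix c a assume "c \<in> S" "a \<in> ideal_polys S w y n"
  then obtain p where "a = (\<Sum>i<n. w * p i * y ^ i)" "\<forall>i<n. p i \<in> S" unfolding ideal_polys_def by blast
  then show "c * a \<in> ideal_polys S w y n" unfolding ideal_polys_def using r(4) \<open>c \<in> S\<close>
    by (auto intro!: exI[of _ "\<lambda>i. c * p i"] simp: sum_distrib_left mult_ac)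
qed

lemma ideal_polys_monom:
  assumes "closed_ring S" "i < n" "a \<in> S"
  shows "w * a * y ^ i \<in> ideal_polys S w y n"
proof -
  have "(\<Sum>j<n. w * (if j = i then a else 0) * y ^ j) = w * a * y ^ i"
    using assms(2) by (subst sum.cong[OF refl, of _ _ "\<lambda>j. if j = i then w * a * y ^ i else 0"]) auto
  then show ?thesis unfolding ideal_polys_def using assms closed_ringD(1)[OF assms(1)]
    by (intro CollectI exI[of _ "\<lambda>j. if j = i then a else 0"]) auto
qed

context const_field begin

lemma set_coeffs_subset: "set (coeffs p) \<subseteq> K \<longleftrightarrow> (\<forall>k. coeff p k \<in> K)"
proof -
  have "range (coeff p) \<subseteq> K \<longleftrightarrow> set (coeffs p) \<subseteq> K"
    unfolding range_coeff using K_ring(1) by simp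
  then show ?thesis by auto
qed

lemmas closed_ring_polys = closed_ring_polys_over[OF closed_ring_K]

lemmas polys_ring = closed_ringD[OF closed_ring_polys]

lemma K_polys: "a \<in> K \<Longrightarrow> a \<in> polys_over K y"
  unfolding polys_over_def by (auto intro!: exI[of _ "[:a:]"] simp: coeff_pCons K_ring split: nat.splits)

lemma self_polys: "y \<in> polys_over K y"
  unfolding polys_over_def by (auto intro!: exI[of _ "[:0,1:]"] simp: coeff_pCons K_ring split: nat.splits)

lemma polys_over_subset:
  assumes "closed_ring S" "K \<subseteq> S" "y \<in> S"
  shows "polys_over K y \<subseteq> S"
  unfolding polys_over_def poly_altdef using assms
  by (auto intro!: closed_ring_sum[OF assms(1)] closed_ringD[OF assms(1)] closed_ring_power)

lemma closed_ring_rat_fun_field: "closed_ring (rat_fun_field K x)"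
proof -
  have R: "rat_fun_field K x = {a / b | a b. a \<in> polys_over K x \<and> b \<in> polys_over K x \<and> b \<noteq> 0}"
    unfolding rat_fun_field_def polys_over_def set_coeffs_subset by blast
  note P = closed_ringD[OF closed_ring_polys]
  show ?thesis unfolding closed_ring_def
  proof (intro conjI ballI)
    show "0 \<in> rat_fun_field K x" unfolding R using P(1,2) by (intro CollectI exI[of _ 0] exI[of _ 1]) auto
    show "1 \<in> rat_fun_field K x" unfolding R using P(1,2) by (intro CollectI exI[of _ 1]) auto
  next
    fix r s assume "r \<in> rat_fun_field K x" "s \<in> rat_fun_field K x"
    then obtain a b c d where *: "r = a / b" "s = c / d" "b \<noteq> 0" "d \<noteq> 0" "a \<in> polys_over K x"
      "b \<in> polys_over K x" "c \<in> polys_over K x" "d \<in> polys_over K x" unfolding R by blast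
    have "r + s = (a * d + c * b) / (b * d)" "r * s = (a * c) / (b * d)" using * by (auto simp: field_simps)
    moreover have "a * d + c * b \<in> polys_over K x" "a * c \<in> polys_over K x" "b * d \<in> polys_over K x" "b * d \<noteq> 0"
      using * by (auto intro!: P)
    ultimately show "r + s \<in> rat_fun_field K x" "r * s \<in> rat_fun_field K x"
      unfolding R by blast+
  next
    fix r assume "r \<in> rat_fun_field K x"
    then obtain a b where *: "r = a / b" "b \<noteq> 0" "a \<in> polys_over K x" "b \<in> polys_over K x" unfolding R by blast
    have "- r = (- a) / b" using * by simp
    then show "- r \<in> rat_fun_field K x" unfolding R using * P(5) by blast
  qed
qed

lemma transcendentalD:
  "transcendental_over K y \<Longrightarrow> (\<And>k. coeff p k \<in> K) \<Longrightarrow> poly p y = 0 \<Longrightarrow> p = 0"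
  unfolding transcendental_over_def set_coeffs_subset by blast

end

text \<open>\<open>N\<close> is the degree of \<open>F\<close> over \<open>K(x)\<close> and \<open>u\<close> a basis.\<close>
locale ff_basis = const_field K for K :: "'f::field set" +
  fixes x :: 'f and N :: nat and u :: "nat \<Rightarrow> 'f"
  assumes x_trans: "transcendental_over K x"
    and dep_x: "dep_over K x N"
    and indep_u: "lin_indep_mod (polys_over K x) {0} {..<N} u"
    and N_pos: "N \<ge> 1"

text \<open>Relations over K(x) become relations over K[x] when denominators are cleared, so
  \<open>card B\<close> satisfies \<open>dep_over\<close>. For the least such \<open>N\<close>,
  failure of \<open>dep_over\<close> at \<open>N - 1\<close> yields \<open>N\<close> elements
  independent over K[x].\<close>

lemma function_field_imp_ff_basis:
  assumes "function_field K"
  shows "\<exists>x N u. ff_basis K x N u"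
proof -
  interpret const_field K using assms unfolding function_field_def by unfold_locales auto
  obtain x B where x: "transcendental_over K x" and B: "finite B"
    "\<And>z. \<exists>c. (\<forall>b\<in>B. c b \<in> rat_fun_field K x) \<and> z = (\<Sum>b\<in>B. c b * b)"
    using assms unfolding function_field_def by blast
  have "dep_over K x (card B)"
    unfolding dep_over_def
  proof
    fix z :: "nat \<Rightarrow> 'a"
    obtain r where r: "\<And>i b. b \<in> B \<Longrightarrow> r i b \<in> rat_fun_field K x" "\<And>i. z i = (\<Sum>b\<in>B. r i b * b)"
      using B(2)[of "z _"] by metis
    have "\<exists>c. (\<forall>i\<in>{..card B}. c i \<in> rat_fun_field K x) \<and> (\<exists>i\<in>{..card B}. c i \<noteq> 0) \<and>
        (\<forall>k\<in>B. (\<Sum>i\<le>card B. c i * r i k) = 0)"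
      by (rule underdetermined_system[OF closed_ring_rat_fun_field]) (use B r in auto)
    then obtain c where c: "\<forall>i\<le>card B. c i \<in> rat_fun_field K x" "\<exists>i\<le>card B. c i \<noteq> 0"
      "\<forall>k\<in>B. (\<Sum>i\<le>card B. c i * r i k) = 0" by auto
    have "\<forall>i\<in>{..card B}. \<exists>a. \<exists>b. a \<in> polys_over K x \<and> b \<in> polys_over K x \<and> b \<noteq> 0 \<and> c i = a / b"
      using c(1) unfolding rat_fun_field_def polys_over_def set_coeffs_subset by blast
    then obtain a b where ab: "\<And>i. i \<le> card B \<Longrightarrow> a i \<in> polys_over K x" "\<And>i. i \<le> card B \<Longrightarrow> b i \<in> polys_over K x"
      "\<And>i. i \<le> card B \<Longrightarrow> b i \<noteq> 0" "\<And>i. i \<le> card B \<Longrightarrow> c i = a i / b i" by (metis atMost_iff)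
    define c' where "c' = (\<lambda>i. a i * (\<Prod>j\<in>{..card B}-{i}. b j))"
    define D where "D = (\<Prod>j\<le>card B. b j)"
    have D: "D \<noteq> 0" using ab unfolding D_def by auto
    have c': "c' i = D * c i" if "i \<le> card B" for i
    proof -
      have "D = b i * (\<Prod>j\<in>{..card B}-{i}. b j)" unfolding D_def using that by (subst prod.remove[of _ i]) auto
      then show ?thesis unfolding c'_def ab(4)[OF that] using ab(3)[OF that] by simp
    qed
    have "(\<Sum>i\<le>card B. c i * z i) = (\<Sum>i\<le>card B. \<Sum>k\<in>B. c i * r i k * k)"
      unfolding r(2) by (simp add: sum_distrib_left mult.assoc)
    also have "\<dots> = (\<Sum>k\<in>B. (\<Sum>i\<le>card B. c i * r i k) * k)"
      by (subst sum.swap) (simp add: sum_distrib_right)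
    also have "\<dots> = 0" using c(3) by simp
    finally have "(\<Sum>i\<le>card B. c i * z i) = 0" .
    then have "D * (\<Sum>i\<le>card B. c i * z i) = 0" by simp
    then have "(\<Sum>i\<le>card B. c' i * z i) = 0"
      by (simp add: sum_distrib_left mult.assoc[symmetric] c')
    moreover have "\<forall>i\<le>card B. c' i \<in> polys_over K x" unfolding c'_def
      using ab by (auto intro!: polys_ring(4) closed_ring_prod[OF closed_ring_polys])
    moreover have "\<exists>i\<le>card B. c' i \<noteq> 0" using c(2) c' D by auto
    ultimately show "\<exists>c. (\<forall>i\<le>card B. c i \<in> polys_over K x) \<and> (\<exists>i\<le>card B. c i \<noteq> 0) \<and> (\<Sum>i\<le>card B. c i * z i) = 0"
      by blast
  qed
  then have ex: "\<exists>N. dep_over K x N" by blast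
  define N where "N = (LEAST N. dep_over K x N)"
  have N: "dep_over K x N" using LeastI_ex[OF ex] unfolding N_def .
  have "\<not> dep_over K x 0" unfolding dep_over_def by (auto intro!: exI[of _ "\<lambda>_. 1"])
  then have N1: "N \<ge> 1" using N by (cases N) auto
  then have "\<not> dep_over K x (N - 1)" using not_less_Least[of "N-1" "dep_over K x"] unfolding N_def by simp
  then obtain u :: "nat \<Rightarrow> 'a" where u: "\<And>c. (\<forall>i\<le>N-1. c i \<in> polys_over K x) \<Longrightarrow> (\<Sum>i\<le>N-1. c i * u i) = 0 \<Longrightarrow> \<forall>i\<le>N-1. c i = 0"
    unfolding dep_over_def by blast
  have "{..N-1} = {..<N}" using N1 by auto
  then have "lin_indep_mod (polys_over K x) {0} {..<N} u"
    unfolding lin_indep_mod_def using u by (metis atMost_iff singletonD)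
  then have "ff_basis K x N u" using x N N1 by unfold_locales
  then show ?thesis by blast
qed

section \<open>Bounds for the degree of F over K(y)\<close>

context ff_basis begin

text \<open>The tower law through K(x,y), without fractions. Up to a power of the leading
  coefficient \<open>d M\<close>, every element of K[x] lies in the K[y]-span of the first
  \<open>M\<close> powers of \<open>x\<close>; up to a factor in K[x], every element of F lies in
  the K[x]-span of the \<open>u k\<close>. So \<open>M * N + 1\<close> elements have only
  \<open>M * N\<close> coordinates and must be dependent.\<close>

lemma dep_over_from_relation:
  assumes d: "\<And>k. k \<le> M \<Longrightarrow> d k \<in> polys_over K y" "d M \<noteq> 0" "(\<Sum>k\<le>M. d k * x ^ k) = 0"
  shows "dep_over K y (M * N)"
proof -
  have M1: "M \<ge> 1" using d by (cases M) auto
  let ?S = "polys_over K y"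
  define Mo where "Mo = ideal_polys ?S 1 x M"
  have Mo: "ksubspace ?S Mo" unfolding Mo_def by (rule ksubspace_ideal_polys[OF closed_ring_polys])
  have xk: "x ^ k \<in> Mo" if "k < M" for k
    using ideal_polys_monom[OF closed_ring_polys that polys_ring(2), of 1 x] unfolding Mo_def by simp
  have dM: "d M \<in> polys_over K y" using d by simp
  have "(\<Sum>k<M. d k * x ^ k) + d M * x ^ M = 0" using d(3) by (simp add: lessThan_Suc_atMost[symmetric])
  then have "d M * x ^ M = (\<Sum>k<M. (- d k) * x ^ k)" by (simp add: sum_negf eq_neg_iff_add_eq_0 add.commute)
  then have xM: "d M * x ^ M \<in> Mo"
    using ksubspace_lincomb[OF Mo, of "{..<M}" "\<lambda>k. x ^ k" "\<lambda>k. - d k"] xk d polys_ring(5) by auto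
  \<comment> \<open>One factor \<open>d M\<close> pays for one multiplication by \<open>x\<close>:
    the relation rewrites \<open>d M * x ^ M\<close>, and no other power leaves the span.\<close>
  have step: "d M * x * a \<in> Mo" if aMo: "a \<in> Mo" for a
  proof -
    obtain p where p: "a = (\<Sum>k<M. p k * x ^ k)" "\<forall>k<M. p k \<in> polys_over K y" using aMo unfolding Mo_def ideal_polys_def by auto
    have "d M * x * a = (\<Sum>k<M. p k * (d M * x ^ Suc k))"
      unfolding p by (simp add: sum_distrib_left algebra_simps)
    also have "\<dots> \<in> Mo"
    proof (rule ksubspace_lincomb[OF Mo])
      fix k assume "k \<in> {..<M}"
      then show "d M * x ^ Suc k \<in> Mo"
        using xM xk[of "Suc k"] ksubspaceD(3)[OF Mo dM] by (cases "Suc k = M") auto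
    qed (use p in auto)
    finally show ?thesis .
  qed
  have pow: "d M ^ j * x ^ j \<in> Mo" for j
  proof (induction j)
    case 0 then show ?case using xk[of 0] M1 by simp
  next
    case (Suc j) then show ?case using step[OF Suc] by (simp add: algebra_simps)
  qed
  have pol: "\<exists>D0. \<forall>D\<ge>D0. d M ^ D * a \<in> Mo" if aP: "a \<in> polys_over K x" for a
  proof -
    obtain p where p: "a = poly p x" "\<forall>k. coeff p k \<in> K" using aP unfolding polys_over_def by blast
    show ?thesis
    proof (intro exI[of _ "degree p"] allI impI)
      fix D assume D: "degree p \<le> D"
      have "d M ^ D * a = (\<Sum>j\<le>degree p. (coeff p j * d M ^ (D - j)) * (d M ^ j * x ^ j))"
        unfolding p poly_altdef sum_distrib_left
      proof (intro sum.cong refl)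
        fix j assume "j \<in> {..degree p}"
        then have "d M ^ D = d M ^ (D - j) * d M ^ j" using D by (simp add: power_add[symmetric])
        then show "d M ^ D * (coeff p j * x ^ j) = coeff p j * d M ^ (D - j) * (d M ^ j * x ^ j)" by simp
      qed
      also have "\<dots> \<in> Mo"
        by (rule ksubspace_lincomb[OF Mo pow]) (use p dM in \<open>auto intro!: polys_ring(4) closed_ring_power[OF closed_ring_polys] intro: K_polys\<close>)
      finally show "d M ^ D * a \<in> Mo" .
    qed
  qed
  show ?thesis unfolding dep_over_def
  proof
    fix z :: "nat \<Rightarrow> 'f"
    have "\<exists>e. \<exists>a. e \<in> polys_over K x \<and> e \<noteq> 0 \<and> (\<forall>k<N. a k \<in> polys_over K x) \<and> e * w = (\<Sum>k<N. a k * u k)" for w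
    proof -
      obtain c where c: "\<forall>i\<le>N. c i \<in> polys_over K x" "\<exists>i\<le>N. c i \<noteq> 0" "(\<Sum>i\<le>N. c i * (u(N := w)) i) = 0"
        using dep_x unfolding dep_over_def by blast
      have s: "(\<Sum>i<N. c i * u i) + c N * w = 0"
        using c(3) by (simp add: lessThan_Suc_atMost[symmetric])
      have "c N \<noteq> 0"
      proof
        assume "c N = 0"
        then have "\<And>i. i \<in> {..<N} \<Longrightarrow> c i = 0" using lin_indep_modD[OF indep_u, of c] s c(1) by simp
        then show False using c(2) \<open>c N = 0\<close> by (metis lessThan_iff order_le_less)
      qed
      moreover have "c N * w = (\<Sum>i<N. (- c i) * u i)" using s by (simp add: sum_negf eq_neg_iff_add_eq_0 add.commute)
      ultimately show ?thesis using c(1) polys_ring(5) by (intro exI[of _ "c N"] exI[of _ "\<lambda>i. - c i"]) auto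
    qed
    then have "\<forall>i. \<exists>e. \<exists>a. e \<in> polys_over K x \<and> e \<noteq> 0 \<and> (\<forall>k<N. a k \<in> polys_over K x) \<and> e * z i = (\<Sum>k<N. a k * u k)"
      by blast
    then obtain e where "\<forall>i. \<exists>a. e i \<in> polys_over K x \<and> e i \<noteq> 0 \<and> (\<forall>k<N. a k \<in> polys_over K x) \<and> e i * z i = (\<Sum>k<N. a k * u k)"
      by (subst (asm) choice_iff) blast
    then obtain a where "\<forall>i. e i \<in> polys_over K x \<and> e i \<noteq> 0 \<and> (\<forall>k<N. a i k \<in> polys_over K x) \<and> e i * z i = (\<Sum>k<N. a i k * u k)"
      by (subst (asm) choice_iff) blast
    then have e: "\<And>i. e i \<in> polys_over K x" "\<And>i. e i \<noteq> 0" and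
      a: "\<And>i k. k < N \<Longrightarrow> a i k \<in> polys_over K x" "\<And>i. e i * z i = (\<Sum>k<N. a i k * u k)" by blast+
    let ?L = "M * N"
    define E where "E = (\<Prod>i\<le>?L. e i)"
    define a' where "a' = (\<lambda>i k. (\<Prod>j\<in>{..?L}-{i}. e j) * a i k)"
    have E0: "E \<noteq> 0" unfolding E_def using e by auto
    have a'P: "a' i k \<in> polys_over K x" if "k < N" for i k
      unfolding a'_def using a(1) e that by (auto intro!: polys_ring(4) closed_ring_prod[OF closed_ring_polys])
    have Ez: "E * z i = (\<Sum>k<N. a' i k * u k)" if "i \<le> ?L" for i
    proof -
      have "E = (\<Prod>j\<in>{..?L}-{i}. e j) * e i" unfolding E_def using that by (subst prod.remove[of _ i]) auto
      then have "E * z i = (\<Prod>j\<in>{..?L}-{i}. e j) * (\<Sum>k<N. a i k * u k)" by (simp add: a(2)[symmetric] mult.assoc)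
      then show ?thesis unfolding a'_def by (simp add: sum_distrib_left mult.assoc)
    qed
    have "\<forall>i k. \<exists>D0. k < N \<longrightarrow> (\<forall>D\<ge>D0. d M ^ D * a' i k \<in> Mo)" using pol[OF a'P] by blast
    then obtain D0 where D0: "\<And>i k D. k < N \<Longrightarrow> D \<ge> D0 i k \<Longrightarrow> d M ^ D * a' i k \<in> Mo"
      unfolding choice_iff by blast
    \<comment> \<open>A single exponent for all coordinates: the sum bounds every
      \<open>D0 i k\<close>.\<close>
    define D where "D = (\<Sum>i\<le>?L. \<Sum>k<N. D0 i k)"
    have "D0 i k \<le> D" if "i \<le> ?L" "k < N" for i k
    proof -
      have "D0 i k \<le> (\<Sum>k<N. D0 i k)" using that by (intro member_le_sum) auto
      also have "\<dots> \<le> D" unfolding D_def using that by (intro member_le_sum) auto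
      finally show ?thesis .
    qed
    then have "\<forall>i k. \<exists>p. i \<le> ?L \<longrightarrow> k < N \<longrightarrow> (\<forall>j<M. p j \<in> polys_over K y) \<and> d M ^ D * a' i k = (\<Sum>j<M. p j * x ^ j)"
      using D0 unfolding Mo_def ideal_polys_def mult_1_left by blast
    then obtain p where "\<forall>i k. i \<le> ?L \<longrightarrow> k < N \<longrightarrow> (\<forall>j<M. p i k j \<in> polys_over K y) \<and> d M ^ D * a' i k = (\<Sum>j<M. p i k j * x ^ j)"
      unfolding choice_iff by blast
    then have p: "\<And>i k j. i \<le> ?L \<Longrightarrow> k < N \<Longrightarrow> j < M \<Longrightarrow> p i k j \<in> polys_over K y"
      "\<And>i k. i \<le> ?L \<Longrightarrow> k < N \<Longrightarrow> d M ^ D * a' i k = (\<Sum>j<M. p i k j * x ^ j)" by blast+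
    have "\<exists>c. (\<forall>i\<in>{..?L}. c i \<in> polys_over K y) \<and> (\<exists>i\<in>{..?L}. c i \<noteq> 0) \<and>
       (\<forall>kj\<in>{..<N}\<times>{..<M}. (\<Sum>i\<le>?L. c i * p i (fst kj) (snd kj)) = 0)"
      by (rule underdetermined_system[OF closed_ring_polys]) (use p in \<open>auto simp: mult.commute\<close>)
    then obtain c where c: "\<forall>i\<le>?L. c i \<in> polys_over K y" "\<exists>i\<le>?L. c i \<noteq> 0"
      "\<And>k j. k < N \<Longrightarrow> j < M \<Longrightarrow> (\<Sum>i\<le>?L. c i * p i k j) = 0" by auto
    have "d M ^ D * E * (\<Sum>i\<le>?L. c i * z i) = (\<Sum>i\<le>?L. c i * (d M ^ D * (E * z i)))"
      by (simp add: sum_distrib_left algebra_simps)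
    also have "\<dots> = (\<Sum>i\<le>?L. \<Sum>k<N. c i * ((d M ^ D * a' i k) * u k))"
      by (intro sum.cong refl) (simp add: Ez sum_distrib_left mult.assoc)
    also have "\<dots> = (\<Sum>i\<le>?L. \<Sum>k<N. \<Sum>j<M. c i * p i k j * (x ^ j * u k))"
      by (intro sum.cong refl) (simp add: p sum_distrib_left sum_distrib_right mult.assoc)
    also have "\<dots> = (\<Sum>k<N. \<Sum>i\<le>?L. \<Sum>j<M. c i * p i k j * (x ^ j * u k))"
      by (rule sum.swap)
    also have "\<dots> = (\<Sum>k<N. \<Sum>j<M. \<Sum>i\<le>?L. c i * p i k j * (x ^ j * u k))"
      by (rule sum.cong[OF refl]) (rule sum.swap)
    also have "\<dots> = 0" by (simp add: c(3) flip: sum_distrib_right)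
    finally have "(\<Sum>i\<le>?L. c i * z i) = 0" using d(2) E0 by simp
    then show "\<exists>c. (\<forall>i\<le>M * N. c i \<in> polys_over K y) \<and> (\<exists>i\<le>M * N. c i \<noteq> 0) \<and> (\<Sum>i\<le>M * N. c i * z i) = 0"
      using c by blast
  qed
qed

text \<open>The powers of \<open>y\<close> up to \<open>y ^ N\<close> are dependent over K[x].
  Sorted by powers of \<open>x\<close>, this is a relation for \<open>x\<close> over K[y], and
  transcendence of \<open>y\<close> keeps its leading coefficient from vanishing.\<close>

lemma dep_over_transcendental:
  assumes "transcendental_over K y"
  shows "\<exists>N'. dep_over K y N'"
proof -
  obtain c where c: "\<forall>i\<le>N. c i \<in> polys_over K x" "\<exists>i\<le>N. c i \<noteq> 0" "(\<Sum>i\<le>N. c i * y ^ i) = 0"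
    using dep_x[unfolded dep_over_def, rule_format, of "\<lambda>i. y ^ i"] by blast
  then obtain p where p: "\<And>i k. i \<le> N \<Longrightarrow> coeff (p i) k \<in> K" "\<And>i. i \<le> N \<Longrightarrow> c i = poly (p i) x"
    unfolding polys_over_def by (simp add: mem_Collect_eq) metis
  define q where "q = (\<lambda>k. \<Sum>i\<le>N. monom (coeff (p i) k) i)"
  have qc: "coeff (q k) i = (if i \<le> N then coeff (p i) k else 0)" for k i
    unfolding q_def by (simp add: coeff_sum)
  have qK: "coeff (q k) i \<in> K" for k i using p(1) K_ring(1) by (simp add: qc)
  define D where "D = (\<Sum>i\<le>N. degree (p i))"
  have D: "degree (p i) \<le> D" if "i \<le> N" for i unfolding D_def using that by (intro member_le_sum) auto
  have "(\<Sum>k\<le>D. poly (q k) y * x ^ k) = (\<Sum>k\<le>D. \<Sum>i\<le>N. coeff (p i) k * x ^ k * y ^ i)"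
    unfolding q_def by (simp add: poly_sum poly_monom sum_distrib_right sum_distrib_left mult.commute mult.left_commute)
  also have "\<dots> = (\<Sum>i\<le>N. \<Sum>k\<le>D. coeff (p i) k * x ^ k * y ^ i)" by (rule sum.swap)
  also have "\<dots> = (\<Sum>i\<le>N. c i * y ^ i)"
  proof (intro sum.cong refl)
    fix i assume i: "i \<in> {..N}"
    have "(\<Sum>k\<le>D. coeff (p i) k * x ^ k) = (\<Sum>k\<le>degree (p i). coeff (p i) k * x ^ k)"
      using D[of i] i by (intro sum.mono_neutral_right) (auto simp: coeff_eq_0)
    then show "(\<Sum>k\<le>D. coeff (p i) k * x ^ k * y ^ i) = c i * y ^ i"
      using p(2)[of i] i by (simp add: poly_altdef flip: sum_distrib_right)
  qed
  finally have rel: "(\<Sum>k\<le>D. poly (q k) y * x ^ k) = 0" using c(3) by simp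
  obtain i where i: "i \<le> N" "c i \<noteq> 0" using c by blast
  then have "p i \<noteq> 0" using p(2)[of i] by auto
  then have "coeff (p i) (degree (p i)) \<noteq> 0" by simp
  then have "q (degree (p i)) \<noteq> 0" using qc[of "degree (p i)" i] i by auto
  then have ex: "\<exists>k\<le>D. q k \<noteq> 0" using D i by blast
  \<comment> \<open>The relation is cut off at the highest power of \<open>x\<close> that really
    occurs.\<close>
  define M where "M = (GREATEST k. k \<le> D \<and> q k \<noteq> 0)"
  have M: "M \<le> D" "q M \<noteq> 0"
    using GreatestI_ex_nat[of "\<lambda>k. k \<le> D \<and> q k \<noteq> 0" D] ex unfolding M_def by auto
  have Mm: "q k = 0" if "k \<le> D" "k > M" for k
    using Greatest_le_nat[of "\<lambda>k. k \<le> D \<and> q k \<noteq> 0" k D] that unfolding M_def by auto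
  have "dep_over K y (M * N)"
  proof (rule dep_over_from_relation[of M "\<lambda>k. poly (q k) y"])
    show "poly (q k) y \<in> polys_over K y" for k using qK unfolding polys_over_def by blast
    show "poly (q M) y \<noteq> 0" using transcendentalD[OF assms, of "q M"] qK M by auto
    have "(\<Sum>k\<le>M. poly (q k) y * x ^ k) = (\<Sum>k\<le>D. poly (q k) y * x ^ k)"
      using M Mm by (intro sum.mono_neutral_left) auto
    then show "(\<Sum>k\<le>M. poly (q k) y * x ^ k) = 0" using rel by simp
  qed
  then show ?thesis by blast
qed

text \<open>\<open>x\<close> is a root of a(T) - a(x), a polynomial in T of degree
  \<open>degree a\<close> over K[a(x)].\<close>

lemma dep_over_poly:
  assumes "\<And>k. coeff a k \<in> K" "degree a \<ge> 1"
  shows "dep_over K (poly a x) (degree a * N)"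
proof (rule dep_over_from_relation[of _ "\<lambda>k. if k = 0 then coeff a 0 - poly a x else coeff a k"])
  show "(if k = 0 then coeff a 0 - poly a x else coeff a k) \<in> polys_over K (poly a x)" for k
    using assms(1) by (auto intro: polys_ring K_polys self_polys)
  show "(if degree a = 0 then coeff a 0 - poly a x else coeff a (degree a)) \<noteq> 0" using assms(2) by auto
  show "(\<Sum>k\<le>degree a. (if k = 0 then coeff a 0 - poly a x else coeff a k) * x ^ k) = 0"
  proof -
    have "(\<Sum>k\<le>degree a. (if k = 0 then coeff a 0 - poly a x else coeff a k) * x ^ k)
      = (\<Sum>k\<le>degree a. coeff a k * x ^ k - (if k = 0 then poly a x else 0))"
      by (intro sum.cong) auto
    also have "\<dots> = 0" by (simp add: sum_subtractf poly_altdef)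
    finally show ?thesis .
  qed
qed

lemma transcendental_nonzero:
  assumes "transcendental_over K y" shows "y \<noteq> 0"
proof -
  have "coeff [:0, 1::'f:] k \<in> K" for k
    using K_ring(1,2) by (auto simp: coeff_pCons split: nat.splits)
  then show ?thesis using transcendentalD[OF assms, of "[:0,1:]"] by auto
qed

lemmas x_nonzero = transcendental_nonzero[OF x_trans]

text \<open>\<open>x\<close> is a root of the linear polynomial \<open>inverse x\<close> T -
  1.\<close>

lemma dep_over_inverse_x: "dep_over K (inverse x) N"
proof -
  have "dep_over K (inverse x) (1 * N)"
    by (rule dep_over_from_relation[of 1 "\<lambda>k. if k = 0 then - 1 else inverse x"])
       (use x_nonzero in \<open>auto intro: polys_ring self_polys\<close>)
  then show ?thesis by simp
qed

end

section \<open>Places are discrete valuation rings\<close>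

definition unif :: "'f::field set \<Rightarrow> 'f" where
  "unif R = (SOME t. uniformizer R t)"

text \<open>0 is included by hand because \<open>ord R 0\<close> carries no meaning; with it these
  sets are a filtration of F by \<open>K\<close>-subspaces.\<close>

definition val_ge :: "'f::field set \<Rightarrow> int \<Rightarrow> 'f set" where
  "val_ge R n = {z. z = 0 \<or> ord R z \<ge> n}"

lemma max_idealD: "z \<in> max_ideal R \<Longrightarrow> z \<in> R" "z \<in> max_ideal R \<Longrightarrow> z \<noteq> 0 \<Longrightarrow> inverse z \<notin> R"
  unfolding max_ideal_def by auto

lemma not_max_idealD: "z \<in> R \<Longrightarrow> z \<notin> max_ideal R \<Longrightarrow> z \<noteq> 0 \<and> inverse z \<in> R"
  unfolding max_ideal_def by auto

context const_field begin

lemma place_ring: "R \<in> places K \<Longrightarrow> closed_ring R"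
  using K_ring(1,2) unfolding places_def valuation_ring_def closed_ring_def by blast

lemmas place_ringD = closed_ringD[OF place_ring]

lemma place_K: "R \<in> places K \<Longrightarrow> K \<subseteq> R"
  unfolding places_def valuation_ring_def by blast

lemma place_inverse: 
  assumes "R \<in> places K" "z \<notin> R" shows "inverse z \<in> max_ideal R"
proof -
  have "inverse z \<in> R" using assms unfolding places_def valuation_ring_def by blast
  then show ?thesis using assms unfolding max_ideal_def by auto
qed

lemma max_ideal_mult:
  assumes R: "R \<in> places K" and a: "a \<in> max_ideal R" "r \<in> R" shows "r * a \<in> max_ideal R"
proof (cases "r * a = 0")
  case False
  have "inverse (r * a) \<notin> R"
  proof
    assume "inverse (r * a) \<in> R"
    then have "r * inverse (r * a) \<in> R" using place_ringD(4)[OF R] a by blast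
    moreover have "r * inverse (r * a) = inverse a" using False by (simp add: field_simps)
    ultimately show False using max_idealD(2)[OF a(1)] False by (metis mult_zero_right)
  qed
  then show ?thesis using place_ringD(4)[OF R] a max_idealD(1) unfolding max_ideal_def by blast
next
  case True
  show ?thesis unfolding True using place_ringD(1)[OF R] by (simp add: max_ideal_def)
qed

lemma max_ideal_add:
  assumes R: "R \<in> places K" and a: "a \<in> max_ideal R" "b \<in> max_ideal R" shows "a + b \<in> max_ideal R"
proof -
  note r = place_ringD[OF R]
  have *: "a + b \<in> max_ideal R" if "a \<in> max_ideal R" "b \<in> max_ideal R" "a / b \<in> R" "b \<noteq> 0" for a b
  proof -
    have "a + b = (1 + a / b) * b" using that by (simp add: field_simps)
    then show ?thesis using max_ideal_mult[OF R that(2), of "1 + a / b"] r that by simp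
  qed
  show ?thesis
  proof (cases "a = 0 \<or> b = 0")
    case False
    have "a / b \<in> R \<or> inverse (a / b) \<in> R" using R unfolding places_def valuation_ring_def by blast
    then show ?thesis using *[of a b] *[of b a] a False by (auto simp: add.commute)
  qed (use a in auto)
qed

lemma zero_max_ideal: "R \<in> places K \<Longrightarrow> 0 \<in> max_ideal R"
  using place_ringD(1) unfolding max_ideal_def by auto

lemma ksubspace_max_ideal: "R \<in> places K \<Longrightarrow> ksubspace K (max_ideal R)"
  unfolding ksubspace_def using max_ideal_add max_ideal_mult place_K zero_max_ideal by blast

lemma ksubspace_place: "R \<in> places K \<Longrightarrow> ksubspace K R"
  using place_ring[of R] place_K[of R] unfolding ksubspace_def closed_ring_def by blast

lemma K_not_max_ideal: "R \<in> places K \<Longrightarrow> a \<in> K \<Longrightarrow> a \<in> max_ideal R \<Longrightarrow> a = 0"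
  using max_idealD(2) K_inverse place_K by blast

lemma max_ideal_nonzero: "R \<in> places K \<Longrightarrow> \<exists>t\<in>max_ideal R. t \<noteq> 0"
proof -
  assume R: "R \<in> places K"
  then obtain z where "z \<notin> R" unfolding places_def valuation_ring_def by blast
  then show ?thesis using place_inverse[OF R] place_ringD(1)[OF R]
    by (intro bexI[of _ "inverse z"]) auto
qed

text \<open>If p(w) = 0, the constant coefficient of p is a multiple of \<open>w\<close> and so lies
  in the maximal ideal, where \<open>K\<close> has only 0. A factor \<open>w\<close> can then be
  cancelled, and the argument repeats.\<close>

lemma max_ideal_transcendental:
  assumes R: "R \<in> places K" and w: "w \<in> max_ideal R" "w \<noteq> 0"
  shows "transcendental_over K w"
  unfolding transcendental_over_def set_coeffs_subset
proof (intro allI impI)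
  fix p assume "\<forall>k. coeff p k \<in> K" "p \<noteq> 0"
  then show "poly p w \<noteq> 0"
  proof (induction p)
    case (pCons a q)
    have qK: "\<forall>k. coeff q k \<in> K" and aK: "a \<in> K"
      using pCons.prems(1) by (metis coeff_pCons_Suc, metis coeff_pCons_0)
    show ?case
    proof (cases "a = 0")
      case True then show ?thesis using pCons qK w by auto
    next
      case False
      have "poly q w \<in> R"
        using polys_over_subset[OF place_ring[OF R] place_K[OF R] max_idealD(1)[OF w(1)]] qK
        unfolding polys_over_def by blast
      then have "poly q w * w \<in> max_ideal R" using max_ideal_mult[OF R w(1)] by blast
      moreover have "a = - (poly q w * w)" if "poly (pCons a q) w = 0"
        using that by (simp add: eq_neg_iff_add_eq_0 mult.commute)
      ultimately show ?thesis
        using K_not_max_ideal[OF R aK] False ksubspace_uminus[OF ksubspace_max_ideal[OF R]] by auto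
    qed
  qed auto
qed

text \<open>Independence over \<open>K\<close> modulo \<open>y\<close> lifts to independence over
  K[y]: in a relation over K[y] the constant coefficients form a relation over \<open>K\<close>
  modulo \<open>y\<close> and therefore vanish, after which a factor \<open>y\<close> cancels. The
  induction runs over a common degree bound \<open>D\<close> of the coefficients.\<close>

lemma card_indep_le_of_dep_over:
  assumes S: "S \<subseteq> places K" "S \<noteq> {}" and y: "y \<noteq> 0" "\<And>R. R \<in> S \<Longrightarrow> y \<in> max_ideal R"
    and A: "finite A" "\<And>i R. i \<in> A \<Longrightarrow> R \<in> S \<Longrightarrow> z i \<in> R"
    and ind: "lin_indep_mod K (\<Inter>R\<in>S. (*) y ` R) A z" and dep: "dep_over K y M"
  shows "card A \<le> M"
proof (rule ccontr)
  assume "\<not> card A \<le> M"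
  then obtain c where c: "\<forall>i\<in>A. c i \<in> polys_over K y" "\<exists>i\<in>A. c i \<noteq> 0" "(\<Sum>i\<in>A. c i * z i) = 0"
    using dep_overD[OF dep A(1), of z] polys_ring(1) by auto
  then obtain p where p: "\<And>i k. i \<in> A \<Longrightarrow> coeff (p i) k \<in> K" "\<And>i. i \<in> A \<Longrightarrow> c i = poly (p i) y"
    unfolding polys_over_def by (simp add: mem_Collect_eq) metis
  have "\<forall>i\<in>A. p i = 0" if "\<And>i k. i \<in> A \<Longrightarrow> coeff (p i) k \<in> K" "\<And>i k. i \<in> A \<Longrightarrow> k \<ge> D \<Longrightarrow> coeff (p i) k = 0"
    "(\<Sum>i\<in>A. poly (p i) y * z i) = 0" for D p
    using that
  proof (induction D arbitrary: p)
    case 0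
    then show ?case by (auto intro!: poly_eqI)
  next
    case (Suc D)
    define q where "q = (\<lambda>i. poly_shift 1 (p i))"
    have pq: "p i = pCons (coeff (p i) 0) (q i)" for i
      by (rule poly_eqI) (auto simp: q_def coeff_pCons coeff_poly_shift split: nat.splits)
    have "(\<Sum>i\<in>A. poly (p i) y * z i) = (\<Sum>i\<in>A. coeff (p i) 0 * z i + y * (poly (q i) y * z i))"
      by (subst (1) pq) (simp add: algebra_simps)
    then have s: "(\<Sum>i\<in>A. coeff (p i) 0 * z i) + y * (\<Sum>i\<in>A. poly (q i) y * z i) = 0"
      using Suc.prems(3) by (simp add: sum.distrib sum_distrib_left)
    have "(\<Sum>i\<in>A. coeff (p i) 0 * z i) \<in> (*) y ` R" if "R \<in> S" for R
    proof -
      have R: "R \<in> places K" using that S by blast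
      note r = place_ringD[OF R]
      have "poly (q i) y \<in> polys_over K y" if "i \<in> A" for i
        unfolding polys_over_def q_def using Suc.prems(1)[OF that]
        by (intro CollectI exI conjI refl) (auto simp: coeff_poly_shift)
      then have "poly (q i) y \<in> R" if "i \<in> A" for i
        using that polys_over_subset[OF place_ring[OF R] place_K[OF R] max_idealD(1)[OF y(2)[OF \<open>R \<in> S\<close>]]]
          by blast
      then have "- (\<Sum>i\<in>A. poly (q i) y * z i) \<in> R"
        using A(2) that by (intro r closed_ring_sum[OF place_ring[OF R]]) auto
      moreover have "(\<Sum>i\<in>A. coeff (p i) 0 * z i) = y * - (\<Sum>i\<in>A. poly (q i) y * z i)"
        using s by (simp add: eq_neg_iff_add_eq_0)
      ultimately show ?thesis by blast
    qed
    then have z0: "\<And>i. i \<in> A \<Longrightarrow> coeff (p i) 0 = 0"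
      using lin_indep_modD[OF ind, of "\<lambda>i. coeff (p i) 0"] Suc.prems(1) by blast
    then have "(\<Sum>i\<in>A. poly (q i) y * z i) = 0" using s y(1) by simp
    then have "\<forall>i\<in>A. q i = 0"
      using Suc.prems by (intro Suc.IH) (auto simp: q_def coeff_poly_shift)
    then show ?case using pq z0 by (metis pCons_0_0)
  qed
  note * = this
  define D where "D = Suc (\<Sum>i\<in>A. degree (p i))"
  have "coeff (p i) k = 0" if "i \<in> A" "k \<ge> D" for i k
  proof -
    have "degree (p i) \<le> (\<Sum>i\<in>A. degree (p i))" using that A(1) by (intro member_le_sum) auto
    then show ?thesis using that by (intro coeff_eq_0) (auto simp: D_def)
  qed
  then have "\<forall>i\<in>A. p i = 0"
    using c(3) p by (intro *[of p D]) auto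
  then show False using c(2) p(2) by auto
qed

end

context ff_basis begin

lemma max_ideal_dep_over:
  assumes "R \<in> places K" "y \<in> max_ideal R" "y \<noteq> 0" shows "\<exists>M. dep_over K y M"
  using dep_over_transcendental max_ideal_transcendental assms by blast

lemma finite_dim_mod_mult:
  assumes R: "R \<in> places K" and z: "z \<in> R" "z \<noteq> 0"
  shows "\<exists>d. has_dim K R ((*) z ` R) d"
proof (cases "z \<in> max_ideal R")
  case True
  then obtain M where M: "dep_over K z M" using max_ideal_dep_over[OF R] z by blast
  have "\<exists>d\<le>M. has_dim K R ((*) z ` R) d"
  proof (rule has_dim_bounded_exists[OF ksubspace_times[OF ksubspace_place[OF R]]])
    fix d and b :: "nat \<Rightarrow> 'f" assume "\<And>i. i < d \<Longrightarrow> b i \<in> R" "lin_indep_mod K ((*) z ` R) {..<d} b"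
    then show "d \<le> M" using card_indep_le_of_dep_over[of "{R}" z "{..<d}" b M] R z True M by auto
  qed
  then show ?thesis by blast
next
  case False
  then have "inverse z \<in> R" using not_max_idealD z by blast
  have "(*) z ` R = R"
  proof
    show "(*) z ` R \<subseteq> R" using place_ringD(4)[OF R] z by auto
    show "R \<subseteq> (*) z ` R"
    proof
      fix a assume "a \<in> R"
      then have "inverse z * a \<in> R" using place_ringD(4)[OF R] \<open>inverse z \<in> R\<close> by blast
      then show "a \<in> (*) z ` R" using z by (intro image_eqI[of _ _ "inverse z * a"]) auto
    qed
  qed
  then show ?thesis using has_dim_self[OF ksubspace_place[OF R]] by metis
qed

text \<open>The dimension of R/tR is that of R/sR plus that of sR/tR, and the latter is not 0 since
  \<open>s\<close> is outside tR. The dimension thus measures divisibility before any valuation is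
  available.\<close>

lemma dim_mod_mult_less:
  assumes R: "R \<in> places K" and sR: "s \<in> R" and t: "t \<in> (*) s ` R" "t \<noteq> 0" "s \<notin> (*) t ` R"
    and d: "has_dim K R ((*) t ` R) d"
  shows "\<exists>e<d. has_dim K R ((*) s ` R) e"
proof -
  note r = place_ringD[OF R]
  have s: "s \<noteq> 0" using t by auto
  have sub: "(*) t ` R \<subseteq> (*) s ` R"
  proof -
    obtain a where "a \<in> R" "t = s * a" using t(1) by blast
    then show ?thesis using r(4) by (auto simp: mult.assoc)
  qed
  have subR: "(*) s ` R \<subseteq> R" using r(4) sR by auto
  note k = ksubspace_times[OF ksubspace_place[OF R]] ksubspace_place[OF R]
  obtain e where e: "has_dim K R ((*) s ` R) e" using finite_dim_mod_mult[OF R sR s] by blast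
  obtain f where f: "has_dim K ((*) s ` R) ((*) t ` R) f" using has_dim_subspace[OF k(1) d subR] by blast
  have "d = e + f" using has_dim_unique[OF k(1) d has_dim_trans[OF k(1) k(1) k(2) sub subR e f]] .
  moreover have "f \<noteq> 0"
  proof
    assume "f = 0"
    then have "(*) s ` R \<subseteq> (*) t ` R" using has_dim_0D f by blast
    moreover have "s \<in> (*) s ` R" using r(2) by (intro image_eqI[of _ _ 1]) auto
    ultimately show False using t(3) by blast
  qed
  ultimately show ?thesis using e by (intro exI[of _ e]) auto
qed

text \<open>A nonzero \<open>t\<close> in the maximal ideal with R/tR of least dimension generates
  the ideal: in a valuation ring an \<open>s\<close> that is not a multiple of \<open>t\<close> is a
  proper divisor of \<open>t\<close>, and R/sR would have smaller dimension.\<close>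

lemma uniformizer_exists:
  assumes R: "R \<in> places K"
  shows "\<exists>t. uniformizer R t"
proof -
  note r = place_ringD[OF R]
  define Pd where "Pd = (\<lambda>d. \<exists>t\<in>max_ideal R. t \<noteq> 0 \<and> has_dim K R ((*) t ` R) d)"
  obtain t where "t \<in> max_ideal R" "t \<noteq> 0" using max_ideal_nonzero[OF R] by blast
  then have ex: "\<exists>d. Pd d" unfolding Pd_def using finite_dim_mod_mult[OF R] max_idealD(1) by blast
  define d where "d = (LEAST d. Pd d)"
  have "Pd d" unfolding d_def using LeastI_ex[OF ex] .
  then obtain t where t: "t \<in> max_ideal R" "t \<noteq> 0" "has_dim K R ((*) t ` R) d" unfolding Pd_def by blast
  have "s \<in> (*) t ` R" if s: "s \<in> max_ideal R" for s
  proof (rule ccontr)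
    assume n: "s \<notin> (*) t ` R"
    have s0: "s \<noteq> 0" using n r(1) by (metis image_eqI mult_zero_right)
    have "s / t \<notin> R" using n t(2) by (metis image_eqI nonzero_mult_div_cancel_left times_divide_eq_right)
    then have "t / s \<in> R" using place_inverse[OF R, of "s / t"] max_idealD(1) by auto
    then have "t \<in> (*) s ` R" using s0 by (intro image_eqI[of _ _ "t / s"]) auto
    then obtain e where "e < d" "has_dim K R ((*) s ` R) e"
      using dim_mod_mult_less[OF R max_idealD(1)[OF s] _ t(2) n t(3)] by blast
    then have "Pd e" unfolding Pd_def using s s0 by blast
    then show False using not_less_Least[of e Pd] \<open>e < d\<close> unfolding d_def by blast
  qed
  moreover have "t * a \<in> max_ideal R" if "a \<in> R" for a
    using max_ideal_mult[OF R t(1) that] by (simp add: mult.commute)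
  ultimately have "max_ideal R = {t * a | a. a \<in> R}" by blast
  then show ?thesis unfolding uniformizer_def using t max_idealD(1) by blast
qed

lemma unif:
  assumes R: "R \<in> places K"
  shows "unif R \<in> max_ideal R" "unif R \<noteq> 0" "max_ideal R = (*) (unif R) ` R" "unif R \<in> R" "inverse (unif R) \<notin> R"
proof -
  have u: "uniformizer R (unif R)" unfolding unif_def using someI_ex[OF uniformizer_exists[OF R]] .
  then show m: "max_ideal R = (*) (unif R) ` R" unfolding uniformizer_def by auto
  show 1: "unif R \<in> max_ideal R" unfolding m using place_ringD(2)[OF R]
    by (intro image_eqI[of _ _ 1]) auto
  show 2: "unif R \<noteq> 0"
  proof
    assume "unif R = 0"
    then have "max_ideal R \<subseteq> {0}" unfolding m by auto
    then show False using max_ideal_nonzero[OF R] by blast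
  qed
  show "unif R \<in> R" "inverse (unif R) \<notin> R" using max_idealD 1 2 by blast+
qed

section \<open>The normalized valuation of a place\<close>

definition unit_of :: "'f set \<Rightarrow> 'f \<Rightarrow> bool" where
  "unit_of R w \<longleftrightarrow> w \<in> R \<and> w \<noteq> 0 \<and> inverse w \<in> R"

lemma unit_mult: "R \<in> places K \<Longrightarrow> unit_of R v \<Longrightarrow> unit_of R w \<Longrightarrow> unit_of R (v * w)"
  unfolding unit_of_def using place_ringD(4) by (simp add: mult.commute)

lemma unit_inverse: "unit_of R w \<Longrightarrow> unit_of R (inverse w)"
  unfolding unit_of_def by simp

lemma unit_not_max: "unit_of R w \<Longrightarrow> w \<notin> max_ideal R"
  unfolding unit_of_def max_ideal_def by auto

lemma unit_one: "R \<in> places K \<Longrightarrow> unit_of R 1"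
  unfolding unit_of_def using place_ringD(2) by simp

text \<open>Division by the uniformizer strictly lowers the dimension of R/zR, so it can be repeated
  only finitely often before a unit remains.\<close>

lemma val_decomp_R:
  assumes R: "R \<in> places K" and "z \<in> R" "z \<noteq> 0"
  shows "\<exists>n w. unit_of R w \<and> z = unif R ^ n * w"
proof -
  obtain d where "has_dim K R ((*) z ` R) d" using finite_dim_mod_mult[OF assms] by blast
  then show ?thesis using assms(2,3)
  proof (induction d arbitrary: z rule: less_induct)
    case (less d)
    show ?case
    proof (cases "z \<in> max_ideal R")
      case False
      then have "unit_of R z" unfolding unit_of_def using not_max_idealD less.prems by blast
      then show ?thesis by (intro exI[of _ 0] exI[of _ z]) auto
    next
      case True
      then obtain a where a: "a \<in> R" "z = unif R * a" using unif(3)[OF R] by blast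
      have "a \<notin> (*) z ` R"
      proof
        assume "a \<in> (*) z ` R"
        then obtain b where b: "b \<in> R" "a = z * b" by blast
        have "a * (unif R * b) = z * b" unfolding a(2) by (simp only: mult_ac)
        then have "a * 1 = a * (unif R * b)" using b(2) by (simp only: mult_1_right)
        then have "unif R * b = 1" using a less.prems(3) by (metis mult_cancel_left mult_zero_right)
        then have "inverse (unif R) = b" by (rule inverse_unique)
        then show False using unif(5)[OF R] b by simp
      qed
      moreover have "z \<in> (*) a ` R" using a unif(4)[OF R] by (intro image_eqI[of _ _ "unif R"]) auto
      ultimately have "\<exists>e<d. has_dim K R ((*) a ` R) e"
        using dim_mod_mult_less[OF R a(1) _ less.prems(3) _ less.prems(1)] by blast
      then obtain e where e: "e < d" "has_dim K R ((*) a ` R) e" by blast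
      moreover have "a \<noteq> 0" using a(2) less.prems(3) by (metis mult_zero_right)
      ultimately obtain n w where "unit_of R w" "a = unif R ^ n * w" using less.IH[OF e a(1)] by blast
      then show ?thesis using a by (intro exI[of _ "Suc n"] exI[of _ w]) auto
    qed
  qed
qed

lemma val_decomp:
  assumes R: "R \<in> places K" and z: "z \<noteq> 0"
  shows "\<exists>n w. unit_of R w \<and> z = unif R powi n * w"
proof (cases "z \<in> R")
  case True
  then obtain n w where "unit_of R w" "z = unif R ^ n * w" using val_decomp_R[OF R] z by blast
  then show ?thesis by (intro exI[of _ "int n"] exI[of _ w]) simp
next
  case False
  then have "inverse z \<in> R" using place_inverse[OF R] max_idealD(1) by blast
  then obtain n w where w: "unit_of R w" "inverse z = unif R ^ n * w" using val_decomp_R[OF R, of "inverse z"] z by auto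
  have "z = inverse (unif R ^ n * w)" by (simp only: w(2)[symmetric] inverse_inverse_eq)
  also have "\<dots> = unif R powi (- int n) * inverse w" by (simp add: power_int_minus)
  finally show ?thesis using unit_inverse[OF w(1)] by blast
qed

lemma unif_powi_max:
  assumes R: "R \<in> places K" and "n > 0"
  shows "unif R powi n \<in> max_ideal R"
proof -
  obtain m where m: "n = int (Suc m)" using assms(2) that[of "nat n - 1"] by simp
  have "unif R ^ m * unif R \<in> max_ideal R"
    by (intro max_ideal_mult[OF R unif(1)[OF R]] closed_ring_power[OF place_ring[OF R] unif(4)[OF R]])
  then show ?thesis by (simp only: m power_int_of_nat power_Suc2)
qed

text \<open>The exponent is unique, as the \<open>THE\<close> in \<open>ord\<close> demands: from
  exponents n < m the unit \<open>w\<close> would be a multiple of a positive power of the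
  uniformizer.\<close>

lemma ord_eqI:
  assumes R: "R \<in> places K" and w: "unit_of R w" "z = unif R powi n * w"
  shows "ord R z = n"
proof -
  have less: False if "n < m" "unit_of R w" "unit_of R v" "unif R powi n * w = unif R powi m * v" for n m v w
  proof -
    have e: "n + (m - n) = m" by simp
    have "unif R powi m = unif R powi n * unif R powi (m - n)"
      using power_int_add[of "unif R" n "m - n", OF disjI1[OF unif(2)[OF R]]] unfolding e .
    then have "unif R powi n * w = unif R powi n * (unif R powi (m - n) * v)"
      using that(4) by (simp only: mult.assoc)
    then have "w = unif R powi (m - n) * v"
      using unif(2)[OF R] by (simp only: mult_cancel_left power_int_eq_0_iff simp_thms)
    moreover have "v * unif R powi (m - n) \<in> max_ideal R"
      using that by (intro max_ideal_mult[OF R] unif_powi_max[OF R]) (auto simp: unit_of_def)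
    ultimately show False using unit_not_max that(2) by (metis mult.commute)
  qed
  have "ord R z = (THE n. \<exists>w. unit_of R w \<and> z = unif R powi n * w)"
    unfolding ord_def unif_def unit_of_def by (simp add: conj_assoc)
  also have "\<dots> = n"
  proof (rule the_equality)
    show "\<exists>w. unit_of R w \<and> z = unif R powi n * w" using w by blast
    fix m assume "\<exists>w. unit_of R w \<and> z = unif R powi m * w"
    then obtain v where "unit_of R v" "z = unif R powi m * v" by blast
    then show "m = n" using less[of m n v w] less[of n m w v] w by (metis linorder_neqE)
  qed
  finally show ?thesis .
qed

lemma ordE:
  assumes R: "R \<in> places K" and z: "z \<noteq> 0"
  obtains w where "unit_of R w" "z = unif R powi (ord R z) * w"
  using val_decomp[OF R z] ord_eqI[OF R] by metis

lemma ord_mult: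
  assumes R: "R \<in> places K" and "y \<noteq> 0" "z \<noteq> 0"
  shows "ord R (y * z) = ord R y + ord R z"
proof -
  obtain v where v: "unit_of R v" "y = unif R powi (ord R y) * v" by (rule ordE[OF R assms(2)])
  obtain w where w: "unit_of R w" "z = unif R powi (ord R z) * w" by (rule ordE[OF R assms(3)])
  have "y * z = (unif R powi (ord R y) * v) * (unif R powi (ord R z) * w)" using v(2) w(2) by simp
  also have "\<dots> = unif R powi (ord R y + ord R z) * (v * w)"
    using power_int_add[of "unif R" "ord R y" "ord R z"] unif(2)[OF R] by (simp add: mult_ac)
  finally show ?thesis using ord_eqI[OF R unit_mult[OF R v(1) w(1)]] by blast
qed

lemma ord_one: "R \<in> places K \<Longrightarrow> ord R 1 = 0"
  using ord_eqI[OF _ unit_one, of R 1 0] by simp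

lemma ord_inverse:
  assumes R: "R \<in> places K" and "z \<noteq> 0"
  shows "ord R (inverse z) = - ord R z"
  using ord_mult[OF R, of z "inverse z"] ord_one[OF R] assms by simp

lemma ord_power:
  assumes R: "R \<in> places K" and "z \<noteq> 0"
  shows "ord R (z ^ n) = int n * ord R z"
  by (induction n) (use assms in \<open>auto simp: ord_one ord_mult algebra_simps\<close>)

lemma ord_unif_powi: "R \<in> places K \<Longrightarrow> ord R (unif R powi n) = n"
  using ord_eqI[OF _ unit_one, of R "unif R powi n" n] by simp

lemma ord_nonneg_iff:
  assumes R: "R \<in> places K" and z: "z \<noteq> 0"
  shows "ord R z \<ge> 0 \<longleftrightarrow> z \<in> R"
proof -
  obtain w where w: "unit_of R w" "z = unif R powi (ord R z) * w" using ordE[OF R z] .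
  show ?thesis
  proof
    assume "ord R z \<ge> 0"
    then have "unif R powi (ord R z) \<in> R"
      unfolding power_int_def by (simp add: closed_ring_power[OF place_ring[OF R] unif(4)[OF R]])
    then show "z \<in> R" using w place_ringD(4)[OF R] unfolding unit_of_def by metis
  next
    assume zR: "z \<in> R"
    show "ord R z \<ge> 0"
    proof (rule ccontr)
      assume "\<not> ord R z \<ge> 0"
      then have "z * unif R powi (- ord R z) \<in> max_ideal R"
        using unif_powi_max[OF R] max_ideal_mult[OF R _ zR] by simp
      moreover have "z * unif R powi (- ord R z) = w"
        using unif(2)[OF R] by (subst w(2)) (simp add: power_int_minus)
      ultimately show False using unit_not_max w(1) by blast
    qed
  qed
qed

lemma ord_pos_iff:
  assumes R: "R \<in> places K" and z: "z \<noteq> 0"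
  shows "ord R z > 0 \<longleftrightarrow> z \<in> max_ideal R"
  using ord_nonneg_iff[OF R z] ord_nonneg_iff[OF R, of "inverse z"] ord_inverse[OF R z] z
  unfolding max_ideal_def by auto

lemma val_ge_0:
  assumes R: "R \<in> places K" shows "val_ge R 0 = R"
proof (rule set_eqI)
  fix z show "z \<in> val_ge R 0 \<longleftrightarrow> z \<in> R"
    using ord_nonneg_iff[OF R, of z] place_ringD(1)[OF R] unfolding val_ge_def by (cases "z = 0") auto
qed

lemma val_ge_1:
  assumes R: "R \<in> places K" shows "val_ge R 1 = max_ideal R"
proof (rule set_eqI)
  fix z show "z \<in> val_ge R 1 \<longleftrightarrow> z \<in> max_ideal R"
    using ord_pos_iff[OF R, of z] zero_max_ideal[OF R] unfolding val_ge_def by (cases "z = 0") auto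
qed

lemma val_ge_shift:
  assumes R: "R \<in> places K" and y: "y \<noteq> 0"
  shows "(*) y ` val_ge R n = val_ge R (n + ord R y)"
proof
  show "(*) y ` val_ge R n \<subseteq> val_ge R (n + ord R y)"
    unfolding val_ge_def using ord_mult[OF R y] by fastforce
  show "val_ge R (n + ord R y) \<subseteq> (*) y ` val_ge R n"
  proof
    fix a assume a: "a \<in> val_ge R (n + ord R y)"
    then have "inverse y * a \<in> val_ge R n" unfolding val_ge_def
      using ord_mult[OF R, of "inverse y" a] ord_inverse[OF R y] y by (cases "a = 0") auto
    then show "a \<in> (*) y ` val_ge R n" using y by (intro image_eqI[of _ _ "inverse y * a"]) auto
  qed
qed

lemma ksubspace_val_ge: "R \<in> places K \<Longrightarrow> ksubspace K (val_ge R n)"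
  using val_ge_shift[of R "unif R powi n" 0] val_ge_0[of R] ord_unif_powi[of R n] unif(2)[of R]
    ksubspace_times[OF ksubspace_place[of R], of "unif R powi n"] by simp

lemma val_ge_mult:
  "R \<in> places K \<Longrightarrow> a \<in> val_ge R m \<Longrightarrow> b \<in> val_ge R n \<Longrightarrow> a * b \<in> val_ge R (m + n)"
  unfolding val_ge_def using ord_mult[of R a b] by (cases "a = 0 \<or> b = 0") auto

lemma val_ge_mono: "m \<le> n \<Longrightarrow> val_ge R n \<subseteq> val_ge R m"
  unfolding val_ge_def by auto

lemma val_ge_ord: "z \<in> val_ge R (ord R z)"
  unfolding val_ge_def by simp

text \<open>The strict triangle inequality. That the sum is nonzero is recorded too, because a
  statement about \<open>ord\<close> alone could not exclude 0.\<close>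

lemma ord_add_eq:
  assumes R: "R \<in> places K" and "y \<noteq> 0" "z \<in> val_ge R (ord R y + 1)"
  shows "ord R (y + z) = ord R y" "y + z \<noteq> 0"
proof -
  let ?n = "ord R y"
  have "y + z \<in> val_ge R ?n"
    using ksubspaceD(2)[OF ksubspace_val_ge[OF R], of y ?n z] val_ge_ord assms(3) val_ge_mono[of ?n "?n + 1"] by auto
  moreover have "y + z \<notin> val_ge R (?n + 1)"
  proof
    assume "y + z \<in> val_ge R (?n + 1)"
    then have "y + z - z \<in> val_ge R (?n + 1)" by (intro ksubspace_diff[OF ksubspace_val_ge[OF R]] assms)
    then show False using assms(2) unfolding val_ge_def by simp
  qed
  ultimately show "ord R (y + z) = ord R y" "y + z \<noteq> 0" unfolding val_ge_def by auto
qed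

lemma has_dim_residue: "R \<in> places K \<Longrightarrow> has_dim K R (max_ideal R) (place_degree K R)"
proof -
  assume R: "R \<in> places K"
  obtain d where "has_dim K R (max_ideal R) d"
    using finite_dim_mod_mult[OF R unif(4)[OF R] unif(2)[OF R]] unif(3)[OF R] by auto
  then show ?thesis using place_degree_eq[OF ksubspace_max_ideal[OF R]] by simp
qed

text \<open>Each step of the filtration is a scaled copy of \<open>R\<close> modulo its maximal
  ideal.\<close>

lemma has_dim_val_ge:
  assumes R: "R \<in> places K"
  shows "has_dim K (val_ge R n) (val_ge R (n + int k)) (k * place_degree K R)"
proof (induction k)
  case 0 then show ?case using has_dim_self[OF ksubspace_val_ge[OF R]] by simp
next
  case (Suc k)
  let ?m = "n + int k"
  have "has_dim K (val_ge R ?m) (val_ge R (1 + ?m)) (place_degree K R)"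
    using has_dim_scale[of "unif R powi ?m", OF _ has_dim_residue[OF R]] unif(2)[OF R]
      val_ge_shift[OF R, of "unif R powi ?m" 0] val_ge_shift[OF R, of "unif R powi ?m" 1]
    by (simp add: val_ge_0[OF R] val_ge_1[OF R] ord_unif_powi[OF R])
  then have "has_dim K (val_ge R n) (val_ge R (1 + ?m)) (k * place_degree K R + place_degree K R)"
    by (intro has_dim_trans[OF _ _ _ _ _ Suc] ksubspace_val_ge[OF R] val_ge_mono) auto
  then show ?case by (simp add: algebra_simps)
qed

lemma place_degree_pos:
  assumes R: "R \<in> places K" shows "place_degree K R > 0"
proof (rule ccontr)
  assume "\<not> place_degree K R > 0"
  then have "R \<subseteq> max_ideal R" using has_dim_0D has_dim_residue[OF R] by simp
  then show False using unit_one[OF R] unit_not_max unfolding unit_of_def by blast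
qed

end

section \<open>Weak approximation and degrees of zero divisors\<close>

context ff_basis begin

text \<open>A discrete valuation ring is a maximal proper subring. If \<open>S\<close> contained
  \<open>R\<close> and some \<open>z\<close> with a pole at \<open>R\<close>, any \<open>v\<close>
  would be the product of \<open>v / z ^ k\<close>, which lies in \<open>R\<close> for large
  \<open>k\<close>, and \<open>z ^ k\<close>; so \<open>S\<close> would be all of F.\<close>

lemma places_incomparable:
  assumes R: "R \<in> places K" and S: "S \<in> places K" and "R \<noteq> S"
  shows "\<exists>z\<in>R. z \<notin> S"
proof (rule ccontr)
  assume "\<not> (\<exists>z\<in>R. z \<notin> S)"
  then have sub: "R \<subseteq> S" by blast
  then obtain z where z: "z \<in> S" "z \<notin> R" using assms(3) by blast
  obtain v where v: "v \<notin> S" using S unfolding places_def valuation_ring_def by blast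
  have v0: "v \<noteq> 0" and z0: "z \<noteq> 0"
    using v z place_ringD(1)[OF S] place_ringD(1)[OF R] by auto
  obtain k where k: "int k = \<bar>ord R v\<bar>" using zero_le_imp_eq_int[of "\<bar>ord R v\<bar>"] by auto
  have "ord R z \<le> -1" using ord_nonneg_iff[OF R z0] z(2) by auto
  then have "int k * ord R z \<le> int k * (-1)" by (intro mult_left_mono) auto
  then have "ord R (v * inverse (z ^ k)) \<ge> 0"
    using ord_mult[OF R v0, of "inverse (z ^ k)"] ord_inverse[OF R, of "z ^ k"] ord_power[OF R z0, of k] z0
      k by simp
  then have "v * inverse (z ^ k) \<in> S" using ord_nonneg_iff[OF R, of "v * inverse (z ^ k)"] v0 z0 sub by auto
  then have "v * inverse (z ^ k) * z ^ k \<in> S"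
    using place_ringD(4)[OF S] closed_ring_power[OF place_ring[OF S] z(1)] by blast
  then show False using v z0 by (simp add: mult.assoc)
qed

lemma max_ideal_power:
  assumes "R \<in> places K" "z \<in> max_ideal R" shows "z ^ Suc k \<in> max_ideal R"
  using max_ideal_mult[OF assms closed_ring_power[OF place_ring[OF assms(1)] max_idealD(1)[OF assms(2)], of k]]
  by (simp only: power_Suc2)

lemma power_notin_place:
  assumes R: "R \<in> places K" and "z \<notin> R" shows "z ^ Suc k \<notin> R"
proof
  assume a: "z ^ Suc k \<in> R"
  have z0: "z \<noteq> 0" using assms place_ringD(1)[OF R] by auto
  have "ord R z < 0" using ord_nonneg_iff[OF R z0] assms(2) by auto
  then have "int (Suc k) * ord R z < 0" by (intro mult_pos_neg) auto
  then have "ord R (z ^ Suc k) < 0" using ord_power[OF R z0, of "Suc k"] by (simp del: power_Suc)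
  then show False using ord_nonneg_iff[OF R, of "z ^ Suc k"] a z0 by simp
qed

text \<open>If the \<open>v\<close> found for \<open>T\<close> has no pole at the new place
  \<open>Q\<close>, a high power of some \<open>z\<close> that vanishes at \<open>P\<close> and has
  a pole at \<open>Q\<close> is added. The exponent is so high that it cannot cancel the poles of
  \<open>v\<close> at the other places.\<close>

lemma approx_separate:
  assumes "finite T" "T \<subseteq> places K" and P: "P \<in> places K" "P \<notin> T"
  shows "\<exists>v\<in>max_ideal P. \<forall>Q\<in>T. v \<notin> Q"
  using assms(1,2,4)
proof (induction T rule: finite_induct)
  case empty
  then show ?case using zero_max_ideal[OF P(1)] by blast
next
  case (insert Q T)
  then obtain v where v: "v \<in> max_ideal P" "\<forall>S\<in>T. v \<notin> S" by auto
  have Q: "Q \<in> places K" and PQ: "P \<noteq> Q" using insert by auto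
  show ?case
  proof (cases "v \<in> Q")
    case False then show ?thesis using v by blast
  next
    case True
    obtain a b where a: "a \<in> P" "a \<notin> Q" and b: "b \<in> Q" "b \<notin> P"
      using places_incomparable[OF P(1) Q PQ] places_incomparable[OF Q P(1)] PQ by metis
    define z where "z = a * inverse b"
    have b0: "b \<noteq> 0" using b closed_ringD(1)[OF place_ring[OF P(1)]] by auto
    have zP: "z \<in> max_ideal P" unfolding z_def by (intro max_ideal_mult[OF P(1)] place_inverse[OF P(1)] a b)
    have zQ: "z \<notin> Q"
    proof
      assume "z \<in> Q"
      then have "z * b \<in> Q" using place_ringD(4)[OF Q] b by blast
      then show False using a b0 unfolding z_def by (simp add: mult.assoc)
    qed
    \<comment> \<open>\<open>Suc r\<close> exceeds every |ord S v|, so wherever \<open>z\<close> has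
      a pole its power dominates \<open>v\<close>.\<close>
    define r where "r = (\<Sum>S\<in>T. nat \<bar>ord S v\<bar>)"
    let ?w = "v + z ^ Suc r"
    have "?w \<in> max_ideal P" by (intro max_ideal_add[OF P(1)] v max_ideal_power[OF P(1)] zP)
    moreover have "?w \<notin> Q"
    proof
      assume "?w \<in> Q"
      then have "?w - v \<in> Q" using place_ringD(6)[OF Q] True by blast
      then show False using power_notin_place[OF Q zQ, of r] by simp
    qed
    moreover have "?w \<notin> S" if "S \<in> T" for S
    proof
      assume w: "?w \<in> S"
      have S: "S \<in> places K" using that insert by auto
      have vS: "v \<notin> S" using v that by blast
      have zS: "z \<notin> S"
      proof
        assume "z \<in> S"
        then have "?w - z ^ Suc r \<in> S" using w place_ringD(6)[OF S] closed_ring_power[OF place_ring[OF S]] by blast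
        then show False using vS by simp
      qed
      then have z0: "z \<noteq> 0" using place_ringD(1)[OF S] by auto
      have "nat \<bar>ord S v\<bar> \<le> r" unfolding r_def using that insert.hyps by (intro member_le_sum) auto
      moreover have "ord S z \<le> -1" using ord_nonneg_iff[OF S z0] zS by auto
      then have "int (Suc r) * ord S z \<le> int (Suc r) * (-1)" by (intro mult_left_mono) auto
      ultimately have o: "ord S (z ^ Suc r) + 1 \<le> ord S v" "ord S (z ^ Suc r) < 0"
        using ord_power[OF S z0, of "Suc r"] by (auto simp del: power_Suc)
      have "v \<in> val_ge S (ord S (z ^ Suc r) + 1)" unfolding val_ge_def using o by auto
      then have "ord S (z ^ Suc r + v) = ord S (z ^ Suc r)" "z ^ Suc r + v \<noteq> 0"
        using ord_add_eq[OF S, of "z ^ Suc r" v] z0 by (simp_all del: power_Suc)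
      then show False using ord_nonneg_iff[OF S, of "z ^ Suc r + v"] o w by (simp add: add.commute del: power_Suc)
    qed
    ultimately show ?thesis by blast
  qed
qed

text \<open>The function 1 / (1 + s) with s = \<open>v ^ Suc m\<close> is close to 1 where s has a
  zero of high order and close to 0 where s has a pole of high order.\<close>

lemma approx_one:
  assumes T: "finite T" "T \<subseteq> places K" and P: "P \<in> places K" "P \<notin> T"
  shows "\<exists>w. w - 1 \<in> val_ge P (int m) \<and> (\<forall>Q\<in>T. w \<in> val_ge Q (int m))"
proof -
  obtain v where v: "v \<in> max_ideal P" "\<forall>Q\<in>T. v \<notin> Q" using approx_separate[OF assms] by blast
  let ?s = "v ^ Suc m"
  define w where "w = inverse (1 + ?s)"
  have pw: "v ^ k \<in> val_ge P (int k)" for k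
  proof (induction k)
    case 0 then show ?case using ord_one[OF P(1)] by (simp add: val_ge_def)
  next
    case (Suc k)
    then have "v * v ^ k \<in> val_ge P (1 + int k)" using v(1) val_ge_1[OF P(1)] val_ge_mult[OF P(1)] by blast
    then show ?case by simp
  qed
  have "?s \<in> val_ge P (ord P 1 + 1)" using pw[of "Suc m"] val_ge_mono[of 1 "int (Suc m)" P] ord_one[OF P(1)] by auto
  then have o: "ord P (1 + ?s) = 0" "1 + ?s \<noteq> 0" using ord_add_eq[OF P(1), of 1 ?s] ord_one[OF P(1)] by auto
  then have "w \<in> val_ge P 0" unfolding val_ge_def w_def using ord_inverse[OF P(1), of "1 + ?s"] by auto
  then have "?s * w \<in> val_ge P (int (Suc m) + 0)" using pw[of "Suc m"] val_ge_mult[OF P(1)] by blast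
  then have "- (?s * w) \<in> val_ge P (int m)"
    using val_ge_mono[of "int m" "int (Suc m)" P] ksubspace_uminus[OF ksubspace_val_ge[OF P(1)]] by auto
  moreover have "w - 1 = - (?s * w)"
  proof -
    have "(1 + ?s) * w = 1" unfolding w_def using o(2) by simp
    then have "w + ?s * w = 1" by (simp only: distrib_right mult_1_left)
    then show ?thesis by (simp only: eq_neg_iff_add_eq_0) (simp add: algebra_simps)
  qed
  ultimately have "w - 1 \<in> val_ge P (int m)" by simp
  moreover have "w \<in> val_ge Q (int m)" if "Q \<in> T" for Q
  proof -
    have Q: "Q \<in> places K" using that T by auto
    have vQ: "v \<notin> Q" using v that by blast
    have v0: "v \<noteq> 0" using place_ringD(1)[OF Q] vQ by auto
    have "ord Q v \<le> -1" using ord_nonneg_iff[OF Q v0] vQ by auto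
    then have "int (Suc m) * ord Q v \<le> int (Suc m) * (-1)" by (intro mult_left_mono) auto
    then have le: "ord Q ?s \<le> - int (Suc m)" using ord_power[OF Q v0, of "Suc m"] by (simp del: power_Suc)
    then have "1 \<in> val_ge Q (ord Q ?s + 1)" unfolding val_ge_def using ord_one[OF Q] by auto
    then have "ord Q (?s + 1) = ord Q ?s" "?s + 1 \<noteq> 0"
      using ord_add_eq[OF Q, of ?s 1] v0 by (simp_all del: power_Suc)
    then have "ord Q w = - ord Q ?s" unfolding w_def using ord_inverse[OF Q, of "1 + ?s"] by (simp add: add.commute del: power_Suc)
    then show ?thesis unfolding val_ge_def using le by auto
  qed
  ultimately show ?thesis by blast
qed

lemma weak_approximation:
  assumes T: "finite T" "T \<subseteq> places K" and P: "P \<in> places K" "P \<notin> T"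
  shows "\<exists>z. z - b \<in> val_ge P m \<and> (\<forall>Q\<in>T. z \<in> val_ge Q m)"
proof -
  \<comment> \<open>The precision of \<open>w\<close> must make up for possible poles of
    \<open>b\<close>, at \<open>P\<close> and at every place of \<open>T\<close>.\<close>
  define M where "M = nat (\<bar>m\<bar> + \<bar>ord P b\<bar> + (\<Sum>Q\<in>T. \<bar>ord Q b\<bar>))"
  obtain w where w: "w - 1 \<in> val_ge P (int M)" "\<forall>Q\<in>T. w \<in> val_ge Q (int M)"
    using approx_one[OF assms] by blast
  have s: "(\<Sum>Q\<in>T. \<bar>ord Q b\<bar>) \<ge> 0" by (intro sum_nonneg) auto
  then have M: "int M = \<bar>m\<bar> + \<bar>ord P b\<bar> + (\<Sum>Q\<in>T. \<bar>ord Q b\<bar>)" unfolding M_def by simp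
  have "(w - 1) * b \<in> val_ge P (int M + ord P b)" using val_ge_mult[OF P(1) w(1) val_ge_ord] .
  moreover have "m \<le> int M + ord P b" using M s by linarith
  ultimately have "w * b - b \<in> val_ge P m" using val_ge_mono by (auto simp: left_diff_distrib)
  moreover have "w * b \<in> val_ge Q m" if Q: "Q \<in> T" for Q
  proof -
    have "w * b \<in> val_ge Q (int M + ord Q b)" using val_ge_mult[of Q w "int M" b "ord Q b"] val_ge_ord w(2) Q T by blast
    moreover have "\<bar>ord Q b\<bar> \<le> (\<Sum>Q\<in>T. \<bar>ord Q b\<bar>)" using T Q by (intro member_le_sum) auto
    then have "m \<le> int M + ord Q b" using M by linarith
    ultimately show ?thesis using val_ge_mono by blast
  qed
  ultimately show ?thesis by blast
qed

text \<open>The degree of the zero divisor of \<open>y\<close> is at most that of F over K(y). Bases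
  of the local quotients R/yR are glued by weak approximation into one family that is independent
  modulo \<open>y\<close>, and the left-hand side counts its members.\<close>

lemma zeros_degree_le:
  assumes S: "finite S" "S \<subseteq> places K" and y: "y \<noteq> 0" "\<And>R. R \<in> S \<Longrightarrow> y \<in> max_ideal R"
    and dep: "dep_over K y M"
  shows "(\<Sum>R\<in>S. nat (ord R y) * place_degree K R) \<le> M"
proof (cases "S = {}")
  case False
  define n where "n = (\<lambda>R. nat (ord R y) * place_degree K R)"
  have pl: "R \<in> S \<Longrightarrow> R \<in> places K" for R using S by blast
  have yR: "(*) y ` R = val_ge R (ord R y)" if "R \<in> S" for R
    using val_ge_shift[OF pl[OF that] y(1), of 0] val_ge_0[OF pl[OF that]] by simp
  have pos: "ord R y > 0" if "R \<in> S" for R using ord_pos_iff[OF pl[OF that] y(1)] y(2)[OF that] by blast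
  have "has_dim K R ((*) y ` R) (n R)" if "R \<in> S" for R
    using has_dim_val_ge[OF pl[OF that], of 0 "nat (ord R y)"] pos[OF that] yR[OF that] val_ge_0[OF pl[OF that]]
    unfolding n_def by simp
  then have "\<forall>R\<in>S. \<exists>b. (\<forall>i<n R. b i \<in> R) \<and> lin_indep_mod K ((*) y ` R) {..<n R} b"
    unfolding has_dim_def by blast
  then obtain b where b: "\<And>R i. R \<in> S \<Longrightarrow> i < n R \<Longrightarrow> b R i \<in> R"
    "\<And>R. R \<in> S \<Longrightarrow> lin_indep_mod K ((*) y ` R) {..<n R} (b R)" by (metis bchoice)
  \<comment> \<open>At this precision an error is divisible by \<open>y\<close> at every place of
    \<open>S\<close>: a glued element equals its target modulo \<open>y\<close> at its own place and
    is 0 modulo \<open>y\<close> at the others.\<close>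
  define m where "m = (\<Sum>R\<in>S. ord R y)"
  have m: "ord R y \<le> m" if "R \<in> S" for R
    unfolding m_def using that S pos by (intro member_le_sum) (auto intro: less_imp_le)
  have "\<exists>z. z - b R i \<in> val_ge R m \<and> (\<forall>Q\<in>S-{R}. z \<in> val_ge Q m)" if "R \<in> S" for R i
    using weak_approximation[of "S - {R}" R "b R i" m] S that by auto
  then obtain z where z: "\<And>R i. R \<in> S \<Longrightarrow> z (R, i) - b R i \<in> val_ge R m"
    "\<And>R i Q. R \<in> S \<Longrightarrow> Q \<in> S \<Longrightarrow> Q \<noteq> R \<Longrightarrow> z (R, i) \<in> val_ge Q m"
  proof -
    assume hyp: "\<And>z. (\<And>R i. R \<in> S \<Longrightarrow> z (R, i) - b R i \<in> val_ge R m) \<Longrightarrow>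
      (\<And>R i Q. R \<in> S \<Longrightarrow> Q \<in> S \<Longrightarrow> Q \<noteq> R \<Longrightarrow> z (R, i) \<in> val_ge Q m) \<Longrightarrow> thesis"
    let ?z = "\<lambda>(R, i). SOME z. z - b R i \<in> val_ge R m \<and> (\<forall>Q\<in>S-{R}. z \<in> val_ge Q m)"
    have "?z (R, i) - b R i \<in> val_ge R m \<and> (\<forall>Q\<in>S-{R}. ?z (R, i) \<in> val_ge Q m)" if "R \<in> S" for R i
      using someI_ex[OF \<open>R \<in> S \<Longrightarrow> \<exists>z. z - b R i \<in> val_ge R m \<and> (\<forall>Q\<in>S-{R}. z \<in> val_ge Q m)\<close>[OF that]] by simp
    then show thesis using hyp[of ?z] by blast
  qed
  have my: "val_ge R m \<subseteq> (*) y ` R" if "R \<in> S" for R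
    unfolding yR[OF that] by (rule val_ge_mono[OF m[OF that]])
  have kR: "ksubspace K ((*) y ` R)" if "R \<in> S" for R
    using ksubspace_times ksubspace_place pl that by blast
  have yRR: "(*) y ` R \<subseteq> R" if "R \<in> S" for R
    using place_ringD(4)[OF pl[OF that]] max_idealD(1)[OF y(2)[OF that]] by auto
  let ?A = "Sigma S (\<lambda>R. {..<n R})"
  have "card ?A \<le> M"
  proof (rule card_indep_le_of_dep_over[OF S(2) False y, where z = z])
    show "finite ?A" using S by auto
    show "z i \<in> R" if "i \<in> ?A" "R \<in> S" for i R
    proof -
      obtain Q j where i: "i = (Q, j)" "Q \<in> S" "j < n Q" using \<open>i \<in> ?A\<close> by auto
      show ?thesis
      proof (cases "Q = R")
        case True
        have "(z (R, j) - b R j) + b R j \<in> R"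
          using z(1)[OF that(2), of j] my[OF that(2)] yRR[OF that(2)] b(1)[OF that(2)] i True
            place_ringD(3)[OF pl[OF that(2)]] by blast
        then show ?thesis using i True by simp
      next
        case False
        then show ?thesis using z(2)[OF i(2) that(2), of j] my[OF that(2)] yRR[OF that(2)] i by auto
      qed
    qed
    show "lin_indep_mod K (\<Inter>R\<in>S. (*) y ` R) ?A z"
      unfolding lin_indep_mod_def
    proof (intro allI impI)
      fix c assume c: "\<forall>i\<in>?A. c i \<in> K" "(\<Sum>i\<in>?A. c i * z i) \<in> (\<Inter>R\<in>S. (*) y ` R)"
      have "c (R, i) = 0" if R: "R \<in> S" "i < n R" for R i
      proof -
        let ?B = "(\<lambda>i. (R, i)) ` {..<n R}"
        have BA: "?B \<subseteq> ?A" using R by auto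
        have "(\<Sum>i\<in>?A. c i * z i) = (\<Sum>i\<in>?A - ?B. c i * z i) + (\<Sum>i\<in>?B. c i * z i)"
          by (rule sum.subset_diff[OF BA]) (use S in auto)
        moreover have "(\<Sum>i\<in>?B. c i * z i) = (\<Sum>i<n R. c (R, i) * z (R, i))"
          by (subst sum.reindex) (auto simp: inj_on_def)
        moreover have "(\<Sum>i\<in>?A - ?B. c i * z i) \<in> (*) y ` R"
        proof (rule ksubspace_lincomb[OF kR[OF R(1)]])
          fix j assume j: "j \<in> ?A - ?B"
          then obtain Q k where "j = (Q, k)" "Q \<in> S" "Q \<noteq> R" by auto
          then show "z j \<in> (*) y ` R" using z(2)[of Q R k] my[OF R(1)] R by auto
        qed (use c in auto)
        moreover have "(\<Sum>i\<in>?A. c i * z i) \<in> (*) y ` R" using c(2) R by blast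
        ultimately have 1: "(\<Sum>i<n R. c (R, i) * z (R, i)) \<in> (*) y ` R"
          using ksubspace_diff[OF kR[OF R(1)], of "(\<Sum>i\<in>?A. c i * z i)" "(\<Sum>i\<in>?A - ?B. c i * z i)"] by simp
        have 2: "(\<Sum>i<n R. c (R, i) * (z (R, i) - b R i)) \<in> (*) y ` R"
          by (rule ksubspace_lincomb[OF kR[OF R(1)]]) (use z(1)[OF R(1)] my[OF R(1)] c R in auto)
        have "(\<Sum>i<n R. c (R, i) * b R i) = (\<Sum>i<n R. c (R, i) * z (R, i)) - (\<Sum>i<n R. c (R, i) * (z (R, i) - b R i))"
          by (simp add: right_diff_distrib sum_subtractf)
        then have "(\<Sum>i<n R. c (R, i) * b R i) \<in> (*) y ` R"
          using ksubspace_diff[OF kR[OF R(1)] 1 2] by simp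
        then show ?thesis using lin_indep_modD[OF b(2)[OF R(1)], of "\<lambda>i. c (R, i)" i] c R by auto
      qed
      then show "\<forall>i\<in>?A. c i = 0" by auto
    qed
    show "dep_over K y M" by (rule dep)
  qed
  then show ?thesis using S unfolding n_def by (simp add: card_SigmaI)
qed auto

lemma finite_zeros:
  assumes "y \<noteq> 0" shows "finite {R \<in> places K. y \<in> max_ideal R}"
proof (rule ccontr)
  let ?Z = "{R \<in> places K. y \<in> max_ideal R}"
  assume inf: "infinite ?Z"
  then obtain R where "R \<in> places K" "y \<in> max_ideal R" using infinite_imp_nonempty by blast
  then obtain M where M: "dep_over K y M" using max_ideal_dep_over assms by blast
  obtain S where S: "S \<subseteq> ?Z" "finite S" "card S = Suc M" using infinite_arbitrarily_large[OF inf] by blast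
  have "card S = (\<Sum>R\<in>S. 1)" by simp
  also have "\<dots> \<le> (\<Sum>R\<in>S. nat (ord R y) * place_degree K R)"
  proof (rule sum_mono)
    fix R assume "R \<in> S"
    then have R: "R \<in> places K" "y \<in> max_ideal R" using S by auto
    have "nat (ord R y) \<ge> 1" using ord_pos_iff[OF R(1) assms] R(2) by simp
    moreover have "place_degree K R \<ge> 1" using place_degree_pos[OF R(1)] by simp
    ultimately show "1 \<le> nat (ord R y) * place_degree K R" using mult_le_mono by fastforce
  qed
  also have "\<dots> \<le> M" by (rule zeros_degree_le[OF _ _ assms _ M]) (use S in auto)
  finally show False using S by simp
qed

lemma finite_poles: "finite {R \<in> places K. z \<notin> R}"
proof (cases "z = 0")
  case True
  then have "{R \<in> places K. z \<notin> R} = {}" using place_ringD(1) by blast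
  then show ?thesis by (simp only: finite.emptyI)
next
  case False
  have "{R \<in> places K. z \<notin> R} \<subseteq> {R \<in> places K. inverse z \<in> max_ideal R}" using place_inverse by auto
  then show ?thesis using finite_zeros[of "inverse z"] False finite_subset by auto
qed

end

section \<open>Existence of poles\<close>

text \<open>The exchange step of the extension theorem for valuations. The relation in
  \<open>y'\<close>, multiplied by \<open>y ^ Suc n\<close>, shows that (1 - w b_0)
  \<open>y ^ Suc n\<close> has an expression of lower degree in \<open>y\<close>. The relation in
  \<open>y\<close>, multiplied by 1 - w b_0, can therefore drop its top term.\<close>

lemma ideal_polys_step:
  assumes O: "closed_ring O'" "w \<in> O'" and y: "y * y' = 1"
    and 1: "1 \<in> ideal_polys O' w y (Suc (Suc n))" and 2: "1 \<in> ideal_polys O' w y' m"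
    and m: "m \<le> Suc (Suc n)" "m \<noteq> 0"
  shows "1 \<in> ideal_polys O' w y (Suc n)"
proof -
  note r = closed_ringD[OF O(1)]
  let ?U = "ideal_polys O' w y (Suc n)"
  note U = ksubspace_ideal_polys[OF O(1), of w y "Suc n"]
  note mono = ideal_polys_monom[OF O(1), where w = w and y = y and n = "Suc n"]
  obtain a where a: "1 = (\<Sum>i<Suc (Suc n). w * a i * y ^ i)" "\<forall>i<Suc (Suc n). a i \<in> O'"
    using 1 unfolding ideal_polys_def by blast
  obtain b where b: "1 = (\<Sum>i<m. w * b i * y' ^ i)" "\<forall>i<m. b i \<in> O'"
    using 2 unfolding ideal_polys_def by blast
  let ?b0 = "w * b 0"
  obtain k where k: "m = Suc k" using m by (cases m) auto
  have b0: "b 0 \<in> O'" using b k by auto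
  have yy: "y ^ Suc n * y' ^ Suc j = y ^ (n - j)" if "j < k" for j
  proof -
    have "y ^ Suc n = y ^ (n - j) * y ^ Suc j" using that m k by (simp flip: power_add del: power_Suc)
    then have "y ^ Suc n * y' ^ Suc j = y ^ (n - j) * (y * y') ^ Suc j" by (simp only: power_mult_distrib mult.assoc)
    then show ?thesis by (simp only: y power_one mult_1_right)
  qed
  have "1 = ?b0 + (\<Sum>j<k. w * b (Suc j) * y' ^ Suc j)"
    using b(1) unfolding k by (simp only: sum.lessThan_Suc_shift power_0 mult_1_right)
  then have "1 - ?b0 = (\<Sum>j<k. w * b (Suc j) * y' ^ Suc j)" by (simp only: diff_eq_eq add.commute)
  then have "(1 - ?b0) * y ^ Suc n = (\<Sum>j<k. w * b (Suc j) * (y ^ Suc n * y' ^ Suc j))"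
    by (simp only: sum_distrib_left sum_distrib_right mult_ac)
  also have "\<dots> = (\<Sum>j<k. w * b (Suc j) * y ^ (n - j))" by (intro sum.cong refl) (simp only: yy lessThan_iff)
  also have "\<dots> \<in> ?U"
    by (rule ksubspace_sum[OF U], rule mono) (use b k in auto)
  finally have A: "(1 - ?b0) * y ^ Suc n \<in> ?U" .
  have w: "w * a (Suc n) \<in> O'" using O a r(4) by auto
  have B: "(\<Sum>i<Suc n. w * a i * y ^ i) \<in> ?U"
    by (rule ksubspace_sum[OF U], rule mono) (use a in auto)
  have C: "?b0 \<in> ?U" using mono[of 0 "b 0"] b0 by simp
  have D: "1 - ?b0 \<in> O'" using r b0 O by auto
  have "1 = ?b0 + (1 - ?b0) * 1" by (simp add: algebra_simps)
  also have "\<dots> = ?b0 + (1 - ?b0) * (\<Sum>i<Suc (Suc n). w * a i * y ^ i)" by (simp only: a(1)[symmetric])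
  also have "\<dots> = ?b0 + ((1 - ?b0) * (\<Sum>i<Suc n. w * a i * y ^ i) + w * a (Suc n) * ((1 - ?b0) * y ^ Suc n))"
    by (simp only: sum.lessThan_Suc distrib_left mult_ac)
  also have "\<dots> \<in> ?U"
    by (intro ksubspaceD(2)[OF U] C ksubspaceD(3)[OF U] D B w A)
  finally show ?thesis .
qed

text \<open>Descent: of the two expressions of 1 the longer one is shortened by means of the other,
  while an expression with at most one term would make \<open>w\<close> invertible in
  \<open>O'\<close>.\<close>

lemma ideal_polys_false:
  assumes O: "closed_ring O'" "w \<in> O'" "inverse w \<notin> O'" and "y * y' = 1"
    "1 \<in> ideal_polys O' w y n" "1 \<in> ideal_polys O' w y' m"
  shows False
  using assms(4-)
proof (induction "n + m" arbitrary: n m y y' rule: less_induct)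
  case less
  have ge2: "\<exists>k. n = Suc (Suc k)" if "1 \<in> ideal_polys O' w y n" for n y
  proof (rule ccontr)
    assume "\<nexists>k. n = Suc (Suc k)"
    then have "n = 0 \<or> n = 1" by (metis One_nat_def not0_implies_Suc)
    moreover obtain a where a: "1 = (\<Sum>i<n. w * a i * y ^ i)" "\<forall>i<n. a i \<in> O'"
      using \<open>1 \<in> ideal_polys O' w y n\<close> unfolding ideal_polys_def by blast
    ultimately have "w * a 0 = 1" "a 0 \<in> O'" by auto
    then show False using O(3) inverse_unique[of w "a 0"] by simp
  qed
  obtain k l where kl: "n = Suc (Suc k)" "m = Suc (Suc l)"
    using ge2[OF less.prems(2)] ge2[OF less.prems(3)] by blast
  show False
  proof (cases "m \<le> n")
    case True
    then have "1 \<in> ideal_polys O' w y (Suc k)"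
      using ideal_polys_step[OF O(1,2) less.prems(1) _ less.prems(3)] less.prems(2) kl by simp
    then show False using less.hyps[of "Suc k" m y y'] less.prems kl by simp
  next
    case False
    have y': "y' * y = 1" using less.prems(1) by (simp add: mult.commute)
    have "1 \<in> ideal_polys O' w y' (Suc l)"
      using ideal_polys_step[OF O(1,2) y' _ less.prems(2)] less.prems(3) kl False by simp
    then show False using less.hyps[of n "Suc l" y y'] less.prems kl by simp
  qed
qed

context const_field begin

text \<open>Multiplying z = p(1/z) by \<open>z ^ degree p\<close> gives an equation for
  \<open>z\<close> over \<open>K\<close> with leading term \<open>z ^ Suc (degree p)\<close>;
  \<open>reflect_poly\<close> is p with its coefficients reversed.\<close>

lemma transcendental_not_poly_inverse:
  assumes z: "transcendental_over K z" and z0: "z \<noteq> 0"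
  shows "z \<notin> polys_over K (inverse z)"
proof
  assume "z \<in> polys_over K (inverse z)"
  then obtain p where p: "z = poly p (inverse z)" "\<forall>k. coeff p k \<in> K" unfolding polys_over_def by blast
  define q where "q = monom 1 (Suc (degree p)) - reflect_poly p"
  have "poly (reflect_poly p) z = z ^ degree p * z" using poly_reflect_poly_nz[OF z0, of p] p(1) by simp
  then have "poly q z = 0" unfolding q_def by (simp add: poly_monom)
  moreover have "coeff q k \<in> K" for k
    unfolding q_def using p(2) K_ring by (auto simp: coeff_reflect_poly)
  ultimately have "q = 0" using transcendentalD[OF z] by blast
  moreover have "coeff q (Suc (degree p)) = 1" unfolding q_def by (simp add: coeff_reflect_poly)
  ultimately show False by simp
qed

text \<open>A maximal subring containing \<open>K\<close> and \<open>inverse z\<close> but not \<open>z\<close> is a valuation ring.\<close>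
lemma pole_exists:
  assumes z: "transcendental_over K z" and z0: "z \<noteq> 0"
  shows "\<exists>R\<in>places K. z \<notin> R"
proof -
  define w where "w = inverse z"
  have wz: "inverse w = z" "w * z = 1" "w \<noteq> 0" using z0 by (auto simp: w_def)
  define T where "T = {S. closed_ring S \<and> K \<subseteq> S \<and> w \<in> S \<and> z \<notin> S}"
  have "polys_over K w \<in> T"
    unfolding T_def using closed_ring_polys K_polys self_polys transcendental_not_poly_inverse[OF assms] w_def by auto
  then have ne: "T \<noteq> {}" by blast
  have "\<exists>M\<in>T. \<forall>X\<in>T. M \<subseteq> X \<longrightarrow> X = M"
  proof (rule subset_Zorn_nonempty[OF ne])
    fix C assume C: "C \<noteq> {}" "subset.chain T C"
    have CT: "S \<in> C \<Longrightarrow> closed_ring S \<and> K \<subseteq> S \<and> w \<in> S \<and> z \<notin> S" for S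
      using C(2) unfolding subset.chain_def T_def by blast
    have "closed_ring (\<Union>C)"
      unfolding closed_ring_def
    proof (intro conjI ballI)
      show "0 \<in> \<Union>C" "1 \<in> \<Union>C" using C(1) CT closed_ringD(1,2) by blast+
    next
      fix a b assume "a \<in> \<Union>C" "b \<in> \<Union>C"
      then obtain A B where AB: "A \<in> C" "B \<in> C" "a \<in> A" "b \<in> B" by blast
      then have "A \<subseteq> B \<or> B \<subseteq> A" using C(2) unfolding subset.chain_def by blast
      then obtain D where "D \<in> C" "a \<in> D" "b \<in> D" using AB by blast
      then show "a + b \<in> \<Union>C" "a * b \<in> \<Union>C" using CT closed_ringD(3,4) by blast+
    next
      fix a assume "a \<in> \<Union>C"
      then show "- a \<in> \<Union>C" using CT closed_ringD(5) by blast
    qed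
    then show "\<Union>C \<in> T" unfolding T_def using CT C(1) by blast
  qed
  then obtain M where M: "M \<in> T" "\<And>X. X \<in> T \<Longrightarrow> M \<subseteq> X \<Longrightarrow> X = M" by blast
  have MT: "closed_ring M" "K \<subseteq> M" "w \<in> M" "z \<notin> M" using M(1) unfolding T_def by auto
  note r = closed_ringD[OF MT(1)]
  \<comment> \<open>By maximality, adjoining \<open>y\<close> to \<open>M\<close> brings in
    \<open>z\<close>. Multiplied by \<open>w\<close>, a polynomial expression of \<open>z\<close>
    becomes an expression of 1 with coefficients in \<open>w M\<close>.\<close>
  have ext: "\<exists>n. 1 \<in> ideal_polys M w y n" if "y \<notin> M" for y
  proof -
    have sub: "M \<subseteq> polys_over M y"
    proof
      fix a assume "a \<in> M"
      then show "a \<in> polys_over M y" unfolding polys_over_def using r(1)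
        by (intro CollectI exI[of _ "[:a:]"]) (auto simp: coeff_pCons split: nat.splits)
    qed
    have "y \<in> polys_over M y" unfolding polys_over_def using r(1,2)
      by (intro CollectI exI[of _ "[:0,1:]"]) (auto simp: coeff_pCons split: nat.splits)
    then have "polys_over M y \<noteq> M" using that by blast
    then have "polys_over M y \<notin> T" using M(2)[OF _ sub] by blast
    then have "z \<in> polys_over M y" unfolding T_def using closed_ring_polys_over[OF MT(1)] sub MT by blast
    then obtain p where p: "z = poly p y" "\<forall>k. coeff p k \<in> M" unfolding polys_over_def by blast
    have "1 = w * poly p y" using wz p(1) by simp
    also have "\<dots> = (\<Sum>i<Suc (degree p). w * coeff p i * y ^ i)"
      unfolding poly_altdef lessThan_Suc_atMost by (simp add: sum_distrib_left mult.assoc)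
    finally show ?thesis unfolding ideal_polys_def using p(2) by blast
  qed
  have val: "y \<in> M \<or> inverse y \<in> M" for y
  proof (rule ccontr)
    assume n: "\<not> (y \<in> M \<or> inverse y \<in> M)"
    then have "y \<noteq> 0" using r(1) by auto
    then have "y * inverse y = 1" by simp
    then show False
      using ext[of y] ext[of "inverse y"] n ideal_polys_false[OF MT(1,3), of y "inverse y"] wz MT(4) by metis
  qed
  have "w \<notin> K" using K_inverse[of w] wz MT by auto
  then have "K \<subset> M" using MT by blast
  moreover have "M \<noteq> UNIV" using MT(4) by blast
  ultimately have "M \<in> places K" unfolding places_def valuation_ring_def using r(3-5) val by simp
  then show ?thesis using MT(4) by blast
qed

end

section \<open>Divisors and Riemann--Roch spaces\<close>

lemma place_div_apply: "place_div R X = (if X = R then 1 else 0)"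
  unfolding place_div_def by simp

context ff_basis begin

text \<open>The residue space is a line over \<open>K\<close> and the residue of 1 is not 0, so 1
  spans it. The basis vector \<open>b 0\<close> is arbitrary, whence the quotient
  \<open>e / c\<close> of two coordinates.\<close>

lemma rational_residue:
  assumes "rational_place K R" "h \<in> R"
  shows "\<exists>!a. a \<in> K \<and> h - a \<in> max_ideal R"
proof -
  have R: "R \<in> places K" and d: "place_degree K R = 1" using assms unfolding rational_place_def by auto
  note k = ksubspaceD[OF ksubspace_max_ideal[OF R]]
  obtain b where sp: "spans_mod K R (max_ideal R) {..<1::nat} b"
    using has_dim_residue[OF R] unfolding d has_dim_def by blast
  have res: "\<exists>c\<in>K. z - c * b 0 \<in> max_ideal R" if "z \<in> R" for z
    using sp that unfolding spans_mod_def by auto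
  obtain c where c: "c \<in> K" "1 - c * b 0 \<in> max_ideal R" using res place_ringD(2)[OF R] by blast
  obtain e where e: "e \<in> K" "h - e * b 0 \<in> max_ideal R" using res assms(2) by blast
  have c0: "c \<noteq> 0"
    using c(2) K_not_max_ideal[OF R K_ring(2)] by auto
  have "(h - e * b 0) - (e / c) * (1 - c * b 0) \<in> max_ideal R"
    by (intro ksubspace_diff[OF ksubspace_max_ideal[OF R]] e k(3) K_divide c)
  moreover have "(h - e * b 0) - (e / c) * (1 - c * b 0) = h - e / c" using c0 by (simp add: field_simps)
  ultimately have ex: "e / c \<in> K \<and> h - e / c \<in> max_ideal R"
    using K_divide[OF e(1) c(1)] by (simp only: simp_thms)
  show ?thesis
  proof (rule ex1I[of _ "e / c"], rule ex)
    fix a assume a: "a \<in> K \<and> h - a \<in> max_ideal R"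
    then have "(h - a) - (h - e / c) \<in> max_ideal R" using ex ksubspace_diff[OF ksubspace_max_ideal[OF R]] by blast
    then have "e / c - a \<in> max_ideal R" by (simp add: algebra_simps)
    then have "e / c - a = 0" using K_not_max_ideal[OF R] K_ring(6) a ex by blast
    then show "a = e / c" by simp
  qed
qed

lemma mem_RR: "z \<in> RR_space K A \<longleftrightarrow> (\<forall>R\<in>places K. z \<in> val_ge R (- A R))"
  unfolding RR_space_def val_ge_def by auto

lemma RR_mono: "(\<And>R. R \<in> places K \<Longrightarrow> A R \<le> B R) \<Longrightarrow> RR_space K A \<subseteq> RR_space K B"
  unfolding mem_RR subset_iff using val_ge_mono[of "- B R" "- A R" R for R] by fastforce

lemma ksubspace_RR: "ksubspace K (RR_space K A)"
  unfolding ksubspace_def mem_RR Ball_def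
  using ksubspaceD[OF ksubspace_val_ge] by blast

lemma RR_scale:
  assumes y: "y \<noteq> 0"
  shows "(*) y ` RR_space K A = RR_space K (\<lambda>R. A R - ord R y)"
proof -
  have *: "y * a \<in> RR_space K (\<lambda>R. A R - ord R y) \<longleftrightarrow> a \<in> RR_space K A" for a
    unfolding mem_RR
  proof (intro ball_cong refl)
    fix R assume R: "R \<in> places K"
    have "y * a \<in> (*) y ` val_ge R (- A R) \<longleftrightarrow> a \<in> val_ge R (- A R)" using y by auto
    then show "y * a \<in> val_ge R (- (A R - ord R y)) \<longleftrightarrow> a \<in> val_ge R (- A R)"
      unfolding val_ge_shift[OF R y] by (simp add: algebra_simps)
  qed
  show ?thesis
  proof
    show "(*) y ` RR_space K A \<subseteq> RR_space K (\<lambda>R. A R - ord R y)" using * by blast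
    show "RR_space K (\<lambda>R. A R - ord R y) \<subseteq> (*) y ` RR_space K A"
    proof
      fix b assume "b \<in> RR_space K (\<lambda>R. A R - ord R y)"
      then have "y * (inverse y * b) \<in> RR_space K (\<lambda>R. A R - ord R y)" using y by (simp add: mult.assoc[symmetric])
      then have "inverse y * b \<in> RR_space K A" using * by blast
      then show "b \<in> (*) y ` RR_space K A" using y by (intro image_eqI[of _ _ "inverse y * b"]) auto
    qed
  qed
qed

lemma div_deg_eq_sum:
  assumes "finite S" "{R. D R \<noteq> 0} \<subseteq> S"
  shows "div_deg K D = (\<Sum>R\<in>S. D R * int (place_degree K R))"
  unfolding div_deg_def by (rule sum.mono_neutral_left) (use assms in auto)

lemma divisor_finite: "divisor K D \<Longrightarrow> finite {R. D R \<noteq> 0}"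
  unfolding divisor_def by blast

lemma divisor_lincomb:
  assumes "divisor K A" "divisor K B"
  shows "divisor K (\<lambda>R. a * A R + b * B R)"
    "div_deg K (\<lambda>R. a * A R + b * B R) = a * div_deg K A + b * div_deg K B"
proof -
  let ?S = "{R. A R \<noteq> 0} \<union> {R. B R \<noteq> 0}"
  have f: "finite ?S" using assms divisor_finite by blast
  have sub: "{R. a * A R + b * B R \<noteq> 0} \<subseteq> ?S" by auto
  show "divisor K (\<lambda>R. a * A R + b * B R)"
    using assms finite_subset[OF sub f] sub unfolding divisor_def by blast
  show "div_deg K (\<lambda>R. a * A R + b * B R) = a * div_deg K A + b * div_deg K B"
    using div_deg_eq_sum[OF f sub] div_deg_eq_sum[OF f, of A] div_deg_eq_sum[OF f, of B]
    by (simp add: sum_distrib_left sum.distrib algebra_simps)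
qed

lemma divisor_add:
  assumes "divisor K A" "divisor K B"
  shows "divisor K (\<lambda>R. A R + B R)" "div_deg K (\<lambda>R. A R + B R) = div_deg K A + div_deg K B"
  using divisor_lincomb[OF assms, of 1 1] by auto

lemma divisor_diff:
  assumes "divisor K A" "divisor K B"
  shows "divisor K (\<lambda>R. A R - B R)" "div_deg K (\<lambda>R. A R - B R) = div_deg K A - div_deg K B"
  using divisor_lincomb[OF assms, of 1 "-1"] by auto

lemma divisor_mult:
  assumes "divisor K A"
  shows "divisor K (\<lambda>R. m * A R)" "div_deg K (\<lambda>R. m * A R) = m * div_deg K A"
  using divisor_lincomb[OF assms assms, of m 0] by auto

lemma divisor_place_div:
  assumes "R \<in> places K"
  shows "divisor K (place_div R)" "div_deg K (place_div R) = int (place_degree K R)"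
proof -
  have *: "{X. place_div R X \<noteq> 0} = {R}" by (auto simp: place_div_apply)
  show "divisor K (place_div R)" unfolding divisor_def * using assms by (auto simp: place_div_apply)
  show "div_deg K (place_div R) = int (place_degree K R)" unfolding div_deg_def * by (simp add: place_div_apply)
qed

lemma divisor_zero: "divisor K (\<lambda>_. 0)" "div_deg K (\<lambda>_. 0) = 0"
  unfolding divisor_def div_deg_def by auto

lemma div_deg_nonneg: "(\<And>R. D R \<ge> 0) \<Longrightarrow> div_deg K D \<ge> 0"
  unfolding div_deg_def by (intro sum_nonneg) auto

lemma div_deg_mono:
  assumes "divisor K A" "divisor K B" "\<And>R. A R \<le> B R"
  shows "div_deg K A \<le> div_deg K B"
  using divisor_diff[OF assms(2,1)] div_deg_nonneg[of "\<lambda>R. B R - A R"] assms(3) by auto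

lemma divisorI_finite_places:
  assumes "finite S" "S \<subseteq> places K" "\<And>R. R \<notin> S \<Longrightarrow> D R = 0"
  shows "divisor K D"
proof -
  have "{R. D R \<noteq> 0} \<subseteq> S" using assms(3) by blast
  then show ?thesis unfolding divisor_def using assms finite_subset by blast
qed

text \<open>A function in L(A + R) belongs to L(A) as soon as it meets the condition at
  \<open>R\<close>. So L(A + R)/L(A) embeds into one step of the filtration at
  \<open>R\<close>.\<close>

lemma RR_add_place:
  assumes R: "R \<in> places K" and d: "has_dim K (RR_space K A) {0} d"
  shows "\<exists>d'. has_dim K (RR_space K (\<lambda>X. A X + place_div R X)) {0} d' \<and> d' \<le> d + place_degree K R"
proof -
  let ?V = "RR_space K (\<lambda>X. A X + place_div R X)"
  have sub: "RR_space K A \<subseteq> ?V" by (rule RR_mono) (simp add: place_div_apply)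
  have "has_dim K (val_ge R (- A R - 1)) (val_ge R (- A R)) (place_degree K R)"
    using has_dim_val_ge[OF R, of "- A R - 1" 1] by simp
  then have "\<exists>e\<le>place_degree K R. has_dim K ?V (RR_space K A) e"
  proof (rule has_dim_linear_inj[where f = "\<lambda>z. z", rotated -1])
    fix z assume z: "z \<in> ?V"
    then have "z \<in> val_ge R (- (A R + place_div R R))" unfolding mem_RR using R by blast
    then show "z \<in> val_ge R (- A R - 1)" by (simp add: place_div_apply)
    assume zR: "z \<in> val_ge R (- A R)"
    show "z \<in> RR_space K A"
      unfolding mem_RR
    proof
      fix S assume "S \<in> places K"
      then have "z \<in> val_ge S (- (A S + place_div R S))" using z unfolding mem_RR by blast
      then show "z \<in> val_ge S (- A S)" using zR by (cases "S = R") (auto simp: place_div_apply)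
    qed
  qed (auto intro: ksubspace_RR ksubspace_val_ge[OF R])
  then obtain e where e: "e \<le> place_degree K R" "has_dim K ?V (RR_space K A) e" by blast
  have "has_dim K ?V {0} (e + d)"
    using has_dim_trans[OF ksubspace_zero ksubspace_RR ksubspace_RR _ sub e(2) d]
      ksubspaceD(1)[OF ksubspace_RR] by auto
  then show ?thesis using e(1) by (intro exI[of _ "e + d"]) auto
qed

lemma RR_add_effective:
  assumes "divisor K D" "\<And>R. D R \<ge> 0" "has_dim K (RR_space K A) {0} d"
  shows "\<exists>d'. has_dim K (RR_space K (\<lambda>X. A X + D X)) {0} d' \<and> int d' \<le> int d + div_deg K D"
proof -
  have "\<exists>n. nat (div_deg K D) = n" by blast
  then obtain n where "nat (div_deg K D) = n" by blast
  then show ?thesis using assms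
  proof (induction n arbitrary: D rule: less_induct)
    case (less n)
    show ?case
    proof (cases "\<forall>R. D R = 0")
      case True
      then have "D = (\<lambda>_. 0)" by auto
      then show ?thesis using less.prems divisor_zero by auto
    next
      case False
      then obtain R where DR: "D R \<noteq> 0" by blast
      then have R: "R \<in> places K" using less.prems(2) unfolding divisor_def by blast
      define D' where "D' = (\<lambda>X. D X - place_div R X)"
      note pd = divisor_place_div[OF R]
      have D': "divisor K D'" "div_deg K D' = div_deg K D - int (place_degree K R)"
        unfolding D'_def using divisor_diff[OF less.prems(2) pd(1)] pd(2) by auto
      have nn: "D' X \<ge> 0" for X using less.prems(3)[of X] DR by (auto simp: D'_def place_div_apply)
      have "div_deg K D' \<ge> 0" using div_deg_nonneg nn by blast
      then have "nat (div_deg K D') < n"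
        using D'(2) less.prems(1) place_degree_pos[OF R] by linarith
      then obtain d' where d': "has_dim K (RR_space K (\<lambda>X. A X + D' X)) {0} d'" "int d' \<le> int d + div_deg K D'"
        using less.IH[OF _ refl D'(1) nn less.prems(4)] by blast
      obtain e where e: "has_dim K (RR_space K (\<lambda>X. A X + D' X + place_div R X)) {0} e" "e \<le> d' + place_degree K R"
        using RR_add_place[OF R d'(1)] by blast
      have "(\<lambda>X. A X + D' X + place_div R X) = (\<lambda>X. A X + D X)" unfolding D'_def by auto
      then show ?thesis using e d' D'(2) by (intro exI[of _ e]) auto
    qed
  qed
qed

text \<open>The value 0 off the places is forced by \<open>divisor\<close>, which requires the
  support to consist of places.\<close>

abbreviation principal_div :: "'f \<Rightarrow> 'f set \<Rightarrow> int" where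
  "principal_div z \<equiv> \<lambda>R. if R \<in> places K then ord R z else 0"

lemma divisor_principal:
  assumes "z \<noteq> 0"
  shows "divisor K (principal_div z)"
proof (rule divisorI_finite_places)
  show "finite ({R \<in> places K. z \<in> max_ideal R} \<union> {R \<in> places K. z \<notin> R})"
    using finite_zeros[OF assms] finite_poles by blast
  fix R assume R: "R \<notin> {R \<in> places K. z \<in> max_ideal R} \<union> {R \<in> places K. z \<notin> R}"
  show "(if R \<in> places K then ord R z else 0) = 0"
    using R ord_pos_iff[of R z] ord_nonneg_iff[of R z] assms by auto
qed auto

lemma RR_cong: "(\<And>R. R \<in> places K \<Longrightarrow> A R = B R) \<Longrightarrow> RR_space K A = RR_space K B"
  unfolding RR_space_def by auto

text \<open>Powers of the uniformizer are dependent over K[x]. Once common powers of it are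
  cancelled, the lowest coefficient is nonzero and is a multiple of the uniformizer.\<close>

lemma poly_in_max_ideal:
  assumes R: "R \<in> places K" and x: "x \<in> R"
  shows "\<exists>c\<in>polys_over K x. c \<noteq> 0 \<and> c \<in> max_ideal R"
proof -
  let ?t = "unif R"
  note r = place_ringD[OF R]
  have pR: "polys_over K x \<subseteq> R" by (rule polys_over_subset[OF place_ring[OF R] place_K[OF R] x])
  have *: "\<exists>c\<in>polys_over K x. c \<noteq> 0 \<and> c \<in> max_ideal R"
    if "\<forall>i\<le>n. c i \<in> polys_over K x" "\<exists>i\<le>n. c i \<noteq> 0" "(\<Sum>i\<le>n. c i * ?t ^ i) = 0" for n c
    using that
  proof (induction n arbitrary: c)
    case 0 then show ?case by auto
  next
    case (Suc n)
    let ?s = "\<Sum>i\<le>n. c (Suc i) * ?t ^ i"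
    have s: "c 0 + ?s * ?t = 0"
      using Suc.prems(3) unfolding sum.atMost_Suc_shift
      by (simp add: sum_distrib_right mult.assoc mult.commute[of ?t])
    show ?case
    proof (cases "c 0 = 0")
      case True
      then have s0: "?s = 0" using s unif(2)[OF R] by auto
      obtain i where i: "i \<le> Suc n" "c i \<noteq> 0" using Suc.prems(2) by blast
      then obtain j where "i = Suc j" using True by (cases i) auto
      then have "\<exists>i\<le>n. c (Suc i) \<noteq> 0" using i by auto
      then show ?thesis using Suc.IH[of "\<lambda>i. c (Suc i)"] Suc.prems(1) s0 by auto
    next
      case False
      have "?s \<in> R" using Suc.prems(1) pR
        by (intro closed_ring_sum[OF place_ring[OF R]] r(4) closed_ring_power[OF place_ring[OF R] unif(4)[OF R]]) auto
      then have "- (?s * ?t) \<in> max_ideal R"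
        using max_ideal_mult[OF R unif(1)[OF R]] ksubspace_uminus[OF ksubspace_max_ideal[OF R]] by blast
      moreover have "c 0 = - (?s * ?t)" using s by (simp add: eq_neg_iff_add_eq_0)
      ultimately have "c 0 \<in> max_ideal R" by (simp only:)
      then show ?thesis using False Suc.prems(1) by blast
    qed
  qed
  obtain c where "\<forall>i\<le>N. c i \<in> polys_over K x" "\<exists>i\<le>N. c i \<noteq> 0" "(\<Sum>i\<le>N. c i * ?t ^ i) = 0"
    using dep_x[unfolded dep_over_def, rule_format, of "\<lambda>i. ?t ^ i"] by blast
  then show ?thesis using * by blast
qed

lemma ord_K:
  assumes R: "R \<in> places K" and "a \<in> K" "a \<noteq> 0" shows "ord R a = 0"
proof -
  have "a \<in> R" "a \<notin> max_ideal R" using assms place_K K_not_max_ideal by blast+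
  then show ?thesis using ord_nonneg_iff[OF R assms(3)] ord_pos_iff[OF R assms(3)] by auto
qed

lemma ord_poly_at_pole:
  assumes R: "R \<in> places K" and "x \<notin> R" "\<forall>k. coeff a k \<in> K" "a \<noteq> 0"
  shows "ord R (poly a x) = int (degree a) * ord R x \<and> poly a x \<noteq> 0"
  using assms(3,4)
proof (induction a)
  case (pCons c q)
  have qK: "\<forall>k. coeff q k \<in> K" and cK: "c \<in> K"
    using pCons.prems(1) by (metis coeff_pCons_Suc, metis coeff_pCons_0)
  have neg: "ord R x < 0" using ord_nonneg_iff[OF R x_nonzero] assms(2) by auto
  show ?case
  proof (cases "q = 0")
    case True then show ?thesis using ord_K[OF R cK] pCons by auto
  next
    case False
    then have IH: "ord R (poly q x) = int (degree q) * ord R x" "poly q x \<noteq> 0" using pCons.IH qK by auto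
    let ?y = "x * poly q x"
    have o: "ord R ?y = int (Suc (degree q)) * ord R x"
      using ord_mult[OF R x_nonzero IH(2)] IH(1) by (simp add: algebra_simps)
    also have "\<dots> < 0" using neg by (intro mult_pos_neg) auto
    finally have "ord R ?y + 1 \<le> 0" by simp
    then have "c \<in> val_ge R (ord R ?y + 1)" using ord_K[OF R cK] unfolding val_ge_def by (cases "c = 0") auto
    then have "ord R (?y + c) = ord R ?y" "?y + c \<noteq> 0"
      using ord_add_eq[OF R, of ?y c] x_nonzero IH(2) by auto
    then show ?thesis using o False by (simp add: add.commute)
  qed
qed auto

lemma has_dim_K: "has_dim K K {0} 1"
  unfolding has_dim_def lin_indep_mod_def spans_mod_def
  by (intro exI[of _ "\<lambda>_. 1"]) (auto simp: K_ring)

end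

text \<open>A rational place makes \<open>K\<close> the full field of constants, hence ell of the
  zero divisor equal to 1; this anchors the dimension counts that follow.\<close>

locale ff_rational = ff_basis K x N u for K :: "'f::field set" and x N u +
  fixes R0 :: "'f set"
  assumes R0: "rational_place K R0"
begin

text \<open>Subtracting the value at \<open>R0\<close> puts a function without poles into the
  maximal ideal at \<open>R0\<close>; were the difference nonzero, it would be transcendental and
  have a pole.\<close>

lemma RR_zero: "RR_space K (\<lambda>_. 0) = K"
proof
  have R0p: "R0 \<in> places K" using R0 unfolding rational_place_def by blast
  show "K \<subseteq> RR_space K (\<lambda>_. 0)" using place_K val_ge_0 unfolding mem_RR subset_iff by auto
  show "RR_space K (\<lambda>_. 0) \<subseteq> K"
  proof
    fix z assume "z \<in> RR_space K (\<lambda>_. 0)"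
    then have z: "z \<in> R" if "R \<in> places K" for R using that val_ge_0 unfolding mem_RR by auto
    obtain a where a: "a \<in> K" "z - a \<in> max_ideal R0" using rational_residue[OF R0 z[OF R0p]] by blast
    have "z - a = 0"
    proof (rule ccontr)
      assume n: "z - a \<noteq> 0"
      obtain R where "R \<in> places K" "z - a \<notin> R"
        using pole_exists[OF max_ideal_transcendental[OF R0p a(2) n] n] by blast
      then show False using z place_K[of R] a(1) place_ringD(6)[of R] by blast
    qed
    then show "z \<in> K" using a by simp
  qed
qed

text \<open>L(A) lies in the space of the positive part of \<open>A\<close>, which arises from L(0)
  by adding finitely many places.\<close>

lemma ell_has_dim:
  assumes A: "divisor K A" shows "has_dim K (RR_space K A) {0} (ell K A)"
proof -
  define B where "B = (\<lambda>R. max 0 (A R))"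
  have B: "divisor K B" using A unfolding B_def
    by (intro divisorI_finite_places[of "{R. A R \<noteq> 0}"]) (auto simp: divisor_def)
  obtain d where d: "has_dim K (RR_space K B) {0} d"
    using RR_add_effective[OF B, of "\<lambda>_. 0" 1] has_dim_K RR_zero by (auto simp: B_def)
  have "RR_space K A \<subseteq> RR_space K B" by (rule RR_mono) (simp add: B_def)
  then obtain e where "has_dim K (RR_space K A) {0} e" using has_dim_subspace[OF ksubspace_zero d] by blast
  then show ?thesis unfolding ell_def using kdim_eq[OF ksubspace_RR] by simp
qed

lemma ell_eqI: "has_dim K (RR_space K A) {0} d \<Longrightarrow> ell K A = d"
  unfolding ell_def using kdim_eq[OF ksubspace_RR] by simp

text \<open>Enlarging a divisor raises \<open>ell\<close> by at most the added degree. Riemann's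
  theorem is then the statement that ell - deg, which falls along growing divisors, is bounded
  below.\<close>

lemma ell_minus_deg_antimono:
  assumes A: "divisor K A" and B: "divisor K B" and le: "\<And>R. A R \<le> B R"
  shows "int (ell K B) - div_deg K B \<le> int (ell K A) - div_deg K A"
proof -
  obtain d where d: "has_dim K (RR_space K (\<lambda>X. A X + (B X - A X))) {0} d" "int d \<le> int (ell K A) + div_deg K (\<lambda>X. B X - A X)"
    using RR_add_effective[OF divisor_diff(1)[OF B A] _ ell_has_dim[OF A]] le by auto
  have "ell K B = d" using ell_eqI d(1) by simp
  then show ?thesis using d(2) divisor_diff(2)[OF B A] by simp
qed

lemma ell_scale:
  assumes "y \<noteq> 0" "divisor K A"
  shows "ell K (\<lambda>R. A R - ord R y) = ell K A"
  using ell_eqI has_dim_scale[OF assms(1) ell_has_dim[OF assms(2)]] RR_scale[OF assms(1)] by auto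

end

section \<open>Riemann's theorem and the genus\<close>

lemma Greatest_int_bounded:
  fixes S :: "int \<Rightarrow> bool"
  assumes "S m0" "\<And>m. S m \<Longrightarrow> m \<le> b"
  shows "S m \<Longrightarrow> m \<le> (GREATEST m. S m)"
proof -
  let ?T = "{m. S m \<and> m0 \<le> m}"
  have f: "finite ?T" by (rule finite_subset[of _ "{m0..b}"]) (use assms in auto)
  have ne: "?T \<noteq> {}" using assms(1) by auto
  have M: "S (Max ?T)" "m0 \<le> Max ?T" using Max_in[OF f ne] by auto
  have le: "m \<le> Max ?T" if "S m" for m
    using Max_ge[OF f, of m] that M(2) by (cases "m0 \<le> m") auto
  have "(GREATEST m. S m) = Max ?T" by (rule Greatest_equality) (use M(1) le in auto)
  then show "S m \<Longrightarrow> m \<le> (GREATEST m. S m)" using le by simp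
qed

context ff_rational begin

definition pole_div :: "'f \<Rightarrow> 'f set \<Rightarrow> int" where
  "pole_div z R = (if R \<in> places K \<and> z \<notin> R then - ord R z else 0)"

lemma pole_div_nonneg: "pole_div z R \<ge> 0"
proof (cases "R \<in> places K \<and> z \<notin> R")
  case True
  then have "z \<noteq> 0" using place_ringD(1) by blast
  then show ?thesis using ord_nonneg_iff[of R z] True unfolding pole_div_def by auto
qed (auto simp: pole_div_def)

lemma pole_div_pos: "R \<in> places K \<Longrightarrow> z \<notin> R \<Longrightarrow> pole_div z R \<ge> 1"
  using ord_nonneg_iff[of R z] place_ringD(1)[of R] unfolding pole_div_def by (cases "z = 0") auto

lemma divisor_pole_div: "divisor K (pole_div z)"
  by (rule divisorI_finite_places[OF finite_poles[of z]]) (auto simp: pole_div_def)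

lemma power_val_ge_pole_div:
  assumes R: "R \<in> places K" and "j \<le> m"
  shows "z ^ j \<in> val_ge R (- (int m * pole_div z R))"
proof (cases "z \<in> R")
  case True
  then have "z ^ j \<in> val_ge R 0" using closed_ring_power[OF place_ring[OF R]] val_ge_0[OF R] by simp
  then show ?thesis using True by (simp add: pole_div_def)
next
  case False
  then have z0: "z \<noteq> 0" using place_ringD(1)[OF R] by auto
  have "int m * ord R z \<le> int j * ord R z"
    using assms(2) ord_nonneg_iff[OF R z0] False by (intro mult_right_mono_neg) auto
  then show ?thesis using False R ord_power[OF R z0, of j] unfolding val_ge_def pole_div_def by simp
qed

abbreviation "x_poles \<equiv> pole_div x"
text \<open>An effective divisor whose Riemann-Roch space contains every \<open>u k\<close>; its
  degree is the error term in the bounds below.\<close>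

definition "basis_poles = (\<lambda>R. \<Sum>k<N. pole_div (u k) R)"

lemma basis_poles_nonneg: "basis_poles R \<ge> 0"
  unfolding basis_poles_def by (intro sum_nonneg pole_div_nonneg)

lemma divisor_basis_poles: "divisor K basis_poles"
proof (rule divisorI_finite_places)
  show "finite (\<Union>k<N. {R \<in> places K. u k \<notin> R})" using finite_poles by blast
qed (auto simp: basis_poles_def pole_div_def)

lemma u_val_ge:
  assumes "R \<in> places K" "k < N" shows "u k \<in> val_ge R (- basis_poles R)"
proof -
  have "pole_div (u k) R \<le> basis_poles R"
    unfolding basis_poles_def using assms pole_div_nonneg by (intro member_le_sum) auto
  then have "u k ^ 1 \<in> val_ge R (- basis_poles R)"
    using power_val_ge_pole_div[OF assms(1), of 1 1 "u k"] val_ge_mono[of "- basis_poles R" "- (int 1 * pole_div (u k) R)" R] by auto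
  then show ?thesis by simp
qed

lemma divisor_mult_x_poles: "divisor K (\<lambda>R. int m * x_poles R + basis_poles R)"
  "div_deg K (\<lambda>R. int m * x_poles R + basis_poles R) = int m * div_deg K x_poles + div_deg K basis_poles"
  using divisor_lincomb[OF divisor_pole_div[of x] divisor_basis_poles, where a = "int m" and b = 1] by auto

text \<open>The products \<open>x ^ j * u k\<close> lie in the space, and a relation over
  \<open>K\<close> among them, sorted by \<open>k\<close>, is a relation over K[x] among the
  \<open>u k\<close>.\<close>

lemma ell_mult_x_poles_ge: "Suc m * N \<le> ell K (\<lambda>R. int m * x_poles R + basis_poles R)"
proof -
  let ?A = "{..m} \<times> {..<N}" and ?z = "\<lambda>(j, k). x ^ j * u k"
  have "card ?A \<le> ell K (\<lambda>R. int m * x_poles R + basis_poles R)"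
  proof (rule has_dim_indep_le[OF ksubspace_zero ell_has_dim[OF divisor_mult_x_poles(1)], where b = ?z])
    fix i assume "i \<in> ?A"
    then obtain j k where i: "i = (j, k)" "j \<le> m" "k < N" by auto
    have "x ^ j * u k \<in> val_ge R (- (int m * x_poles R) + - basis_poles R)" if "R \<in> places K" for R
      by (intro val_ge_mult power_val_ge_pole_div u_val_ge that i)
    then show "?z i \<in> RR_space K (\<lambda>R. int m * x_poles R + basis_poles R)" unfolding mem_RR i by simp
  next
    show "lin_indep_mod K {0} ?A ?z"
      unfolding lin_indep_mod_def
    proof (intro allI impI)
      fix c assume c: "\<forall>i\<in>?A. c i \<in> K" "(\<Sum>i\<in>?A. c i * ?z i) \<in> {0}"
      define p where "p = (\<lambda>k. \<Sum>j\<le>m. monom (c (j, k)) j)"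
      have pc: "coeff (p k) j = (if j \<le> m then c (j, k) else 0)" for j k
        unfolding p_def by (simp add: coeff_sum)
      have pK: "coeff (p k) j \<in> K" if "k < N" for j k using c(1) that K_ring(1) by (auto simp: pc)
      have "(\<Sum>i\<in>?A. c i * ?z i) = (\<Sum>j\<le>m. \<Sum>k<N. c (j, k) * (x ^ j * u k))"
        by (simp add: sum.cartesian_product split_def)
      also have "\<dots> = (\<Sum>k<N. \<Sum>j\<le>m. c (j, k) * (x ^ j * u k))" by (rule sum.swap)
      also have "\<dots> = (\<Sum>k<N. poly (p k) x * u k)"
        unfolding p_def by (simp add: poly_sum poly_monom sum_distrib_right mult.assoc)
      finally have s: "(\<Sum>k<N. poly (p k) x * u k) \<in> {0}" using c(2) by simp
      have p0: "p k = 0" if "k < N" for k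
      proof -
        have "poly (p k) x = 0"
        proof (rule lin_indep_modD[OF indep_u _ s])
          show "poly (p i) x \<in> polys_over K x" if "i \<in> {..<N}" for i
            using that pK unfolding polys_over_def by auto
        qed (use that in auto)
        then show ?thesis using transcendentalD[OF x_trans] pK[OF that] by blast
      qed
      show "\<forall>i\<in>?A. c i = 0"
      proof
        fix i assume "i \<in> ?A"
        then obtain j k where i: "i = (j, k)" "j \<le> m" "k < N" by auto
        then show "c i = 0" using pc[of k j] p0[of k] by simp
      qed
    qed
  qed auto
  then show ?thesis by simp
qed

lemma div_deg_x_poles_le: "div_deg K x_poles \<le> int N"
proof -
  let ?S = "{R \<in> places K. x \<notin> R}"
  have f: "finite ?S" by (rule finite_poles)
  have "div_deg K x_poles = (\<Sum>R\<in>?S. x_poles R * int (place_degree K R))"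
    by (rule div_deg_eq_sum[OF f]) (auto simp: pole_div_def)
  also have "\<dots> = (\<Sum>R\<in>?S. int (nat (ord R (inverse x)) * place_degree K R))"
  proof (intro sum.cong refl)
    fix R assume R: "R \<in> ?S"
    then have "ord R (inverse x) = x_poles R" using ord_inverse[of R x] x_nonzero by (auto simp: pole_div_def)
    then show "x_poles R * int (place_degree K R) = int (nat (ord R (inverse x)) * place_degree K R)"
      using pole_div_nonneg[of x R] by simp
  qed
  also have "\<dots> = int (\<Sum>R\<in>?S. nat (ord R (inverse x)) * place_degree K R)" by simp
  also have "\<dots> \<le> int N"
    using zeros_degree_le[OF f _ _ _ dep_over_inverse_x] x_nonzero place_inverse by (intro of_nat_mono) auto
  finally show ?thesis .
qed

text \<open>Growth in m decides: \<open>ell\<close> of the divisor with m times the poles of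
  \<open>x\<close> is at least (m + 1) N, yet at most 1 plus the degree of that divisor.\<close>

lemma div_deg_x_poles: "div_deg K x_poles = int N"
proof (rule ccontr)
  assume "div_deg K x_poles \<noteq> int N"
  then have d: "div_deg K x_poles \<le> int N - 1" using div_deg_x_poles_le by simp
  obtain c where c: "div_deg K basis_poles = int c" using div_deg_nonneg[of basis_poles] basis_poles_nonneg zero_le_imp_eq_int by blast
  \<comment> \<open>With degree at most N - 1 the two estimates give (m + 1) N \<le> 1 + m (N - 1) +
    c, that is N \<le> 1 + c - m; for m = c + 2 the right-hand side is -1.\<close>
  let ?m = "c + 2"
  have "int (ell K (\<lambda>R. int ?m * x_poles R + basis_poles R)) - div_deg K (\<lambda>R. int ?m * x_poles R + basis_poles R) \<le> int (ell K (\<lambda>_. 0)) - div_deg K (\<lambda>_. 0)"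
    using pole_div_nonneg[of x] basis_poles_nonneg by (intro ell_minus_deg_antimono divisor_zero divisor_mult_x_poles) auto
  moreover have "ell K (\<lambda>_. 0) = 1" using ell_eqI has_dim_K RR_zero by simp
  ultimately have "int (ell K (\<lambda>R. int ?m * x_poles R + basis_poles R)) \<le> 1 + int ?m * div_deg K x_poles + int c"
    unfolding divisor_mult_x_poles divisor_zero c by simp
  moreover have "int (Suc ?m * N) \<le> int (ell K (\<lambda>R. int ?m * x_poles R + basis_poles R))" using ell_mult_x_poles_ge[of ?m] by (simp only: of_nat_le_iff)
  ultimately have "int (Suc ?m * N) \<le> 1 + int ?m * div_deg K x_poles + int c" by simp
  also have "\<dots> \<le> 1 + int ?m * (int N - 1) + int c" using d by (intro add_mono mult_left_mono) auto
  finally show False by (simp add: algebra_simps)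
qed

text \<open>The zeros of a(x) have total degree at most \<open>degree a * N\<close>, by the bound
  for F over K(a(x)), while the pole divisor is exactly \<open>degree a\<close> times that of
  \<open>x\<close>, whose degree is \<open>N\<close>.\<close>

lemma div_deg_principal_poly:
  assumes a: "\<forall>k. coeff a k \<in> K" "a \<noteq> 0"
  shows "div_deg K (principal_div (poly a x)) \<le> 0"
proof (cases "degree a = 0")
  case True
  then obtain c where "a = [:c:]" by (metis degree_eq_zeroE)
  then have c: "poly a x = c" "c \<in> K" "c \<noteq> 0" using a by (auto simp: coeff_pCons split: nat.splits)
  have "principal_div (poly a x) = (\<lambda>_. 0)"
    using ord_K c by auto
  then show ?thesis using divisor_zero by simp
next
  case False
  let ?z = "poly a x" and ?n = "int (degree a)"
  have z0: "?z \<noteq> 0" using transcendentalD[OF x_trans, of a] a by blast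
  let ?Z = "{R \<in> places K. ?z \<in> max_ideal R}" and ?D = "principal_div ?z"
  let ?E = "\<lambda>R. if R \<in> ?Z then ord R ?z else 0"
  have fZ: "finite ?Z" by (rule finite_zeros[OF z0])
  have dE: "divisor K ?E" by (rule divisorI_finite_places[OF fZ]) auto
  have eq: "?D = (\<lambda>R. 1 * ?E R + (- ?n) * x_poles R)"
  proof
    fix R
    show "?D R = 1 * ?E R + (- ?n) * x_poles R"
    proof (cases "R \<in> places K")
      case False then show ?thesis by (simp add: pole_div_def)
    next
      case R: True
      show ?thesis
      proof (cases "x \<in> R")
        case True
        then have "?z \<in> R" using polys_over_subset[OF place_ring[OF R] place_K[OF R]] a unfolding polys_over_def by blast
        then show ?thesis using R True ord_nonneg_iff[OF R z0] ord_pos_iff[OF R z0] by (auto simp: pole_div_def)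
      next
        case False
        have o: "ord R ?z = ?n * ord R x" using ord_poly_at_pole[OF R False a] by blast
        have "?n * ord R x < 0"
          using \<open>degree a \<noteq> 0\<close> ord_nonneg_iff[OF R x_nonzero] False by (intro mult_pos_neg) auto
        then have "R \<notin> ?Z" using o ord_pos_iff[OF R z0] by auto
        then show ?thesis using R False o by (simp add: pole_div_def)
      qed
    qed
  qed
  have "div_deg K ?E = (\<Sum>R\<in>?Z. ?E R * int (place_degree K R))" by (rule div_deg_eq_sum[OF fZ]) auto
  also have "\<dots> = (\<Sum>R\<in>?Z. int (nat (ord R ?z) * place_degree K R))"
  proof (intro sum.cong refl)
    fix R assume R: "R \<in> ?Z"
    then have "ord R ?z > 0" using ord_pos_iff[OF _ z0] by blast
    then show "?E R * int (place_degree K R) = int (nat (ord R ?z) * place_degree K R)" using R by simp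
  qed
  also have "\<dots> = int (\<Sum>R\<in>?Z. nat (ord R ?z) * place_degree K R)" by simp
  also have "\<dots> \<le> int (degree a * N)"
  proof (rule of_nat_mono, rule zeros_degree_le[OF fZ _ z0])
    show "dep_over K (poly a x) (degree a * N)" using a(1) False by (intro dep_over_poly) auto
  qed auto
  finally have "div_deg K ?E \<le> ?n * int N" by simp
  then show ?thesis
    unfolding eq divisor_lincomb(2)[OF dE divisor_pole_div] div_deg_x_poles by simp
qed

lemma ell_minus_deg_mult_x_poles: "int N - div_deg K basis_poles \<le> int (ell K (\<lambda>R. int m * x_poles R)) - div_deg K (\<lambda>R. int m * x_poles R)"
proof -
  have "int (Suc m * N) \<le> int (ell K (\<lambda>R. int m * x_poles R + basis_poles R))" using ell_mult_x_poles_ge by (simp only: of_nat_le_iff)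
  then have "int N - div_deg K basis_poles \<le> int (ell K (\<lambda>R. int m * x_poles R + basis_poles R)) - div_deg K (\<lambda>R. int m * x_poles R + basis_poles R)"
    unfolding divisor_mult_x_poles div_deg_x_poles by (simp add: algebra_simps)
  also have "\<dots> \<le> int (ell K (\<lambda>R. int m * x_poles R)) - div_deg K (\<lambda>R. int m * x_poles R)"
    using basis_poles_nonneg by (intro ell_minus_deg_antimono divisor_mult_x_poles divisor_mult divisor_pole_div) auto
  finally show ?thesis .
qed

text \<open>At each place of \<open>A\<close> where \<open>x\<close> is regular, a nonzero element
  of K[x] vanishing there is raised to the multiplicity of \<open>A\<close>. The product cancels
  \<open>A\<close> away from the poles of \<open>x\<close>.\<close>

lemma exists_poly_dominating:
  assumes A: "divisor K A" "\<And>R. A R \<ge> 0"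
  shows "\<exists>a m. (\<forall>k. coeff a k \<in> K) \<and> a \<noteq> 0 \<and> (\<forall>R\<in>places K. A R - ord R (poly a x) \<le> int m * x_poles R)"
proof -
  let ?T = "{R. A R \<noteq> 0 \<and> x \<in> R}"
  have fT: "finite ?T" using divisor_finite[OF A(1)] by (rule rev_finite_subset) auto
  have Tp: "R \<in> ?T \<Longrightarrow> R \<in> places K" for R using A unfolding divisor_def by blast
  obtain c where c: "\<And>R. R \<in> ?T \<Longrightarrow> c R \<in> polys_over K x" "\<And>R. R \<in> ?T \<Longrightarrow> c R \<noteq> 0"
    "\<And>R. R \<in> ?T \<Longrightarrow> c R \<in> max_ideal R"
    using poly_in_max_ideal Tp by (metis (no_types, lifting) mem_Collect_eq)
  define z where "z = (\<Prod>R\<in>?T. c R ^ nat (A R))"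
  have z0: "z \<noteq> 0" unfolding z_def using c(2) fT by auto
  have zP: "z \<in> polys_over K x" unfolding z_def
    using c(1) by (intro closed_ring_prod[OF closed_ring_polys] closed_ring_power[OF closed_ring_polys])
  then obtain a where a: "z = poly a x" "\<forall>k. coeff a k \<in> K" unfolding polys_over_def by blast
  have a0: "a \<noteq> 0" using a z0 by auto
  define s where "s = (\<Sum>R\<in>{R. A R \<noteq> 0}. A R)"
  have As: "A R \<le> s" for R
  proof (cases "A R = 0")
    case True then show ?thesis unfolding s_def using A(2) by (auto intro: sum_nonneg)
  next
    case False then show ?thesis unfolding s_def using A(2) divisor_finite[OF A(1)] by (intro member_le_sum) auto
  qed
  have s0: "s \<ge> 0" unfolding s_def using A(2) by (auto intro: sum_nonneg)
  \<comment> \<open>At the poles of \<open>x\<close>, \<open>degree a\<close> accounts for the poles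
    of the product and \<open>s\<close> for the multiplicities of \<open>A\<close>.\<close>
  define m where "m = degree a + nat s"
  have "A R - ord R z \<le> int m * x_poles R" if R: "R \<in> places K" for R
  proof (cases "x \<in> R")
    case True
    then have BR: "x_poles R = 0" by (simp add: pole_div_def)
    have zR: "polys_over K x \<subseteq> R" by (rule polys_over_subset[OF place_ring[OF R] place_K[OF R] True])
    show ?thesis
    proof (cases "R \<in> ?T")
      case T: True
      let ?r = "\<Prod>S\<in>?T - {R}. c S ^ nat (A S)"
      have "?r \<in> polys_over K x"
        using c(1) by (intro closed_ring_prod[OF closed_ring_polys] closed_ring_power[OF closed_ring_polys]) auto
      then have r: "?r \<in> val_ge R 0" using zR val_ge_0[OF R] by blast
      have "ord R (c R) \<ge> 1" using ord_pos_iff[OF R c(2)[OF T]] c(3)[OF T] by simp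
      then have "int (nat (A R)) * 1 \<le> int (nat (A R)) * ord R (c R)" by (intro mult_left_mono) auto
      then have "c R ^ nat (A R) \<in> val_ge R (A R)"
        unfolding val_ge_def using ord_power[OF R c(2)[OF T], of "nat (A R)"] A(2)[of R] by simp
      then have "c R ^ nat (A R) * ?r \<in> val_ge R (A R + 0)" using r val_ge_mult[OF R] by blast
      moreover have "z = c R ^ nat (A R) * ?r" unfolding z_def using T fT by (subst prod.remove[of _ R]) auto
      ultimately have "z \<in> val_ge R (A R)" by (simp only: add_0_right)
      then show ?thesis using z0 BR unfolding val_ge_def by simp
    next
      case False
      then have "A R = 0" using True by simp
      moreover have "ord R z \<ge> 0" using zR zP ord_nonneg_iff[OF R z0] by blast
      ultimately show ?thesis using BR by simp
    qed
  next
    case False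
    have o: "ord R z = - int (degree a) * x_poles R"
      using ord_poly_at_pole[OF R False a(2) a0] a(1) R False by (simp add: pole_div_def)
    have "A R * 1 \<le> s * x_poles R" using As[of R] pole_div_pos[OF R False] s0 A(2)[of R] by (intro mult_mono) auto
    then show ?thesis unfolding o m_def using s0 by (simp add: algebra_simps)
  qed
  then show ?thesis using a a0 by blast
qed

text \<open>\<open>A\<close> is enlarged to its positive part \<open>A1\<close>, which is moved by a
  principal divisor below a multiple of \<open>x_poles\<close>. The move keeps \<open>ell\<close>
  and does not lower the degree, since the principal divisor of a polynomial in \<open>x\<close> has
  degree at most 0; so ell - deg of \<open>A1\<close> is no smaller than that of the moved
  divisor.\<close>

lemma riemann_bounded:
  assumes A: "divisor K A"
  shows "div_deg K A - int (ell K A) \<le> div_deg K basis_poles - int N"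
proof -
  define A1 where "A1 = (\<lambda>R. max 0 (A R))"
  have A1: "divisor K A1" using A unfolding A1_def
    by (intro divisorI_finite_places[of "{R. A R \<noteq> 0}"]) (auto simp: divisor_def)
  obtain a m where a: "\<forall>k. coeff a k \<in> K" "a \<noteq> 0" "\<And>R. R \<in> places K \<Longrightarrow> A1 R - ord R (poly a x) \<le> int m * x_poles R"
    using exists_poly_dominating[OF A1] by (auto simp: A1_def)
  have z0: "poly a x \<noteq> 0" using transcendentalD[OF x_trans, of a] a by blast
  let ?P = "principal_div (poly a x)"
  let ?D = "\<lambda>R. A1 R - ?P R"
  have D: "divisor K ?D" "div_deg K ?D = div_deg K A1 - div_deg K ?P"
    using divisor_diff[OF A1 divisor_principal[OF z0]] by auto
  have out: "A1 R = 0" if "R \<notin> places K" for R using that A unfolding A1_def divisor_def by (metis max.idem)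
  have "ell K ?D = ell K (\<lambda>R. A1 R - ord R (poly a x))"
    unfolding ell_def by (simp cong: RR_cong)
  also have "\<dots> = ell K A1" by (rule ell_scale[OF z0 A1])
  finally have eD: "ell K ?D = ell K A1" .
  have "?D R \<le> int m * x_poles R" for R
    using a(3)[of R] out[of R] by (cases "R \<in> places K") (simp_all add: pole_div_def)
  then have "int (ell K (\<lambda>R. int m * x_poles R)) - div_deg K (\<lambda>R. int m * x_poles R) \<le> int (ell K ?D) - div_deg K ?D"
    by (intro ell_minus_deg_antimono D divisor_mult divisor_pole_div)
  moreover have "int (ell K A1) - div_deg K A1 \<le> int (ell K A) - div_deg K A"
    by (intro ell_minus_deg_antimono A A1) (simp add: A1_def)
  ultimately show ?thesis
    using ell_minus_deg_mult_x_poles[of m] div_deg_principal_poly[OF a(1,2)] eD D(2) by linarith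
qed

text \<open>Riemann's inequality. The uniform bound just proved is what makes the
  \<open>GREATEST\<close> in \<open>genus\<close> an attained maximum.\<close>

lemma genus_ge:
  assumes "divisor K A"
  shows "div_deg K A - int (ell K A) + 1 \<le> genus K"
  unfolding genus_def
proof (rule Greatest_int_bounded)
  show "\<exists>A. divisor K A \<and> div_deg K (\<lambda>_. 0) - int (ell K (\<lambda>_. 0)) + 1 = div_deg K A - int (ell K A) + 1"
    using divisor_zero(1) by blast
  show "m \<le> div_deg K basis_poles - int N + 1" if "\<exists>A. divisor K A \<and> m = div_deg K A - int (ell K A) + 1" for m
    using that riemann_bounded by auto
  show "\<exists>Aa. divisor K Aa \<and> div_deg K A - int (ell K A) + 1 = div_deg K Aa - int (ell K Aa) + 1"
    using assms by blast
qed

text \<open>Multiplication by a power of \<open>z\<close> identifies the space of a multiple of (z)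
  with L(0). If (z) had positive degree, multiples would have ever larger degree but
  \<open>ell\<close> equal to 1, against Riemann's inequality.\<close>

lemma div_deg_principal_le_0:
  assumes z: "z \<noteq> 0"
  shows "div_deg K (principal_div z) \<le> 0"
proof (rule ccontr)
  let ?P = "principal_div z"
  assume n: "\<not> div_deg K ?P \<le> 0"
  have P: "divisor K ?P" by (rule divisor_principal[OF z])
  define k where "k = Suc (nat (genus K))"
  have y0: "inverse (z ^ k) \<noteq> 0" using z by simp
  have "ell K (\<lambda>R. int k * ?P R) = ell K (\<lambda>R. 0 - ord R (inverse (z ^ k)))"
    unfolding ell_def using ord_inverse[of _ "z ^ k"] ord_power[OF _ z, of _ k] z by (simp cong: RR_cong)
  also have "\<dots> = ell K (\<lambda>_. 0)" by (rule ell_scale[OF y0 divisor_zero(1)])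
  also have "\<dots> = 1" using ell_eqI has_dim_K RR_zero by simp
  finally have "int k * div_deg K ?P \<le> genus K"
    using genus_ge[OF divisor_mult(1)[OF P, of "int k"]] divisor_mult(2)[OF P, of "int k"] by simp
  moreover have "int k * 1 \<le> int k * div_deg K ?P" using n by (intro mult_left_mono) auto
  ultimately have "int k \<le> genus K" by linarith
  then show False unfolding k_def by linarith
qed

text \<open>A nonzero element would have a principal divisor at least -A, hence of positive
  degree.\<close>

lemma RR_neg_deg:
  assumes A: "divisor K A" "div_deg K A < 0"
  shows "RR_space K A = {0}"
proof -
  have False if z: "z \<in> RR_space K A" "z \<noteq> 0" for z
  proof -
    let ?P = "principal_div z"
    have "- A R \<le> ?P R" for R
      using z A unfolding RR_space_def divisor_def by (cases "A R = 0") auto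
    then have "div_deg K (\<lambda>R. -1 * A R) \<le> div_deg K ?P"
      by (intro div_deg_mono divisor_mult A divisor_principal z) auto
    then show False using div_deg_principal_le_0[OF z(2)] divisor_mult(2)[OF A(1), of "-1"] A(2) by simp
  qed
  then show ?thesis using ksubspaceD(1)[OF ksubspace_RR] by blast
qed

end

section \<open>Non-special divisors\<close>

context ff_rational begin

definition regular_away :: "'f set \<Rightarrow> ('f set \<Rightarrow> int) \<Rightarrow> 'f set" where
  "regular_away R A = {z. \<forall>S\<in>places K. S \<noteq> R \<longrightarrow> z \<in> val_ge S (- A S)}"

definition split_sum :: "'f set \<Rightarrow> ('f set \<Rightarrow> int) \<Rightarrow> 'f set" where
  "split_sum R A = {m + f | m f. m \<in> regular_away R A \<and> f \<in> val_ge R (- A R)}"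

lemma ksubspace_regular_away: "ksubspace K (regular_away R A)"
  unfolding ksubspace_def regular_away_def
  using ksubspaceD[OF ksubspace_val_ge] by auto

lemma ksubspace_split_sum:
  assumes R: "R \<in> places K" shows "ksubspace K (split_sum R A)"
  unfolding ksubspace_def
proof (intro conjI ballI)
  note m = ksubspaceD[OF ksubspace_regular_away[of R A]] and f = ksubspaceD[OF ksubspace_val_ge[OF R, of "- A R"]]
  show "0 \<in> split_sum R A" unfolding split_sum_def using m(1) f(1) by (intro CollectI exI[of _ 0]) auto
  fix a b assume "a \<in> split_sum R A" "b \<in> split_sum R A"
  then obtain m1 f1 m2 f2 where "a = m1 + f1" "b = m2 + f2" "m1 \<in> regular_away R A" "m2 \<in> regular_away R A"
    "f1 \<in> val_ge R (- A R)" "f2 \<in> val_ge R (- A R)" unfolding split_sum_def by blast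
  moreover from this have "a + b = (m1 + m2) + (f1 + f2)" by simp
  ultimately show "a + b \<in> split_sum R A" unfolding split_sum_def using m(2) f(2) by blast
next
  note m = ksubspaceD[OF ksubspace_regular_away[of R A]] and f = ksubspaceD[OF ksubspace_val_ge[OF R, of "- A R"]]
  fix c a assume "c \<in> K" "a \<in> split_sum R A"
  then obtain m1 f1 where "a = m1 + f1" "m1 \<in> regular_away R A" "f1 \<in> val_ge R (- A R)" unfolding split_sum_def by blast
  moreover from this have "c * a = c * m1 + c * f1" by (simp add: distrib_left)
  ultimately show "c * a \<in> split_sum R A" unfolding split_sum_def using m(3) f(3) \<open>c \<in> K\<close> by blast
qed

text \<open>One half of Riemann-Roch: the first cohomology has at most the expected dimension. For
  large m, with D = A + m R, the \<open>z i\<close> and a basis of L(D)/L(A) are jointly independent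
  in a space of dimension m, namely the conditions of \<open>D\<close> and \<open>A\<close> at
  \<open>R\<close>. So k is at most m - ell D + ell A, and Riemann's inequality for \<open>D\<close>
  finishes.\<close>

lemma card_indep_mod_split_sum:
  assumes rat: "rational_place K R" and A: "divisor K A"
    and ind: "lin_indep_mod K (split_sum R A) {..<k::nat} z"
  shows "int k \<le> genus K - 1 - div_deg K A + int (ell K A)"
proof -
  have R: "R \<in> places K" and deg: "place_degree K R = 1" using rat unfolding rational_place_def by auto
  \<comment> \<open>Large enough for every \<open>z i\<close> to meet the condition of
    \<open>D\<close> at \<open>R\<close>.\<close>
  define m where "m = nat \<bar>A R\<bar> + (\<Sum>i<k. nat \<bar>ord R (z i)\<bar>)"
  let ?F0 = "val_ge R (- A R)" and ?Fm = "val_ge R (- A R - int m)"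
  have zF: "z i \<in> ?Fm" if "i < k" for i
  proof -
    have "nat \<bar>ord R (z i)\<bar> \<le> (\<Sum>i<k. nat \<bar>ord R (z i)\<bar>)" using that by (intro member_le_sum) auto
    then have "- A R - int m \<le> ord R (z i)" unfolding m_def by linarith
    then show ?thesis unfolding val_ge_def by simp
  qed
  have Fdim: "has_dim K ?Fm ?F0 m"
    using has_dim_val_ge[OF R, of "- A R - int m" m] deg by simp
  define D where "D = (\<lambda>X. A X + int m * place_div R X)"
  note pd = divisor_place_div[OF R]
  have D: "divisor K D" "div_deg K D = div_deg K A + int m"
    unfolding D_def using divisor_lincomb[OF A pd(1), of 1 "int m"] pd(2) deg by auto
  have DR: "D R = A R + int m" "S \<noteq> R \<Longrightarrow> D S = A S" for S by (auto simp: D_def place_div_apply)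
  have sub: "RR_space K A \<subseteq> RR_space K D" by (rule RR_mono) (simp add: D_def place_div_apply)
  have RD: "RR_space K D \<subseteq> ?Fm" "RR_space K D \<subseteq> regular_away R A"
  proof -
    have mR: "- A R - int m = - D R" using DR(1) by simp
    show "RR_space K D \<subseteq> ?Fm" unfolding mR using R unfolding mem_RR subset_iff by blast
    show "RR_space K D \<subseteq> regular_away R A"
    proof
      fix y assume y: "y \<in> RR_space K D"
      show "y \<in> regular_away R A" unfolding regular_away_def
      proof (intro CollectI ballI impI)
        fix S assume S: "S \<in> places K" "S \<noteq> R"
        then have "y \<in> val_ge S (- D S)" using y unfolding mem_RR by blast
        then show "y \<in> val_ge S (- A S)" using DR(2)[OF S(2)] by simp
      qed
    qed
  qed
  have RF: "RR_space K D \<inter> ?F0 \<subseteq> RR_space K A"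
  proof
    fix y assume y: "y \<in> RR_space K D \<inter> ?F0"
    show "y \<in> RR_space K A" unfolding mem_RR
    proof
      fix S assume "S \<in> places K"
      then have "y \<in> val_ge S (- D S)" using IntD1[OF y] unfolding mem_RR by blast
      then show "y \<in> val_ge S (- A S)" using y DR(2)[of S] by (cases "S = R") simp_all
    qed
  qed
  have "\<exists>e\<le>m. has_dim K (RR_space K D) (RR_space K A) e"
    by (rule has_dim_linear_inj[where f = "\<lambda>z. z", OF _ _ ksubspace_RR _ _ ksubspace_RR ksubspace_val_ge[OF R] Fdim])
       (use RD RF in auto)
  then obtain e where e: "has_dim K (RR_space K D) (RR_space K A) e" by blast
  have "has_dim K (RR_space K D) {0} (e + ell K A)"
    using has_dim_trans[OF ksubspace_zero ksubspace_RR ksubspace_RR _ sub e ell_has_dim[OF A]]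
      ksubspaceD(1)[OF ksubspace_RR] by auto
  then have ellD: "ell K D = e + ell K A" by (rule ell_eqI)
  obtain y where y: "\<forall>i<e. y i \<in> RR_space K D" "lin_indep_mod K (RR_space K A) {..<e} y"
    using e unfolding has_dim_def by blast
  let ?A = "{..<e} <+> {..<k}" and ?f = "case_sum y z"
  have s: "(\<Sum>i\<in>?A. c i * ?f i) = (\<Sum>i<e. c (Inl i) * y i) + (\<Sum>i<k. c (Inr i) * z i)" for c
    by (subst sum.Plus) auto
  have "card ?A \<le> m"
  proof (rule has_dim_indep_le[OF ksubspace_val_ge[OF R] Fdim])
    show "?f i \<in> ?Fm" if "i \<in> ?A" for i using that y(1) RD(1) zF by auto
    show "lin_indep_mod K ?F0 ?A ?f"
      unfolding lin_indep_mod_def s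
    proof (intro allI impI)
      fix c assume c: "\<forall>i\<in>?A. c i \<in> K" "(\<Sum>i<e. c (Inl i) * y i) + (\<Sum>i<k. c (Inr i) * z i) \<in> ?F0"
      let ?y = "\<Sum>i<e. c (Inl i) * y i" and ?z = "\<Sum>i<k. c (Inr i) * z i"
      have yD: "?y \<in> RR_space K D" using c y by (intro ksubspace_lincomb[OF ksubspace_RR]) auto
      \<comment> \<open>Away from \<open>R\<close> the spaces of \<open>D\<close> and
        \<open>A\<close> impose the same conditions. A relation modulo the condition at
        \<open>R\<close> therefore puts the \<open>z\<close> part into \<open>split_sum R A\<close>,
        where its independence applies.\<close>
      then have "- ?y \<in> regular_away R A" using RD(2) ksubspace_uminus[OF ksubspace_regular_away] by blast
      moreover have "?z = - ?y + (?y + ?z)" by simp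
      ultimately have "?z \<in> split_sum R A" unfolding split_sum_def using c(2) by blast
      then have z0: "c (Inr i) = 0" if "i < k" for i
        using lin_indep_modD[OF ind, of "\<lambda>i. c (Inr i)" i] c(1) that by auto
      then have "?y \<in> ?F0" using c(2) by simp
      then have "?y \<in> RR_space K A" using RF yD by blast
      then have "c (Inl i) = 0" if "i < e" for i
        using lin_indep_modD[OF y(2), of "\<lambda>i. c (Inl i)" i] c(1) that by auto
      then show "\<forall>i\<in>?A. c i = 0" using z0 by auto
    qed
  qed auto
  then have "e + k \<le> m" by (simp add: card_Plus)
  then show ?thesis using genus_ge[OF D(1)] D(2) ellD by linarith
qed

lemma finite_codim_split_sum:
  assumes rat: "rational_place K R" and A: "divisor K A"
  shows "\<exists>d. has_dim K UNIV (split_sum R A) d \<and> int d \<le> genus K - 1 - div_deg K A + int (ell K A)"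
proof -
  have R: "R \<in> places K" using rat unfolding rational_place_def by auto
  let ?b = "genus K - 1 - div_deg K A + int (ell K A)"
  have "\<exists>d\<le>nat ?b. has_dim K UNIV (split_sum R A) d"
    by (rule has_dim_bounded_exists[OF ksubspace_split_sum[OF R]]) (use card_indep_mod_split_sum[OF assms] in force)
  then obtain d where d: "has_dim K UNIV (split_sum R A) d" by blast
  then have "int d \<le> ?b" using card_indep_mod_split_sum[OF assms] unfolding has_dim_def by blast
  then show ?thesis using d by blast
qed

text \<open>The first coordinate with respect to a basis of F modulo \<open>W\<close>; linearity
  follows because coordinates are unique modulo \<open>W\<close>.\<close>

lemma coordinate_functional:
  assumes W: "ksubspace K W" and d: "has_dim K UNIV W d" "d > 0"
  shows "\<exists>\<omega> b. (\<forall>z. \<omega> z \<in> K) \<and> (\<forall>y z. \<omega> (y + z) = \<omega> y + \<omega> z) \<and>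
    (\<forall>c\<in>K. \<forall>z. \<omega> (c * z) = c * \<omega> z) \<and> (\<forall>w\<in>W. \<omega> w = 0) \<and> \<omega> b = 1"
proof -
  obtain b where b: "lin_indep_mod K W {..<d} b" "spans_mod K UNIV W {..<d} b"
    using d unfolding has_dim_def by blast
  have "\<forall>z. \<exists>c. (\<forall>i\<in>{..<d}. c i \<in> K) \<and> z - (\<Sum>i<d. c i * b i) \<in> W"
    using b(2) unfolding spans_mod_def by blast
  then obtain c where c: "\<And>z i. i < d \<Longrightarrow> c z i \<in> K" "\<And>z. z - (\<Sum>i<d. c z i * b i) \<in> W"
    unfolding choice_iff by blast
  have uniq: "c z i = e i" if "\<And>i. i < d \<Longrightarrow> e i \<in> K" "z - (\<Sum>i<d. e i * b i) \<in> W" "i < d" for z e i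
  proof -
    have "(z - (\<Sum>i<d. e i * b i)) - (z - (\<Sum>i<d. c z i * b i)) \<in> W" by (intro ksubspace_diff[OF W] that c)
    then have "(\<Sum>i<d. (c z i - e i) * b i) \<in> W" by (simp add: left_diff_distrib sum_subtractf)
    then have "c z i - e i = 0"
      using lin_indep_modD[OF b(1), of "\<lambda>i. c z i - e i" i] that c K_ring(6) by auto
    then show ?thesis by simp
  qed
  show ?thesis
  proof (intro exI[of _ "\<lambda>z. c z 0"] exI[of _ "b 0"] conjI allI ballI)
    show "c z 0 \<in> K" for z using c d by auto
    show "c (y + z) 0 = c y 0 + c z 0" for y z
    proof (rule uniq[of "\<lambda>i. c y i + c z i", OF _ _ d(2)])
      have "(y - (\<Sum>i<d. c y i * b i)) + (z - (\<Sum>i<d. c z i * b i)) \<in> W" by (intro ksubspaceD(2)[OF W] c)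
      then show "y + z - (\<Sum>i<d. (c y i + c z i) * b i) \<in> W" by (simp add: distrib_right sum.distrib algebra_simps)
    qed (use c K_ring in auto)
    show "c (a * z) 0 = a * c z 0" if "a \<in> K" for a z
    proof (rule uniq[of "\<lambda>i. a * c z i", OF _ _ d(2)])
      have "a * (z - (\<Sum>i<d. c z i * b i)) \<in> W" by (intro ksubspaceD(3)[OF W] c that)
      then show "a * z - (\<Sum>i<d. a * c z i * b i) \<in> W" by (simp add: right_diff_distrib sum_distrib_left mult.assoc)
    qed (use c K_ring that in auto)
    show "c w 0 = 0" if "w \<in> W" for w
      by (rule uniq[of "\<lambda>_. 0", OF _ _ d(2)]) (use that K_ring in auto)
    show "c (b 0) 0 = 1"
    proof -
      have "(\<Sum>i<d. (if i = 0 then 1 else 0) * b i) = b 0"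
        using d(2) by (subst sum.cong[OF refl, of _ _ "\<lambda>i. if i = 0 then b 0 else 0"]) auto
      then show ?thesis
        using uniq[of "\<lambda>i. if i = 0 then 1 else 0" "b 0" 0] d(2) K_ring ksubspaceD(1)[OF W] by auto
    qed
  qed
qed

text \<open>If \<open>L(A) = L(A + R)\<close>, some functional \<open>\<omega> \<noteq> 0\<close> on \<open>F\<close> kills the functions regular
  away from \<open>R\<close> and those regular at \<open>R\<close> (both relative to \<open>A\<close>).  Then
  \<open>y \<mapsto> \<omega>(y \<cdot> _)\<close> embeds \<open>L(A)\<close> into the functionals with the same property relative to
  the zero divisor, a space of dimension at most the genus.\<close>
lemma RR_add_rational_place_strict:
  assumes rat: "rational_place K R" and A: "divisor K A" and deg: "div_deg K A \<ge> 2 * genus K - 1"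
  shows "\<exists>z \<in> RR_space K (\<lambda>X. A X + place_div R X). z \<notin> RR_space K A"
proof (rule ccontr)
  assume "\<not> ?thesis"
  then have sub: "RR_space K (\<lambda>X. A X + place_div R X) \<subseteq> RR_space K A" by blast
  have R: "R \<in> places K" and deg1: "place_degree K R = 1" using rat unfolding rational_place_def by auto
  have "RR_space K A \<subseteq> RR_space K (\<lambda>X. A X + place_div R X)" by (rule RR_mono) (simp add: place_div_apply)
  then have "ell K A = ell K (\<lambda>X. A X + place_div R X)" using sub unfolding ell_def by (simp add: subset_antisym)
  moreover have "div_deg K (\<lambda>X. A X + place_div R X) - int (ell K (\<lambda>X. A X + place_div R X)) + 1 \<le> genus K"
    by (intro genus_ge divisor_add A divisor_place_div R)
  \<comment> \<open>A + R has degree at least 2g, so Riemann's inequality gives it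
    \<open>ell\<close> at least g + 1, and by assumption \<open>A\<close> has the same
    \<open>ell\<close>.\<close>
  ultimately have ellA: "int (ell K A) \<ge> genus K + 1"
    using divisor_add(2)[OF A divisor_place_div(1)[OF R]] divisor_place_div(2)[OF R] deg deg1 by simp
  \<comment> \<open>A pole at \<open>R\<close> of order one more than \<open>A\<close> permits. A
    splitting of \<open>t\<close> would leave a summand in L(A + R) outside L(A), so
    \<open>split_sum R A\<close> is a proper subspace and a nonzero functional vanishing on it
    exists.\<close>
  define t where "t = unif R powi (- A R - 1)"
  have t: "t \<noteq> 0" "ord R t = - A R - 1" unfolding t_def using unif(2)[OF R] ord_unif_powi[OF R] by auto
  have tW: "t \<notin> split_sum R A"
  proof
    assume "t \<in> split_sum R A"
    then obtain m f where mf: "t = m + f" "m \<in> regular_away R A" "f \<in> val_ge R (- A R)" unfolding split_sum_def by blast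
    have "- f \<in> val_ge R (ord R t + 1)" using mf(3) t(2) ksubspace_uminus[OF ksubspace_val_ge[OF R]] by simp
    then have m: "ord R m = - A R - 1" "m \<noteq> 0" using ord_add_eq[OF R t(1), of "- f"] mf(1) t(2) by auto
    have "m \<in> RR_space K (\<lambda>X. A X + place_div R X)"
      unfolding mem_RR
    proof
      fix S assume "S \<in> places K"
      then show "m \<in> val_ge S (- (A S + place_div R S))"
        using mf(2) m(1) unfolding regular_away_def val_ge_def by (cases "S = R") (auto simp: place_div_apply)
    qed
    then have "m \<in> RR_space K A" using sub by blast
    then have "m \<in> val_ge R (- A R)" using R unfolding mem_RR by blast
    then show False using m unfolding val_ge_def by simp
  qed
  obtain d where d: "has_dim K UNIV (split_sum R A) d" using finite_codim_split_sum[OF rat A] by blast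
  have "d > 0" using has_dim_0D[of UNIV "split_sum R A"] d tW by (cases d) auto
  then obtain \<omega> b where \<omega>: "\<And>z. \<omega> z \<in> K" "\<And>y z. \<omega> (y + z) = \<omega> y + \<omega> z"
    "\<And>c z. c \<in> K \<Longrightarrow> \<omega> (c * z) = c * \<omega> z" "\<And>w. w \<in> split_sum R A \<Longrightarrow> \<omega> w = 0" "\<omega> b = 1"
    using coordinate_functional[OF ksubspace_split_sum[OF R] d] by blast
  have \<omega>0: "\<omega> 0 = 0" using \<omega>(2)[of 0 0] by (metis add_cancel_right_left add_0)
  have \<omega>sum: "\<omega> (\<Sum>i\<in>I. f i) = (\<Sum>i\<in>I. \<omega> (f i))" for I :: "nat set" and f
    by (induction I rule: infinite_finite_induct) (auto simp: \<omega>0 \<omega>(2))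
  \<comment> \<open>For the zero divisor the codimension bound reads g - 1 - 0 + 1 = g.\<close>
  obtain k where k: "has_dim K UNIV (split_sum R (\<lambda>_. 0)) k" "int k \<le> genus K"
    using finite_codim_split_sum[OF rat divisor_zero(1)] divisor_zero(2) ell_eqI[of "\<lambda>_. 0" 1] has_dim_K RR_zero by auto
  obtain y where y: "spans_mod K UNIV (split_sum R (\<lambda>_. 0)) {..<k} y" using k(1) unfolding has_dim_def by blast
  obtain v where v: "\<forall>i<ell K A. v i \<in> RR_space K A" "lin_indep_mod K {0} {..<ell K A} v"
    using ell_has_dim[OF A] unfolding has_dim_def by blast
  \<comment> \<open>There are at least g + 1 unknowns and at most g equations, so some nonzero
    \<open>X\<close> in L(A) has \<omega>(X y_j) = 0 for all j.\<close>
  have "\<exists>c. (\<forall>i\<in>{..<ell K A}. c i \<in> K) \<and> (\<exists>i\<in>{..<ell K A}. c i \<noteq> 0) \<and>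
    (\<forall>j\<in>{..<k}. (\<Sum>i<ell K A. c i * \<omega> (v i * y j)) = 0)"
    by (rule underdetermined_system[OF closed_ring_K]) (use ellA k(2) \<omega>(1) in auto)
  then obtain c where c: "\<forall>i<ell K A. c i \<in> K" "\<exists>i<ell K A. c i \<noteq> 0"
    "\<And>j. j < k \<Longrightarrow> (\<Sum>i<ell K A. c i * \<omega> (v i * y j)) = 0" by auto
  define X where "X = (\<Sum>i<ell K A. c i * v i)"
  have XA: "X \<in> RR_space K A" unfolding X_def using c v by (intro ksubspace_lincomb[OF ksubspace_RR]) auto
  have X0: "X \<noteq> 0"
  proof
    assume "X = 0"
    then have "c i = 0" if "i < ell K A" for i using lin_indep_modD[OF v(2), of c i] c(1) that unfolding X_def by auto
    then show False using c(2) by blast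
  qed
  have Xy: "\<omega> (X * y j) = 0" if "j < k" for j
  proof -
    have "\<omega> (X * y j) = \<omega> (\<Sum>i<ell K A. c i * (v i * y j))" unfolding X_def by (simp add: sum_distrib_right mult.assoc)
    also have "\<dots> = (\<Sum>i<ell K A. c i * \<omega> (v i * y j))" unfolding \<omega>sum using c(1) \<omega>(3) by (intro sum.cong) auto
    finally show ?thesis using c(3)[OF that] by simp
  qed
  \<comment> \<open>Multiplication by an element of L(A) turns the bounds of the zero divisor into
    those of \<open>A\<close>, at \<open>R\<close> and away from it.\<close>
  have XW: "X * w \<in> split_sum R A" if w: "w \<in> split_sum R (\<lambda>_. 0)" for w
  proof -
    obtain m f where mf: "w = m + f" "m \<in> regular_away R (\<lambda>_. 0)" "f \<in> val_ge R 0"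
      using w unfolding split_sum_def by auto
    have XS: "X \<in> val_ge S (- A S)" if "S \<in> places K" for S using XA that unfolding mem_RR by blast
    have "X * m \<in> regular_away R A"
      using mf(2) XS val_ge_mult[of _ X _ m 0] unfolding regular_away_def by fastforce
    moreover have "X * f \<in> val_ge R (- A R)" using val_ge_mult[OF R XS[OF R] mf(3)] by simp
    ultimately show ?thesis unfolding split_sum_def mf(1) distrib_left by blast
  qed
  have "\<omega> (X * z) = 0" for z
  proof -
    obtain e where e: "\<forall>j\<in>{..<k}. e j \<in> K" "z - (\<Sum>j<k. e j * y j) \<in> split_sum R (\<lambda>_. 0)"
      using y unfolding spans_mod_def by blast
    let ?w = "z - (\<Sum>j<k. e j * y j)"
    have "X * z = X * ?w + (\<Sum>j<k. e j * (X * y j))"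
      by (simp add: right_diff_distrib sum_distrib_left mult.left_commute)
    then have "\<omega> (X * z) = \<omega> (X * ?w) + (\<Sum>j<k. \<omega> (e j * (X * y j)))" by (simp only: \<omega>(2) \<omega>sum)
    also have "\<dots> = 0" using \<omega>(4)[OF XW[OF e(2)]] e(1) Xy by (simp add: \<omega>(3))
    finally show ?thesis .
  qed
  \<comment> \<open>\<omega>(X z) vanishes for all z in F; since \<open>X\<close> is invertible,
    \<omega> itself would be 0.\<close>
  then have "\<omega> (X * (inverse X * b)) = 0" by blast
  then show False using \<omega>(5) X0 by (simp add: mult.assoc[symmetric])
qed

end

section \<open>Reduced states of the encoding\<close>

text \<open>\<open>H\<close>, \<open>f\<close> and \<open>g\<close> stand for L(G) and the
  evaluations at the \<open>Q i\<close> and \<open>P j\<close>; the geometry enters through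
  \<open>inj\<close> alone. The factor \<rho> r r is separated from a weight that depends on the
  input state only through \<open>r\<close>.\<close>

lemma reduced_state_eq_sum_diag:
  fixes K :: "'f::field set" and f g :: "nat \<Rightarrow> 'f \<Rightarrow> 'f" and c :: complex
  assumes fin: "finite K" and IL: "I \<subseteq> {1..L}" and Jn: "J \<subseteq> {1..n}"
    and amp: "\<And>s y. amp s y = c * of_nat (card {h \<in> H. (\<forall>i\<in>{1..L}. f i h = s i) \<and> (\<forall>j\<in>{1..n}. g j h = y j)})"
    and inj: "\<And>h h'. h \<in> H \<Longrightarrow> h' \<in> H \<Longrightarrow> (\<And>i. i \<in> {1..L} - I \<Longrightarrow> f i h = f i h') \<Longrightarrow>
       (\<And>j. j \<in> {1..n} - J \<Longrightarrow> g j h = g j h') \<Longrightarrow> h = h'"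
    and ab: "a \<in> PiE J (\<lambda>_. K)" "b \<in> PiE J (\<lambda>_. K)"
    and enc: "\<And>y y'. enc y y' = (\<Sum>s\<in>PiE {1..L} (\<lambda>_. K). \<Sum>s'\<in>PiE {1..L} (\<lambda>_. K).
        amp s y * tensor_mixed K L I \<rho> s s' * cnj (amp s' y'))"
  shows "reduced_state K n J enc a b =
    (\<Sum>r\<in>PiE I (\<lambda>_. K). \<rho> r r * (\<Sum>(z, s)\<in>PiE ({1..n} - J) (\<lambda>_. K) \<times> {s \<in> PiE {1..L} (\<lambda>_. K). restrict s I = r}.
       if a = b then amp s (\<lambda>j. if j \<in> J then a j else z j) * cnj (amp s (\<lambda>j. if j \<in> J then a j else z j))
          / of_nat (card K ^ card ({1..L} - I)) else 0))"
proof -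
  let ?S = "PiE {1..L} (\<lambda>_. K)" and ?Z = "PiE ({1..n} - J) (\<lambda>_. K)" and ?\<kappa> = "of_nat (card K ^ card ({1..L} - I)) :: complex"
  have fS: "finite ?S" and fZ: "finite ?Z" using fin by (auto intro!: finite_PiE)
  let ?y = "\<lambda>a z j. if j \<in> J then a j else z j"
  let ?T = "\<lambda>z s. if a = b then amp s (?y a z) * cnj (amp s (?y a z)) / ?\<kappa> else 0"
  have inner: "(\<Sum>s'\<in>?S. amp s (?y a z) * tensor_mixed K L I \<rho> s s' * cnj (amp s' (?y b z)))
      = \<rho> (restrict s I) (restrict s I) * ?T z s" if s: "s \<in> ?S" for s z
  proof -
    \<comment> \<open>Nonzero amplitudes come from functions \<open>h\<close> and \<open>h'\<close>.
      They agree on the traced-out shares, which carry the same \<open>z\<close>, and outside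
      \<open>I\<close> because the fully mixed part is diagonal; so \<open>inj\<close>
      applies.\<close>
    have zero: "amp s (?y a z) * tensor_mixed K L I \<rho> s s' * cnj (amp s' (?y b z)) = 0"
      if s': "s' \<in> ?S" and ne: "\<not> (s' = s \<and> a = b)" for s'
    proof (rule ccontr)
      assume nz: "amp s (?y a z) * tensor_mixed K L I \<rho> s s' * cnj (amp s' (?y b z)) \<noteq> 0"
      then have ss: "\<forall>i\<in>{1..L} - I. s i = s' i" unfolding tensor_mixed_def by (auto split: if_splits)
      have "{h \<in> H. (\<forall>i\<in>{1..L}. f i h = s i) \<and> (\<forall>j\<in>{1..n}. g j h = ?y a z j)} \<noteq> {}"
        using nz unfolding amp by (metis (no_types, lifting) card.empty mult_zero_left mult_zero_right of_nat_0)
      then obtain h where h: "h \<in> H" "\<forall>i\<in>{1..L}. f i h = s i" "\<forall>j\<in>{1..n}. g j h = ?y a z j" by blast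
      have "{h \<in> H. (\<forall>i\<in>{1..L}. f i h = s' i) \<and> (\<forall>j\<in>{1..n}. g j h = ?y b z j)} \<noteq> {}"
        using nz unfolding amp by (metis (no_types, lifting) card.empty complex_cnj_zero mult_zero_right of_nat_0)
      then obtain h' where h': "h' \<in> H" "\<forall>i\<in>{1..L}. f i h' = s' i" "\<forall>j\<in>{1..n}. g j h' = ?y b z j" by blast
      have hh: "h = h'"
        by (rule inj[OF h(1) h'(1)]) (use h h' ss in auto)
      have "s' = s" by (rule PiE_ext[OF s' s]) (use h h' hh in auto)
      moreover have "a = b"
      proof (rule PiE_ext[OF ab])
        fix j assume "j \<in> J"
        then show "a j = b j" using h(3) h'(3) hh Jn by (metis (no_types, lifting) subsetD)
      qed
      ultimately show False using ne by blast
    qed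
    have "(\<Sum>s'\<in>?S. amp s (?y a z) * tensor_mixed K L I \<rho> s s' * cnj (amp s' (?y b z)))
      = amp s (?y a z) * tensor_mixed K L I \<rho> s s * cnj (amp s (?y b z))"
    proof -
      have "(\<Sum>s'\<in>?S - {s}. amp s (?y a z) * tensor_mixed K L I \<rho> s s' * cnj (amp s' (?y b z))) = 0"
        by (rule sum.neutral) (use zero in blast)
      then show ?thesis by (simp only: sum.remove[OF fS s] add_0_right)
    qed
    also have "\<dots> = \<rho> (restrict s I) (restrict s I) * ?T z s"
    proof (cases "a = b")
      case True
      show ?thesis unfolding True[symmetric] tensor_mixed_def by simp
    next
      case False then show ?thesis using zero[OF s] by simp
    qed
    finally show ?thesis .
  qed
  have "reduced_state K n J enc a b = (\<Sum>z\<in>?Z. \<Sum>s\<in>?S. \<rho> (restrict s I) (restrict s I) * ?T z s)"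
    unfolding reduced_state_def enc by (intro sum.cong refl inner)
  \<comment> \<open>Secrets are grouped by their restriction to \<open>I\<close>, on which alone the
    entry of \<rho> depends.\<close>
  also have "\<dots> = (\<Sum>z\<in>?Z. \<Sum>r\<in>PiE I (\<lambda>_. K). \<Sum>s\<in>{s \<in> ?S. restrict s I = r}. \<rho> (restrict s I) (restrict s I) * ?T z s)"
  proof (rule sum.cong[OF refl], rule sum.group[OF fS, symmetric])
    show "finite (PiE I (\<lambda>_. K))" using fin finite_subset[OF IL] by (auto intro!: finite_PiE)
    show "(\<lambda>s. restrict s I) ` ?S \<subseteq> PiE I (\<lambda>_. K)" using IL by (auto simp: PiE_iff)
  qed
  also have "\<dots> = (\<Sum>r\<in>PiE I (\<lambda>_. K). \<Sum>z\<in>?Z. \<Sum>s\<in>{s \<in> ?S. restrict s I = r}. \<rho> r r * ?T z s)"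
    by (subst sum.swap) (intro sum.cong refl, auto)
  also have "\<dots> = (\<Sum>r\<in>PiE I (\<lambda>_. K). \<rho> r r * (\<Sum>(z, s)\<in>?Z \<times> {s \<in> ?S. restrict s I = r}. ?T z s))"
    by (simp only: sum.cartesian_product sum_distrib_left split_def)
  finally show ?thesis .
qed

text \<open>Adding \<open>d\<close> to the functions is a bijection of \<open>H\<close> that shifts
  the secrets by the values \<open>f i d\<close> and the traced-out shares by \<open>g j d\<close>,
  and fixes the shares in \<open>J\<close>, where \<open>d\<close> vanishes. \<open>F\<close> is
  arbitrary so that the squared amplitude with its case distinction can be inserted.\<close>

lemma secret_fibre_sum_translate:
  fixes K :: "'f::field set" and f g :: "nat \<Rightarrow> 'f \<Rightarrow> 'f" and c :: complex
  assumes K: "closed_ring K" and IL: "I \<subseteq> {1..L}" and Jn: "J \<subseteq> {1..n}"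
    and amp: "\<And>s y. amp s y = c * of_nat (card {h \<in> H. (\<forall>i\<in>{1..L}. f i h = s i) \<and> (\<forall>j\<in>{1..n}. g j h = y j)})"
    and H: "\<And>h h'. h \<in> H \<Longrightarrow> h' \<in> H \<Longrightarrow> h + h' \<in> H" "\<And>h h'. h \<in> H \<Longrightarrow> h' \<in> H \<Longrightarrow> h - h' \<in> H"
    and f: "\<And>i h. i \<in> {1..L} \<Longrightarrow> h \<in> H \<Longrightarrow> f i h \<in> K"
      "\<And>i h h'. i \<in> {1..L} \<Longrightarrow> h \<in> H \<Longrightarrow> h' \<in> H \<Longrightarrow> f i (h + h') = f i h + f i h'"
    and g: "\<And>j h. j \<in> {1..n} \<Longrightarrow> h \<in> H \<Longrightarrow> g j h \<in> K"
      "\<And>j h h'. j \<in> {1..n} \<Longrightarrow> h \<in> H \<Longrightarrow> h' \<in> H \<Longrightarrow> g j (h + h') = g j h + g j h'"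
    and d: "d \<in> H" "\<And>j. j \<in> J \<Longrightarrow> g j d = 0" "\<And>i. i \<in> I \<Longrightarrow> r' i = r i + f i d"
    and r: "r \<in> PiE I (\<lambda>_. K)" "r' \<in> PiE I (\<lambda>_. K)"
  shows "(\<Sum>(z, s)\<in>PiE ({1..n} - J) (\<lambda>_. K) \<times> {s \<in> PiE {1..L} (\<lambda>_. K). restrict s I = r}. F (amp s (\<lambda>j. if j \<in> J then a j else z j)))
    = (\<Sum>(z, s)\<in>PiE ({1..n} - J) (\<lambda>_. K) \<times> {s \<in> PiE {1..L} (\<lambda>_. K). restrict s I = r'}. F (amp s (\<lambda>j. if j \<in> J then a j else z j)))"
    (is "?lhs = ?rhs")
proof -
  let ?S = "PiE {1..L} (\<lambda>_. K)" and ?Z = "PiE ({1..n} - J) (\<lambda>_. K)"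
  let ?y = "\<lambda>z j. if j \<in> J then a j else z j"
  define \<phi> where "\<phi> = (\<lambda>(z, s). (\<lambda>j\<in>{1..n} - J. z j + g j d, \<lambda>i\<in>{1..L}. s i + f i d))"
  define \<psi> where "\<psi> = (\<lambda>(z, s). (\<lambda>j\<in>{1..n} - J. z j - g j d, \<lambda>i\<in>{1..L}. s i - f i d))"
  note Kr = closed_ringD[OF K]
  have amp_eq: "amp (\<lambda>i\<in>{1..L}. s i + f i d) (?y (\<lambda>j\<in>{1..n} - J. z j + g j d)) = amp s (?y z)" for s z
  proof -
    let ?A = "{h \<in> H. (\<forall>i\<in>{1..L}. f i h = s i) \<and> (\<forall>j\<in>{1..n}. g j h = ?y z j)}"
    let ?B = "{h \<in> H. (\<forall>i\<in>{1..L}. f i h = (\<lambda>i\<in>{1..L}. s i + f i d) i) \<and> (\<forall>j\<in>{1..n}. g j h = ?y (\<lambda>j\<in>{1..n} - J. z j + g j d) j)}"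
    have "bij_betw (\<lambda>h. h + d) ?A
       ?B"
    proof (rule bij_betw_byWitness[of _ "\<lambda>h. h - d"])
      show "(\<lambda>h. h + d) ` ?A \<subseteq>
       ?B"
        using d(1,2) H(1) f(2) g(2) by auto
      show "(\<lambda>h. h - d) ` ?B
        \<subseteq> ?A"
      proof (rule image_subsetI)
        fix h assume h: "h \<in> ?B"
        then have hd: "h - d \<in> H" using H(2) d(1) by blast
        have "f i (h - d) = s i" if "i \<in> {1..L}" for i
          using f(2)[OF that hd d(1)] h that by simp
        moreover have "g j (h - d) = ?y z j" if "j \<in> {1..n}" for j
        proof (cases "j \<in> J")
          case True then show ?thesis using g(2)[OF that hd d(1)] h that d(2) by simp
        next
          case False then show ?thesis using g(2)[OF that hd d(1)] h that by simp
        qed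
        ultimately show "h - d \<in> ?A" using hd by blast
      qed
    qed auto
    then show ?thesis unfolding amp by (simp only: bij_betw_same_card)
  qed
  show ?thesis
  proof (rule sum.reindex_bij_witness[of _ \<psi> \<phi>])
    fix p assume p: "p \<in> ?Z \<times> {s \<in> ?S. restrict s I = r}"
    then obtain z s where zs: "p = (z, s)" "z \<in> ?Z" "s \<in> ?S" "restrict s I = r" by auto
    show "\<psi> (\<phi> p) = p" unfolding zs(1) \<phi>_def \<psi>_def using zs(2,3)
      by (auto simp: fun_eq_iff restrict_def PiE_iff extensional_def)
    have "restrict (\<lambda>i\<in>{1..L}. s i + f i d) I = r'"
    proof
      fix i show "restrict (\<lambda>i\<in>{1..L}. s i + f i d) I i = r' i"
        using fun_cong[OF zs(4), of i] d(3)[of i] IL r(2) by (cases "i \<in> I") (auto simp: PiE_iff extensional_def)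
    qed
    then show "\<phi> p \<in> ?Z \<times> {s \<in> ?S. restrict s I = r'}"
      unfolding zs(1) \<phi>_def using zs(2,3) f(1) g(1) d(1) Kr(3) by (auto simp: PiE_iff)
    show "(case \<phi> p of (z, s) \<Rightarrow> F (amp s (?y z))) = (case p of (z, s) \<Rightarrow> F (amp s (?y z)))"
      unfolding zs(1) \<phi>_def by (simp only: case_prod_conv amp_eq)
  next
    fix p assume p: "p \<in> ?Z \<times> {s \<in> ?S. restrict s I = r'}"
    then obtain z s where zs: "p = (z, s)" "z \<in> ?Z" "s \<in> ?S" "restrict s I = r'" by auto
    show "\<phi> (\<psi> p) = p" unfolding zs(1) \<phi>_def \<psi>_def using zs(2,3)
      by (auto simp: fun_eq_iff restrict_def PiE_iff extensional_def)
    have "restrict (\<lambda>i\<in>{1..L}. s i - f i d) I = r"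
    proof
      fix i show "restrict (\<lambda>i\<in>{1..L}. s i - f i d) I i = r i"
        using fun_cong[OF zs(4), of i] d(3)[of i] IL r(1) by (cases "i \<in> I") (auto simp: PiE_iff extensional_def)
    qed
    then show "\<psi> p \<in> ?Z \<times> {s \<in> ?S. restrict s I = r}"
      unfolding zs(1) \<psi>_def using zs(2,3) f(1) g(1) d(1) Kr(6) by (auto simp: PiE_iff)
  qed
qed

section \<open>Strong security\<close>

lemma places_sum_apply:
  assumes "finite S" "inj_on P S"
  shows "places_sum P S X = (if X \<in> P ` S then 1 else 0)"
proof (cases "X \<in> P ` S")
  case True
  then obtain k where k: "k \<in> S" "X = P k" by blast
  have "places_sum P S X = (\<Sum>i\<in>S. if i = k then 1 else 0)"
    unfolding places_sum_def place_div_apply using k assms(2) by (intro sum.cong) (auto simp: inj_on_def)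
  then show ?thesis using True k assms(1) by simp
qed (auto simp: places_sum_def place_div_apply intro!: sum.neutral)

context ff_basis begin

lemma divisor_places_sum:
  assumes "finite S" "\<And>i. i \<in> S \<Longrightarrow> rational_place K (P i)"
  shows "divisor K (places_sum P S) \<and> div_deg K (places_sum P S) = int (card S)"
  using assms
proof (induction S rule: finite_induct)
  case empty
  then show ?case using divisor_zero by (simp add: places_sum_def)
next
  case (insert i S)
  have eq: "places_sum P (insert i S) = (\<lambda>X. place_div (P i) X + places_sum P S X)"
    unfolding places_sum_def using insert.hyps by auto
  have P: "P i \<in> places K" "place_degree K (P i) = 1" using insert.prems unfolding rational_place_def by auto
  show ?case unfolding eq
    using divisor_add[OF divisor_place_div(1)[OF P(1)], of "places_sum P S"] divisor_place_div(2)[OF P(1)] P(2) insert by auto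
qed

section \<open>Evaluation at rational places\<close>

lemma eval_at_props:
  assumes "rational_place K R" "h \<in> R"
  shows "eval_at K R h \<in> K" "h - eval_at K R h \<in> max_ideal R"
  using theI'[OF rational_residue[OF assms]] unfolding eval_at_def by auto

lemma eval_at_eqI:
  assumes "rational_place K R" "h \<in> R" "a \<in> K" "h - a \<in> max_ideal R"
  shows "eval_at K R h = a"
  using rational_residue[OF assms(1,2)] eval_at_props[OF assms(1,2)] assms(3,4) by blast

lemma eval_at_add:
  assumes rat: "rational_place K R" and h: "h \<in> R" "h' \<in> R"
  shows "eval_at K R (h + h') = eval_at K R h + eval_at K R h'"
proof -
  have R: "R \<in> places K" using rat unfolding rational_place_def by blast
  note e = eval_at_props[OF rat h(1)] eval_at_props[OF rat h(2)]
  have "(h - eval_at K R h) + (h' - eval_at K R h') \<in> max_ideal R" using max_ideal_add[OF R e(2,4)] .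
  then show ?thesis using e place_ringD(3)[OF R] h K_ring(3)
    by (intro eval_at_eqI[OF rat]) (auto simp: algebra_simps)
qed

lemma eval_at_scale:
  assumes rat: "rational_place K R" and h: "h \<in> R" "c \<in> K"
  shows "eval_at K R (c * h) = c * eval_at K R h"
proof -
  have R: "R \<in> places K" using rat unfolding rational_place_def by blast
  note e = eval_at_props[OF rat h(1)]
  have "c * (h - eval_at K R h) \<in> max_ideal R" using max_ideal_mult[OF R e(2)] place_K[OF R] h by blast
  then show ?thesis using e ksubspaceD(3)[OF ksubspace_place[OF R]] h K_ring(4)
    by (intro eval_at_eqI[OF rat]) (auto simp: right_diff_distrib)
qed

lemma eval_at_eq_0_iff:
  assumes rat: "rational_place K R" and h: "h \<in> R"
  shows "eval_at K R h = 0 \<longleftrightarrow> h \<in> max_ideal R"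
  using eval_at_props[OF assms] eval_at_eqI[OF assms K_ring(1)] by auto

lemma RR_mem_place: "h \<in> RR_space K A \<Longrightarrow> R \<in> places K \<Longrightarrow> A R = 0 \<Longrightarrow> h \<in> R"
  using val_ge_0[of R] unfolding mem_RR by fastforce

lemma RR_mem_max_ideal: "h \<in> RR_space K A \<Longrightarrow> R \<in> places K \<Longrightarrow> A R = - 1 \<Longrightarrow> h \<in> max_ideal R"
  using val_ge_1[of R] unfolding mem_RR by fastforce

end

theorem theorem1:
  fixes K :: "'f::field set" and G :: "'f set \<Rightarrow> int"
    and P Q :: "nat \<Rightarrow> 'f set" and n L :: nat and I J :: "nat set"
  assumes "function_field K" and "finite K"
    and "\<forall>j\<in>{1..n}. rational_place K (P j)"
    and "\<forall>i\<in>{1..L}. rational_place K (Q i)"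
    and "inj_on P {1..n}" and "inj_on Q {1..L}" and "P ` {1..n} \<inter> Q ` {1..L} = {}"
    and "divisor K G"
    and "\<forall>j\<in>{1..n}. G (P j) = 0" and "\<forall>i\<in>{1..L}. G (Q i) = 0"
    and "int L = int (ell K G) - int (ell K (G - places_sum Q {1..L}))"
    and "ell K (G - places_sum P {1..n}) = 0"
    and "I \<subseteq> {1..L}" and "J \<subseteq> {1..n}"
    and "int (card J) \<le> int (card ({1..L} - I)) +
           min (div_deg K G - int L - 2 * genus K + 1) (int n - 1 - div_deg K G)"
  shows "strongly_secure K L n (qrss_encode K G P Q n L) I J"
proof (cases "I = {}")
  \<comment> \<open>Over an empty index set a density operator is the 1 by 1 matrix with entry 1, so
    both inputs are the same state.\<close>
  case True
  show ?thesis
    unfolding strongly_secure_def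
  proof (intro allI impI ballI)
    fix \<rho>1 \<rho>2 :: "(nat \<Rightarrow> 'f) \<Rightarrow> (nat \<Rightarrow> 'f) \<Rightarrow> complex" and a b
    assume d: "density_op (PiE I (\<lambda>_. K)) \<rho>1" "density_op (PiE I (\<lambda>_. K)) \<rho>2"
    have "\<rho>1 (\<lambda>_. undefined) (\<lambda>_. undefined) = 1" "\<rho>2 (\<lambda>_. undefined) (\<lambda>_. undefined) = 1"
      using d unfolding density_op_def True by auto
    then have "tensor_mixed K L I \<rho>1 = tensor_mixed K L I \<rho>2"
      unfolding tensor_mixed_def True by (simp add: restrict_def fun_eq_iff)
    then show "reduced_state K n J (qrss_encode K G P Q n L (tensor_mixed K L I \<rho>1)) a b =
      reduced_state K n J (qrss_encode K G P Q n L (tensor_mixed K L I \<rho>2)) a b" by simp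
  qed
next
  case False
  then obtain i0 where i0: "i0 \<in> I" by blast
  obtain x N u where "ff_basis K x N u" using function_field_imp_ff_basis[OF assms(1)] by blast
  then interpret ff_basis K x N u .
  \<comment> \<open>The chosen index of \<open>I\<close> provides the rational place.\<close>
  interpret ff_rational K x N u "Q i0" using assms(4,13) i0 by unfold_locales auto
  let ?H = "RR_space K G" and ?D = "\<lambda>S T X. G X - (places_sum P S X + places_sum Q T X)"
  have Pr: "rational_place K (P j)" "P j \<in> places K" "G (P j) = 0" if "j \<in> {1..n}" for j
    using assms(3,9) that unfolding rational_place_def by auto
  have Qr: "rational_place K (Q i)" "Q i \<in> places K" "G (Q i) = 0" if "i \<in> {1..L}" for i
    using assms(4,10) that unfolding rational_place_def by auto
  have fI: "finite I" and fJ: "finite J" using assms(13,14) finite_subset by blast+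
  have card_I: "int (card ({1..L} - I)) = int L - int (card I)"
    using card_Diff_subset[OF fI assms(13)] card_mono[OF _ assms(13)] by simp
  have card_J: "int (card ({1..n} - J)) = int n - int (card J)"
    using card_Diff_subset[OF fJ assms(14)] card_mono[OF _ assms(14)] by simp
  have HP: "h \<in> P j" if "h \<in> ?H" "j \<in> {1..n}" for h j using RR_mem_place Pr that by blast
  have HQ: "h \<in> Q i" if "h \<in> ?H" "i \<in> {1..L}" for h i using RR_mem_place Qr that by blast
  have PQ: "P j \<noteq> Q i" if "j \<in> {1..n}" "i \<in> {1..L}" for i j using assms(7) that by blast
  have dsum: "divisor K (?D S T)"
    "div_deg K (?D S T) = div_deg K G - int (card S) - int (card T)"
    if "S \<subseteq> {1..n}" "T \<subseteq> {1..L}" for S T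
  proof -
    have "finite S" "finite T" using that finite_subset by blast+
    then have *: "divisor K (places_sum P S) \<and> div_deg K (places_sum P S) = int (card S)"
      "divisor K (places_sum Q T) \<and> div_deg K (places_sum Q T) = int (card T)"
      using divisor_places_sum[of S P] divisor_places_sum[of T Q] Pr(1) Qr(1) that by blast+
    show "divisor K (?D S T)"
      "div_deg K (?D S T) = div_deg K G - int (card S) - int (card T)"
      using divisor_diff[OF assms(8) divisor_add(1)] divisor_add(2) * by auto
  qed
  \<comment> \<open>The places are distinct and \<open>G\<close> is 0 at them, so the coefficient is
    -1 at the chosen places and unchanged elsewhere: membership in the space means vanishing at the
    chosen places.\<close>
  have val: "G X - (places_sum P S X + places_sum Q T X) =
      (if X \<in> P ` S \<or> X \<in> Q ` T then - 1 else G X)" if "S \<subseteq> {1..n}" "T \<subseteq> {1..L}" for S T X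
  proof -
    have "places_sum P S X = (if X \<in> P ` S then 1 else 0)" "places_sum Q T X = (if X \<in> Q ` T then 1 else 0)"
      using places_sum_apply that assms(5,6) inj_on_subset finite_subset by (metis finite_atLeastAtMost)+
    moreover have "\<not> (X \<in> P ` S \<and> X \<in> Q ` T)" using PQ that by blast
    moreover have "G X = 0" if "X \<in> P ` S \<or> X \<in> Q ` T" using that Pr(3) Qr(3) \<open>S \<subseteq> _\<close> \<open>T \<subseteq> _\<close> by blast
    ultimately show ?thesis by auto
  qed
  have vanish: "h \<in> RR_space K (?D S T)"
    if ST: "S \<subseteq> {1..n}" "T \<subseteq> {1..L}" and h: "h \<in> ?H" "\<And>j. j \<in> S \<Longrightarrow> h \<in> max_ideal (P j)" "\<And>i. i \<in> T \<Longrightarrow> h \<in> max_ideal (Q i)" for S T h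
    unfolding mem_RR val[OF ST]
  proof
    fix X assume X: "X \<in> places K"
    show "h \<in> val_ge X (- (if X \<in> P ` S \<or> X \<in> Q ` T then - 1 else G X))"
      using X h val_ge_1[OF X] unfolding mem_RR by auto
  qed
  have inj: "h = h'" if h: "h \<in> ?H" "h' \<in> ?H"
    and eQ: "\<And>i. i \<in> {1..L} - I \<Longrightarrow> eval_at K (Q i) h = eval_at K (Q i) h'"
    and eP: "\<And>j. j \<in> {1..n} - J \<Longrightarrow> eval_at K (P j) h = eval_at K (P j) h'" for h h'
  proof -
    have max: "h - h' \<in> max_ideal R" if "rational_place K R" "h \<in> R" "h' \<in> R" "eval_at K R h = eval_at K R h'" for R
    proof -
      have R: "R \<in> places K" using that unfolding rational_place_def by blast
      have "(h - eval_at K R h) - (h' - eval_at K R h') \<in> max_ideal R"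
        using ksubspace_diff[OF ksubspace_max_ideal[OF R]] eval_at_props that by blast
      then show ?thesis using that(4) by simp
    qed
    have "h - h' \<in> RR_space K (?D ({1..n} - J) ({1..L} - I))"
      by (rule vanish) (use h HP HQ Pr(1) Qr(1) eQ eP max ksubspace_diff[OF ksubspace_RR] in auto)
    \<comment> \<open>The degree is deg G - (n - |J|) - (L - |I|), which the term n - 1 - deg G of
      the minimum bounds by -1.\<close>
    moreover have "div_deg K (?D ({1..n} - J) ({1..L} - I)) < 0"
      using dsum(2)[OF Diff_subset Diff_subset, of J I] card_J assms(15) by linarith
    ultimately have "h - h' = 0" using RR_neg_deg[OF dsum(1)[OF Diff_subset Diff_subset]] by blast
    then show ?thesis by simp
  qed
  have surj: "\<exists>d\<in>?H. (\<forall>j\<in>J. eval_at K (P j) d = 0) \<and> (\<forall>i\<in>I. eval_at K (Q i) d = r i)"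
    if r: "\<And>i. i \<in> I \<Longrightarrow> r i \<in> K" for r
  proof -
    let ?A = "?D J I"
    \<comment> \<open>The degree is deg G - |J| - |I|; the other term of the minimum gives exactly
      this bound.\<close>
    have "div_deg K ?A \<ge> 2 * genus K - 1"
      using dsum(2)[OF assms(14,13)] card_I assms(15) by linarith
    then have "\<exists>z\<in>RR_space K (\<lambda>X. ?A X + place_div (Q i) X). z \<notin> RR_space K ?A" if "i \<in> I" for i
      using RR_add_rational_place_strict[OF _ dsum(1)[OF assms(14,13)]] Qr(1) assms(13) that by blast
    \<comment> \<open>A dual family: \<open>e i\<close> vanishes at the \<open>P j\<close> with j in
      \<open>J\<close> and at the other \<open>Q k\<close> with k in \<open>I\<close>. Being outside
      the space of \<open>?A\<close>, it cannot vanish at \<open>Q i\<close> as well.\<close>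
    then obtain e where e: "\<And>i. i \<in> I \<Longrightarrow> e i \<in> RR_space K (\<lambda>X. ?A X + place_div (Q i) X)"
      "\<And>i. i \<in> I \<Longrightarrow> e i \<notin> RR_space K ?A" by metis
    have eH: "e i \<in> ?H" if "i \<in> I" for i
    proof -
      have "?A X + place_div (Q i) X \<le> G X" for X
        unfolding val[OF assms(14,13)] using Pr(3) Qr(3) assms(13,14) that by (auto simp: place_div_apply)
      then show ?thesis using RR_mono[of "\<lambda>X. ?A X + place_div (Q i) X" G] e(1)[OF that] by blast
    qed
    have eP: "e i \<in> max_ideal (P j)" if "i \<in> I" "j \<in> J" for i j
    proof (rule RR_mem_max_ideal[OF e(1)[OF that(1)]])
      have "P j \<noteq> Q i" using PQ that assms(13,14) by blast
      then show "?A (P j) + place_div (Q i) (P j) = - 1" using that by (simp add: val[OF assms(14,13)] place_div_apply)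
      show "P j \<in> places K" using that assms(14) Pr(2) by blast
    qed
    have eQ: "e i \<in> max_ideal (Q k)" if "i \<in> I" "k \<in> I" "k \<noteq> i" for i k
    proof (rule RR_mem_max_ideal[OF e(1)[OF that(1)]])
      have "Q k \<noteq> Q i" using that assms(6,13) unfolding inj_on_def by blast
      then show "?A (Q k) + place_div (Q i) (Q k) = - 1" using that by (simp add: val[OF assms(14,13)] place_div_apply)
    qed (use that assms(13) Qr(2) in auto)
    have ne: "eval_at K (Q i) (e i) \<noteq> 0" if i: "i \<in> I" for i
    proof
      assume "eval_at K (Q i) (e i) = 0"
      then have "e i \<in> max_ideal (Q i)" using eval_at_eq_0_iff Qr(1) HQ eH i assms(13) by blast
      then have "e i \<in> RR_space K ?A"
        using eH[OF i] eP[OF i] eQ[OF i] by (intro vanish assms) auto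
      then show False using e(2)[OF i] by blast
    qed
    \<comment> \<open>Lagrange interpolation with the dual family.\<close>
    define c where "c = (\<lambda>i. r i / eval_at K (Q i) (e i))"
    have cK: "c i \<in> K" if "i \<in> I" for i
      unfolding c_def using r that eval_at_props(1) Qr(1) HQ eH assms(13) by (intro K_divide) blast+
    let ?d = "\<lambda>S. \<Sum>i\<in>S. c i * e i"
    have dH: "?d S \<in> ?H" if "S \<subseteq> I" for S
      using that eH cK by (intro ksubspace_lincomb[OF ksubspace_RR]) auto
    have dR: "eval_at K R (?d S) = (\<Sum>i\<in>S. c i * eval_at K R (e i))"
      if "rational_place K R" "\<And>h. h \<in> ?H \<Longrightarrow> h \<in> R" "S \<subseteq> I" for R S
    proof -
      have "finite S" using that(3) fI finite_subset by blast
      then show ?thesis using that(3)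
      proof (induction S rule: finite_induct)
        case empty
        have "(0::'f) \<in> R" using that(2) dH[of "{}"] by simp
        moreover from this have "(0::'f) \<in> max_ideal R" unfolding max_ideal_def by simp
        ultimately show ?case using eval_at_eq_0_iff[OF that(1)] by simp
      next
        case (insert i S)
        have "c i * e i \<in> ?H" using ksubspaceD(3)[OF ksubspace_RR] cK eH insert.prems by auto
        then show ?case
          using insert eval_at_add[OF that(1), of "c i * e i" "?d S"] eval_at_scale[OF that(1), of "e i" "c i"]
            that(2) dH[of S] eH[of i] cK[of i] by simp
      qed
    qed
    have "eval_at K (P j) (?d I) = 0" if "j \<in> J" for j
    proof -
      have "eval_at K (P j) (e i) = 0" if "i \<in> I" for i
        using eval_at_eq_0_iff Pr(1) HP eH eP that \<open>j \<in> J\<close> assms(14) by blast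
      then show ?thesis using dR[of "P j" I] Pr(1) HP that assms(14) by auto
    qed
    moreover have "eval_at K (Q k) (?d I) = r k" if k: "k \<in> I" for k
    proof -
      have kL: "k \<in> {1..L}" using k assms(13) by blast
      have "eval_at K (Q k) (e i) = 0" if "i \<in> I" "i \<noteq> k" for i
        using eval_at_eq_0_iff[OF Qr(1)[OF kL] HQ[OF eH[OF that(1)] kL]] eQ[OF that(1) k] that(2) by simp
      then have "(\<Sum>i\<in>I. c i * eval_at K (Q k) (e i)) = (\<Sum>i\<in>I. if i = k then c k * eval_at K (Q k) (e k) else 0)"
        by (intro sum.cong) auto
      also have "\<dots> = r k" using k fI ne[OF k] by (simp add: c_def)
      finally show ?thesis using dR[OF Qr(1)[OF kL] HQ[OF _ kL] subset_refl] by simp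
    qed
    ultimately show ?thesis using dH[of I] by blast
  qed
  have fK: "eval_at K (Q i) h \<in> K" if "i \<in> {1..L}" "h \<in> ?H" for i h
    by (rule eval_at_props(1)[OF Qr(1)[OF that(1)] HQ[OF that(2,1)]])
  have f_add: "eval_at K (Q i) (h + h') = eval_at K (Q i) h + eval_at K (Q i) h'"
    if "i \<in> {1..L}" "h \<in> ?H" "h' \<in> ?H" for i h h'
    by (rule eval_at_add[OF Qr(1)[OF that(1)] HQ[OF that(2,1)] HQ[OF that(3,1)]])
  have gK: "eval_at K (P j) h \<in> K" if "j \<in> {1..n}" "h \<in> ?H" for j h
    by (rule eval_at_props(1)[OF Pr(1)[OF that(1)] HP[OF that(2,1)]])
  have g_add: "eval_at K (P j) (h + h') = eval_at K (P j) h + eval_at K (P j) h'"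
    if "j \<in> {1..n}" "h \<in> ?H" "h' \<in> ?H" for j h h'
    by (rule eval_at_add[OF Pr(1)[OF that(1)] HP[OF that(2,1)] HP[OF that(3,1)]])
  let ?amp = "qrss_amp K G P Q n L"
  show ?thesis
    unfolding strongly_secure_def
  proof (intro allI impI ballI)
    fix \<rho>1 \<rho>2 :: "(nat \<Rightarrow> 'f) \<Rightarrow> (nat \<Rightarrow> 'f) \<Rightarrow> complex" and a b
    assume d: "density_op (PiE I (\<lambda>_. K)) \<rho>1" "density_op (PiE I (\<lambda>_. K)) \<rho>2"
      and ab: "a \<in> PiE J (\<lambda>_. K)" "b \<in> PiE J (\<lambda>_. K)"
    let ?T = "\<lambda>r. \<Sum>(z, s)\<in>PiE ({1..n} - J) (\<lambda>_. K) \<times> {s \<in> PiE {1..L} (\<lambda>_. K). restrict s I = r}.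
       if a = b then ?amp s (\<lambda>j. if j \<in> J then a j else z j) * cnj (?amp s (\<lambda>j. if j \<in> J then a j else z j))
          / of_nat (card K ^ card ({1..L} - I)) else 0"
    have red: "reduced_state K n J (qrss_encode K G P Q n L (tensor_mixed K L I \<rho>)) a b =
      (\<Sum>r\<in>PiE I (\<lambda>_. K). \<rho> r r * ?T r)" for \<rho>
      by (rule reduced_state_eq_sum_diag[OF assms(2,13,14) qrss_amp_def inj ab qrss_encode_def])
    \<comment> \<open>Each weight is compared with that of the zero word; a function that
      interpolates \<open>r\<close> translates one fibre into the other.\<close>
    let ?r0 = "\<lambda>i\<in>I. (0::'f)"
    have r0: "?r0 \<in> PiE I (\<lambda>_. K)" using K_ring(1) by auto
    have T: "?T r = ?T ?r0" if r: "r \<in> PiE I (\<lambda>_. K)" for r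
    proof -
      obtain d where dd: "d \<in> ?H" "\<And>j. j \<in> J \<Longrightarrow> eval_at K (P j) d = 0" "\<And>i. i \<in> I \<Longrightarrow> eval_at K (Q i) d = r i"
        using surj[of r] r by (auto simp: PiE_iff)
      have dr: "r i = ?r0 i + eval_at K (Q i) d" if "i \<in> I" for i using dd(3) that by simp
      have "?T ?r0 = ?T r"
        by (rule secret_fibre_sum_translate[OF closed_ring_K assms(13,14) qrss_amp_def
              ksubspaceD(2)[OF ksubspace_RR] ksubspace_diff[OF ksubspace_RR] fK f_add gK g_add dd(1,2) dr r0 r,
              where F = "\<lambda>w. if a = b then w * cnj w / of_nat (card K ^ card ({1..L} - I)) else 0"])
      then show ?thesis by simp
    qed
    have weighted: "(\<Sum>r\<in>PiE I (\<lambda>_. K). \<rho> r r * t r) = t0"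
      if "density_op (PiE I (\<lambda>_. K)) \<rho>" "\<And>r. r \<in> PiE I (\<lambda>_. K) \<Longrightarrow> t r = t0"
      for \<rho> :: "(nat \<Rightarrow> 'f) \<Rightarrow> (nat \<Rightarrow> 'f) \<Rightarrow> complex" and t t0
    proof -
      have tr: "(\<Sum>r\<in>PiE I (\<lambda>_. K). \<rho> r r) = 1" using that(1) unfolding density_op_def by (elim conjE)
      have "(\<Sum>r\<in>PiE I (\<lambda>_. K). \<rho> r r * t r) = (\<Sum>r\<in>PiE I (\<lambda>_. K). \<rho> r r * t0)"
        by (rule sum.cong[OF refl]) (simp only: that(2))
      also have "\<dots> = (\<Sum>r\<in>PiE I (\<lambda>_. K). \<rho> r r) * t0" by (rule sum_distrib_right[symmetric])
      finally show ?thesis by (simp only: tr mult_1_left)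
    qed
    show "reduced_state K n J (qrss_encode K G P Q n L (tensor_mixed K L I \<rho>1)) a b =
      reduced_state K n J (qrss_encode K G P Q n L (tensor_mixed K L I \<rho>2)) a b"
      using red[of \<rho>1] red[of \<rho>2] weighted[of \<rho>1 ?T "?T ?r0", OF d(1) T] weighted[of \<rho>2 ?T "?T ?r0", OF d(2) T]
      by (simp only:)
  qed
qed

end
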